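(* Let $(M,g_M)$ be a complete connected Riemannian manifold of dimension $m>1$ with constant sectional curvature $K$, let $c_1>0$, and let $r_0=\sqrt{-c_1/K}$ if $K<0$ and $r_0=+\infty$ if $K\ge0$. Then the Kähler metric $$g_{\mathcal{T}_{M,r_0}}=\sqrt{c_1+Kr^2}\;\pi^*g_M+\frac{1}{\sqrt{c_1+Kr^2}}\;\pi^{\star}g_M$$ on the disk bundle $\mathcal{T}_{M,r_0}$ is complete if $K\ge0$ and is not complete if $K<0$.
   Context: Let $\pi:\mathcal{T}_M\to M$ be the total space of the tangent bundle of $M$, $\mathcal{T}_{M,r_0}=\{u\in\mathcal{T}_M:\ \|u\|_M<r_0\}$ (all of $\mathcal{T}_M$ if $r_0=+\infty$), and $r=r(u)=\|u\|_M$. The Levi-Civita connection $\nabla$ of $g_M$ induces a splitting $T\mathcal{T}_M=H^\nabla\oplus V$ into horizontal and vertical ($V=\ker\mathrm{d}\pi$) sub-bundles, each canonically isomorphic to $\pi^*TM$. For $w\in T_{\pi(u)}M$ let $w^h\in H^\nabla_u$, $w^v\in V_u$ be the horizontal and vertical lifts. Then $\pi^*g_M$ denotes the symmetric 2-tensor with $\pi^*g_M(w^h,z^h)=g_M(w,z)$ vanishing when one argument is vertical, and $\pi^\star g_M$ the symmetric 2-tensor with $\pi^\star g_M(w^v,z^v)=g_M(w,z)$ vanishing when one argument is horizontal. The metric is Kähler with respect to the complex structure $J(w^h)=\sqrt{c_1+Kr^2}\,w^v$, $J(w^v)=-\frac{1}{\sqrt{c_1+Kr^2}}w^h$. *)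

theory Defs
  imports "HOL-Analysis.Analysis"
begin

section \<open>Smooth manifolds\<close>

text \<open>
  A chart is its domain together with its coordinate map; the values of the map outside the domain
  carry no meaning. A manifold is given by a smooth atlas (not necessarily maximal) on the
  union of the chart domains; its topology is the one induced by the atlas. The dimension is
  \<open>DIM('b)\<close>.
\<close>

type_synonym ('a, 'b) chart = "'a set \<times> ('a \<Rightarrow> 'b)"

text \<open>Meant for open \<open>S\<close> only.\<close>

primrec Ck_on :: "nat \<Rightarrow> 'b::euclidean_space set \<Rightarrow> ('b \<Rightarrow> 'c::real_normed_vector) \<Rightarrow> bool" where
  "Ck_on 0 S f \<longleftrightarrow> continuous_on S f"
| "Ck_on (Suc k) S f \<longleftrightarrow> (\<forall>x\<in>S. f differentiable (at x)) \<and>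
     (\<forall>v. Ck_on k S (\<lambda>x. frechet_derivative f (at x) v))"

definition smooth_on :: "'b::euclidean_space set \<Rightarrow> ('b \<Rightarrow> 'c::real_normed_vector) \<Rightarrow> bool" where
  "smooth_on S f \<longleftrightarrow> (\<forall>k. Ck_on k S f)"

definition chart_inv :: "('a, 'b) chart \<Rightarrow> 'b \<Rightarrow> 'a" where
  "chart_inv c = inv_into (fst c) (snd c)"

definition transition :: "('a, 'b) chart \<Rightarrow> ('a, 'b) chart \<Rightarrow> 'b \<Rightarrow> 'b" where
  "transition c d = snd d \<circ> chart_inv c"

definition manifold_points :: "('a, 'b) chart set \<Rightarrow> 'a set" where
  "manifold_points A = \<Union> (fst ` A)"

definition atlas_topology :: "('a, 'b::euclidean_space) chart set \<Rightarrow> 'a topology" where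
  "atlas_topology A = topology_generated_by {fst c \<inter> snd c -` B | c B. c \<in> A \<and> open B}"

definition smooth_manifold :: "('a, 'b::euclidean_space) chart set \<Rightarrow> bool" where
  "smooth_manifold A \<longleftrightarrow>
     manifold_points A \<noteq> {} \<and>
     (\<forall>c\<in>A. inj_on (snd c) (fst c) \<and> open (snd c ` fst c)) \<and>
     (\<forall>c\<in>A. \<forall>d\<in>A. open (snd c ` (fst c \<inter> fst d)) \<and>
        smooth_on (snd c ` (fst c \<inter> fst d)) (transition c d)) \<and>
     Hausdorff_space (atlas_topology A) \<and> second_countable (atlas_topology A)"

text \<open>
  A tangent vector at \<open>p\<close> is the family of its components in all charts around \<open>p\<close>, related by the
  differentials of the transition maps (and \<open>0\<close> in the charts not containing \<open>p\<close>), so that the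
  vector space operations are pointwise.
\<close>

type_synonym ('a, 'b) tvec = "('a, 'b) chart \<Rightarrow> 'b"

definition tangent_space ::
  "('a, 'b::euclidean_space) chart set \<Rightarrow> 'a \<Rightarrow> ('a, 'b) tvec set" where
  "tangent_space A p = {v.
     (\<forall>c. \<not> (c \<in> A \<and> p \<in> fst c) \<longrightarrow> v c = 0) \<and>
     (\<forall>c\<in>A. \<forall>d\<in>A. p \<in> fst c \<longrightarrow> p \<in> fst d \<longrightarrow>
        v d = frechet_derivative (transition c d) (at (snd c p)) (v c))}"

text \<open>The tangent vector at \<open>p\<close> whose components in the chart \<open>c\<close> are \<open>x\<close>.\<close>

definition chart_vec ::
  "('a, 'b::euclidean_space) chart set \<Rightarrow> ('a, 'b) chart \<Rightarrow> 'a \<Rightarrow> 'b \<Rightarrow> ('a, 'b) tvec" where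
  "chart_vec A c p x = (\<lambda>d. if d \<in> A \<and> p \<in> fst d
     then frechet_derivative (transition c d) (at (snd c p)) x else 0)"


section \<open>Riemannian metrics, distance and completeness\<close>

type_synonym ('a, 'b) metric_tensor = "'a \<Rightarrow> ('a, 'b) tvec \<Rightarrow> ('a, 'b) tvec \<Rightarrow> real"

definition metric_in_chart :: "('a, 'b::euclidean_space) chart set \<Rightarrow> ('a, 'b) metric_tensor \<Rightarrow>
    ('a, 'b) chart \<Rightarrow> 'b \<Rightarrow> 'b \<Rightarrow> 'b \<Rightarrow> real" where
  "metric_in_chart A g c y v w =
     g (chart_inv c y) (chart_vec A c (chart_inv c y) v) (chart_vec A c (chart_inv c y) w)"

definition riemannian_metric ::
  "('a, 'b::euclidean_space) chart set \<Rightarrow> ('a, 'b) metric_tensor \<Rightarrow> bool" where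
  "riemannian_metric A g \<longleftrightarrow>
     (\<forall>p\<in>manifold_points A. \<forall>u\<in>tangent_space A p. \<forall>v\<in>tangent_space A p.
        g p u v = g p v u \<and>
        (u \<noteq> (\<lambda>c. 0) \<longrightarrow> g p u u > 0) \<and>
        (\<forall>w\<in>tangent_space A p. \<forall>a b.
           g p (\<lambda>c. a *\<^sub>R u c + b *\<^sub>R v c) w = a * g p u w + b * g p v w)) \<and>
     (\<forall>c\<in>A. \<forall>v w. smooth_on (snd c ` fst c) (\<lambda>y. metric_in_chart A g c y v w))"

definition tnorm :: "('a, 'b) metric_tensor \<Rightarrow> 'a \<Rightarrow> ('a, 'b) tvec \<Rightarrow> real" where
  "tnorm g p v = sqrt (g p v v)"

text \<open>
  Paths that are \<open>C\<^sup>1\<close>, up to and including the end points, on the closed pieces between finitely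
  many break points. Unlike the library's \<open>piecewise_C1_differentiable_on\<close>, this makes the
  one-sided derivatives at the break points exist, so that the speed is bounded and integrable.
\<close>

definition piecewise_C1_path ::
  "('a, 'b::euclidean_space) chart set \<Rightarrow> (real \<Rightarrow> 'a) \<Rightarrow> bool" where
  "piecewise_C1_path A \<gamma> \<longleftrightarrow> pathin (atlas_topology A) \<gamma> \<and>
     (\<exists>S. finite S \<and>
        (\<forall>c\<in>A. \<forall>a b. 0 \<le> a \<and> a < b \<and> b \<le> 1 \<and> {a<..<b} \<inter> S = {} \<and> \<gamma> ` {a..b} \<subseteq> fst c \<longrightarrow>
           (\<exists>D. continuous_on {a..b} D \<and>
              (\<forall>t\<in>{a..b}. ((snd c \<circ> \<gamma>) has_vector_derivative D t) (at t within {a..b})))))"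

definition velocity ::
  "('a, 'b::euclidean_space) chart set \<Rightarrow> (real \<Rightarrow> 'a) \<Rightarrow> real \<Rightarrow> ('a, 'b) tvec" where
  "velocity A \<gamma> t = (\<lambda>c. if c \<in> A \<and> \<gamma> t \<in> fst c
     then vector_derivative (snd c \<circ> \<gamma>) (at t within {0..1}) else 0)"

definition riemannian_length ::
  "('a, 'b::euclidean_space) chart set \<Rightarrow> ('a, 'b) metric_tensor \<Rightarrow> (real \<Rightarrow> 'a) \<Rightarrow> real" where
  "riemannian_length A g \<gamma> = integral {0..1} (\<lambda>t. tnorm g (\<gamma> t) (velocity A \<gamma> t))"

text \<open>Meaningful on connected manifolds, where the infimum is over a nonempty set. The library's
  locale \<open>Metric_space\<close> wants symmetry and nonnegativity off the carrier too, hence the value \<open>0\<close>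
  there.\<close>

definition riemannian_dist ::
  "('a, 'b::euclidean_space) chart set \<Rightarrow> ('a, 'b) metric_tensor \<Rightarrow> 'a \<Rightarrow> 'a \<Rightarrow> real" where
  "riemannian_dist A g p q =
     (if p \<in> manifold_points A \<and> q \<in> manifold_points A
      then INF \<gamma> \<in> {\<gamma>. piecewise_C1_path A \<gamma> \<and> \<gamma> 0 = p \<and> \<gamma> 1 = q}. riemannian_length A g \<gamma>
      else 0)"

definition riemannian_complete ::
  "('a, 'b::euclidean_space) chart set \<Rightarrow> ('a, 'b) metric_tensor \<Rightarrow> bool" where
  "riemannian_complete A g \<longleftrightarrow>
     Metric_space.mcomplete (manifold_points A) (riemannian_dist A g)"


section \<open>Levi-Civita connection and sectional curvature\<close>

text \<open>
  In a chart a connection is \<open>\<nabla>\<^sub>X Y = D Y(X) + \<Gamma>(X, Y)\<close> with a field \<open>\<Gamma>\<close> of bilinear maps.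
  The Levi-Civita connection is the unique one that is torsion-free (\<open>\<Gamma>\<close> symmetric) and
  compatible with the metric.
\<close>

definition christoffel :: "('a, 'b::euclidean_space) chart set \<Rightarrow> ('a, 'b) metric_tensor \<Rightarrow>
    ('a, 'b) chart \<Rightarrow> 'b \<Rightarrow> 'b \<Rightarrow> 'b \<Rightarrow> 'b" where
  "christoffel A g c y = (THE \<Gamma>. bilinear \<Gamma> \<and> (\<forall>v w. \<Gamma> v w = \<Gamma> w v) \<and>
     (\<forall>u v w. frechet_derivative (\<lambda>z. metric_in_chart A g c z v w) (at y) u =
        metric_in_chart A g c y (\<Gamma> u v) w + metric_in_chart A g c y v (\<Gamma> u w)))"

text \<open>The next three operators act on vector fields expressed in the coordinates of one chart.\<close>

definition cov_deriv :: "('a, 'b::euclidean_space) chart set \<Rightarrow> ('a, 'b) metric_tensor \<Rightarrow>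
    ('a, 'b) chart \<Rightarrow> ('b \<Rightarrow> 'b) \<Rightarrow> ('b \<Rightarrow> 'b) \<Rightarrow> 'b \<Rightarrow> 'b" where
  "cov_deriv A g c X Y y =
     frechet_derivative Y (at y) (X y) + christoffel A g c y (X y) (Y y)"

definition lie_bracket :: "('b::euclidean_space \<Rightarrow> 'b) \<Rightarrow> ('b \<Rightarrow> 'b) \<Rightarrow> 'b \<Rightarrow> 'b" where
  "lie_bracket X Y y = frechet_derivative Y (at y) (X y) - frechet_derivative X (at y) (Y y)"

definition curvature_op :: "('a, 'b::euclidean_space) chart set \<Rightarrow> ('a, 'b) metric_tensor \<Rightarrow>
    ('a, 'b) chart \<Rightarrow> ('b \<Rightarrow> 'b) \<Rightarrow> ('b \<Rightarrow> 'b) \<Rightarrow> ('b \<Rightarrow> 'b) \<Rightarrow> 'b \<Rightarrow> 'b" where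
  "curvature_op A g c X Y Z y =
     cov_deriv A g c X (cov_deriv A g c Y Z) y - cov_deriv A g c Y (cov_deriv A g c X Z) y
     - cov_deriv A g c (lie_bracket X Y) Z y"

text \<open>By tensoriality any extensions of the vectors will do; those with constant components in
  the chart at hand are used.\<close>

definition curvature :: "('a, 'b::euclidean_space) chart set \<Rightarrow> ('a, 'b) metric_tensor \<Rightarrow> 'a \<Rightarrow>
    ('a, 'b) tvec \<Rightarrow> ('a, 'b) tvec \<Rightarrow> ('a, 'b) tvec \<Rightarrow> ('a, 'b) tvec" where
  "curvature A g p u v w = (\<lambda>c. if c \<in> A \<and> p \<in> fst c
     then curvature_op A g c (\<lambda>_. u c) (\<lambda>_. v c) (\<lambda>_. w c) (snd c p) else 0)"

definition sectional_curvature :: "('a, 'b::euclidean_space) chart set \<Rightarrow>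
    ('a, 'b) metric_tensor \<Rightarrow> 'a \<Rightarrow> ('a, 'b) tvec \<Rightarrow> ('a, 'b) tvec \<Rightarrow> real" where
  "sectional_curvature A g p v w =
     g p (curvature A g p v w w) v / (g p v v * g p w w - (g p v w)\<^sup>2)"

definition constant_sectional_curvature ::
  "('a, 'b::euclidean_space) chart set \<Rightarrow> ('a, 'b) metric_tensor \<Rightarrow> real \<Rightarrow> bool" where
  "constant_sectional_curvature A g K \<longleftrightarrow>
     (\<forall>p\<in>manifold_points A. \<forall>v\<in>tangent_space A p. \<forall>w\<in>tangent_space A p.
        (\<forall>a b. (\<lambda>c. a *\<^sub>R v c + b *\<^sub>R w c) = (\<lambda>c. 0) \<longrightarrow> a = 0 \<and> b = 0) \<longrightarrow>
        sectional_curvature A g p v w = K)"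


section \<open>The tangent bundle and its horizontal and vertical lifts\<close>

text \<open>
  Points of the total space are pairs \<open>(p, u)\<close> with \<open>u\<close> tangent at \<open>p\<close>, and a chart \<open>c\<close> induces
  the bundle chart \<open>(p, u) \<mapsto> (c(p), u\<^sub>c)\<close>. Everything is relative to an open subset \<open>W\<close> of the
  total space, to which the bundle charts are restricted.
\<close>

definition total_space ::
  "('a, 'b::euclidean_space) chart set \<Rightarrow> ('a \<times> ('a, 'b) tvec) set" where
  "total_space A = (SIGMA p : manifold_points A. tangent_space A p)"

definition bundle_chart :: "('a, 'b::euclidean_space) chart set \<Rightarrow> ('a \<times> ('a, 'b) tvec) set \<Rightarrow>
    ('a, 'b) chart \<Rightarrow> ('a \<times> ('a, 'b) tvec, 'b \<times> 'b) chart" where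
  "bundle_chart A W c =
     ((SIGMA p : fst c. tangent_space A p) \<inter> W, \<lambda>(p, u). (snd c p, u c))"

definition bundle_atlas :: "('a, 'b::euclidean_space) chart set \<Rightarrow> ('a \<times> ('a, 'b) tvec) set \<Rightarrow>
    ('a \<times> ('a, 'b) tvec, 'b \<times> 'b) chart set" where
  "bundle_atlas A W = bundle_chart A W ` A"

text \<open>
  \<open>w\<^sup>h\<close> is the velocity of a vector field with value \<open>u\<close> at \<open>p\<close> that is parallel along a curve with
  initial velocity \<open>w\<close>: its components \<open>(w, u')\<close> in a bundle chart satisfy
  \<open>u' + \<Gamma>(w, u) = 0\<close>. \<open>w\<^sup>v\<close> is the velocity of \<open>t \<mapsto> u + t w\<close> at \<open>t = 0\<close>.
\<close>

definition hor_lift :: "('a, 'b::euclidean_space) chart set \<Rightarrow> ('a, 'b) metric_tensor \<Rightarrow>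
    ('a \<times> ('a, 'b) tvec) set \<Rightarrow> 'a \<times> ('a, 'b) tvec \<Rightarrow> ('a, 'b) tvec \<Rightarrow>
    ('a \<times> ('a, 'b) tvec, 'b \<times> 'b) tvec" where
  "hor_lift A g W = (\<lambda>(p, u) w. THE \<xi>. \<xi> \<in> tangent_space (bundle_atlas A W) (p, u) \<and>
     (\<forall>c\<in>A. p \<in> fst c \<longrightarrow>
        \<xi> (bundle_chart A W c) = (w c, - christoffel A g c (snd c p) (w c) (u c))))"

definition vert_lift :: "('a, 'b::euclidean_space) chart set \<Rightarrow>
    ('a \<times> ('a, 'b) tvec) set \<Rightarrow> 'a \<times> ('a, 'b) tvec \<Rightarrow> ('a, 'b) tvec \<Rightarrow>
    ('a \<times> ('a, 'b) tvec, 'b \<times> 'b) tvec" where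
  "vert_lift A W = (\<lambda>(p, u) w. THE \<xi>. \<xi> \<in> tangent_space (bundle_atlas A W) (p, u) \<and>
     (\<forall>c\<in>A. p \<in> fst c \<longrightarrow> \<xi> (bundle_chart A W c) = (0, w c)))"

text \<open>The unique \<open>(w, z)\<close> with \<open>\<xi> = w\<^sup>h + z\<^sup>v\<close>.\<close>

definition hv_split :: "('a, 'b::euclidean_space) chart set \<Rightarrow> ('a, 'b) metric_tensor \<Rightarrow>
    ('a \<times> ('a, 'b) tvec) set \<Rightarrow> 'a \<times> ('a, 'b) tvec \<Rightarrow>
    ('a \<times> ('a, 'b) tvec, 'b \<times> 'b) tvec \<Rightarrow> ('a, 'b) tvec \<times> ('a, 'b) tvec" where
  "hv_split A g W e \<xi> = (THE (w, z).
     w \<in> tangent_space A (fst e) \<and> z \<in> tangent_space A (fst e) \<and>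
     \<xi> = (\<lambda>C. hor_lift A g W e w C + vert_lift A W e z C))"

text \<open>The tensors \<open>\<pi>\<^sup>* g\<close> and \<open>\<pi>\<^sup>\<star> g\<close>.\<close>

definition hor_pullback :: "('a, 'b::euclidean_space) chart set \<Rightarrow> ('a, 'b) metric_tensor \<Rightarrow>
    ('a \<times> ('a, 'b) tvec) set \<Rightarrow> ('a \<times> ('a, 'b) tvec, 'b \<times> 'b) metric_tensor" where
  "hor_pullback A g W e \<xi> \<eta> = g (fst e) (fst (hv_split A g W e \<xi>)) (fst (hv_split A g W e \<eta>))"

definition vert_pullback :: "('a, 'b::euclidean_space) chart set \<Rightarrow> ('a, 'b) metric_tensor \<Rightarrow>
    ('a \<times> ('a, 'b) tvec) set \<Rightarrow> ('a \<times> ('a, 'b) tvec, 'b \<times> 'b) metric_tensor" where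
  "vert_pullback A g W e \<xi> \<eta> = g (fst e) (snd (hv_split A g W e \<xi>)) (snd (hv_split A g W e \<eta>))"

definition disk_bundle :: "('a, 'b::euclidean_space) chart set \<Rightarrow> ('a, 'b) metric_tensor \<Rightarrow>
    ereal \<Rightarrow> ('a \<times> ('a, 'b) tvec) set" where
  "disk_bundle A g r\<^sub>0 = {(p, u) \<in> total_space A. ereal (tnorm g p u) < r\<^sub>0}"

definition disk_bundle_metric :: "('a, 'b::euclidean_space) chart set \<Rightarrow>
    ('a, 'b) metric_tensor \<Rightarrow> real \<Rightarrow> real \<Rightarrow> ereal \<Rightarrow>
    ('a \<times> ('a, 'b) tvec, 'b \<times> 'b) metric_tensor" where
  "disk_bundle_metric A g c\<^sub>1 K r\<^sub>0 e \<xi> \<eta> =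
     (let s = sqrt (c\<^sub>1 + K * (tnorm g (fst e) (snd e))\<^sup>2); W = disk_bundle A g r\<^sub>0
      in s * hor_pullback A g W e \<xi> \<eta> + 1 / s * vert_pullback A g W e \<xi> \<eta>)"

end

theory Submission
  imports Defs
begin

text \<open>
  In a bundle chart with base coordinate \<open>y\<close> and fibre coordinate \<open>x\<close>, a tangent vector \<open>(v, w)\<close>
  has horizontal part \<open>v\<close> and vertical part \<open>w + \<Gamma>\<^sub>y(v, x)\<close>, so with \<open>s = sqrt (c\<^sub>1 + K r\<^sup>2)\<close> its
  squared length is \<open>s \<bar>v\<bar>\<^sup>2 + s\<^sup>-\<^sup>1 \<bar>w + \<Gamma>\<^sub>y(v, x)\<bar>\<^sup>2\<close>. By metric compatibility the differential of
  \<open>r\<^sup>2\<close> is \<open>2 g(w + \<Gamma>\<^sub>y(v, x), x)\<close>, and since \<open>s\<close> grows at most linearly in \<open>r\<close> the function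
  \<open>ln (1 + r\<^sup>2)\<close> is Lipschitz for every sign of \<open>K\<close>.

  If \<open>K \<ge> 0\<close>, then \<open>s \<ge> sqrt c\<^sub>1\<close> makes the projection to \<open>M\<close> Lipschitz. A Cauchy sequence
  therefore has convergent base points and bounded \<open>r\<close>, so it has a subsequence converging in a
  bundle chart. If \<open>K < 0\<close>, then \<open>s\<^sup>-\<^sup>1\<^sup>/\<^sup>2\<close> is integrable up to the boundary along a radial
  segment, which gives a Cauchy sequence with \<open>r \<rightarrow> r\<^sub>0\<close>; its limit would have \<open>r = r\<^sub>0\<close> because
  \<open>ln (1 + r\<^sup>2)\<close> is continuous.
\<close>

text \<open>The connection, the lifts and the splitting are definite descriptions, so none of them
  can be evaluated before existence and uniqueness are shown. For the horizontal lift this includes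
  independence of the chart, that is, the transformation law of the Christoffel symbols under a
  change of coordinates.

  Lengths and distances on the bundle need much less than smoothness: transition maps with one
  continuous derivative, and a metric that is continuous, bilinear and positive definite in
  coordinates. The theory of length and distance is therefore developed for such data and used
  twice, for \<open>M\<close> and for the disk bundle.

  One principle serves two purposes: a function whose differential is bounded by \<open>C\<close>
  changes by at most \<open>C\<close> times the length of a path. Applied to bump functions it shows
  that the distance separates points; applied to the logarithm it keeps the fibre norm under
  control.\<close>

lemma bilinear_expand:
  fixes B :: "'b::euclidean_space \<Rightarrow> 'c::euclidean_space \<Rightarrow> 'd::real_vector"
  assumes "bilinear B"
  shows "B x y = (\<Sum>i\<in>Basis. \<Sum>j\<in>Basis. ((x \<bullet> i) * (y \<bullet> j)) *\<^sub>R B i j)"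
proof -
  have "B x y = B (\<Sum>i\<in>Basis. (x \<bullet> i) *\<^sub>R i) (\<Sum>j\<in>Basis. (y \<bullet> j) *\<^sub>R j)"
    by (simp add: euclidean_representation)
  also have "\<dots> = (\<Sum>(i,j)\<in>Basis\<times>Basis. B ((x \<bullet> i) *\<^sub>R i) ((y \<bullet> j) *\<^sub>R j))"
    by (rule bilinear_sum[OF assms])
  also have "\<dots> = (\<Sum>(i,j)\<in>Basis\<times>Basis. ((x \<bullet> i) * (y \<bullet> j)) *\<^sub>R B i j)"
    by (intro sum.cong refl) (auto simp: bilinear_lmul[OF assms] bilinear_rmul[OF assms])
  finally show ?thesis by (simp add: sum.cartesian_product)
qed

text \<open>Metrics and Christoffel symbols are known to be continuous for each fixed pair of
  arguments. Expanding in a basis leaves finitely many coefficients, so the arguments may vary as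
  well.\<close>

lemma continuous_on_bilinear_family:
  fixes B :: "'z::topological_space \<Rightarrow> 'b::euclidean_space \<Rightarrow> 'c::euclidean_space \<Rightarrow> 'd::real_normed_vector"
  assumes "\<And>z. z \<in> S \<Longrightarrow> bilinear (B z)" "\<And>v w. continuous_on S (\<lambda>z. B z v w)"
    and "continuous_on S a" "continuous_on S b"
  shows "continuous_on S (\<lambda>z. B z (a z) (b z))"
proof -
  have "continuous_on S (\<lambda>z. \<Sum>i\<in>Basis. \<Sum>j\<in>Basis. ((a z \<bullet> i) * (b z \<bullet> j)) *\<^sub>R B z i j)"
    by (intro continuous_intros assms)
  then show ?thesis
    by (rule continuous_on_eq) (simp add: bilinear_expand[OF assms(1), symmetric])
qed

text \<open>A linear map becomes bilinear by adding a scalar argument; freezing that argument at 1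
  derives the statements on linear families from those on bilinear ones.\<close>

lemma bilinear_scaleR_linear: "linear L \<Longrightarrow> bilinear (\<lambda>(r::real) v. r *\<^sub>R L v)"
  by (auto simp: bilinear_def linear_iff algebra_simps)

lemma continuous_on_linear_family:
  fixes L :: "'z::topological_space \<Rightarrow> 'b::euclidean_space \<Rightarrow> 'd::real_normed_vector"
  assumes "\<And>z. z \<in> S \<Longrightarrow> linear (L z)" "\<And>v. continuous_on S (\<lambda>z. L z v)" "continuous_on S a"
  shows "continuous_on S (\<lambda>z. L z (a z))"
  using continuous_on_bilinear_family[of S "\<lambda>z r v. r *\<^sub>R L z v" "\<lambda>_. 1::real" a]
  by (simp add: assms bilinear_scaleR_linear continuous_intros)

text \<open>A product rule with a third term, because the form itself depends on the point. After
  expansion in a basis, derivatives of the coefficients at fixed vectors suffice.\<close>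

lemma has_derivative_bilinear_family:
  fixes B :: "'z::real_normed_vector \<Rightarrow> 'b::euclidean_space \<Rightarrow> 'c::euclidean_space \<Rightarrow> 'd::real_normed_vector"
  assumes S: "open S" "x \<in> S"
    and B: "\<And>z. z \<in> S \<Longrightarrow> bilinear (B z)"
    and B': "\<And>u. bilinear (B' u)"
    and der: "\<And>v w. ((\<lambda>z. B z v w) has_derivative (\<lambda>u. B' u v w)) (at x)"
    and a: "(a has_derivative a') (at x)" and b: "(b has_derivative b') (at x)"
  shows "((\<lambda>z. B z (a z) (b z)) has_derivative
           (\<lambda>u. B' u (a x) (b x) + B x (a' u) (b x) + B x (a x) (b' u))) (at x)"
proof -
  have "((\<lambda>z. \<Sum>i\<in>Basis. \<Sum>j\<in>Basis. ((a z \<bullet> i) * (b z \<bullet> j)) *\<^sub>R B z i j) has_derivative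
     (\<lambda>u. \<Sum>i\<in>Basis. \<Sum>j\<in>Basis. ((a x \<bullet> i) * (b x \<bullet> j)) *\<^sub>R B' u i j +
          ((a x \<bullet> i) * (b' u \<bullet> j) + (a' u \<bullet> i) * (b x \<bullet> j)) *\<^sub>R B x i j)) (at x)"
    by (intro derivative_intros der a b)
  also have "(\<lambda>u. \<Sum>i\<in>Basis. \<Sum>j\<in>Basis. ((a x \<bullet> i) * (b x \<bullet> j)) *\<^sub>R B' u i j +
          ((a x \<bullet> i) * (b' u \<bullet> j) + (a' u \<bullet> i) * (b x \<bullet> j)) *\<^sub>R B x i j) =
      (\<lambda>u. B' u (a x) (b x) + B x (a' u) (b x) + B x (a x) (b' u))"
    unfolding bilinear_expand[OF B', of _ "a x" "b x"] bilinear_expand[OF B[OF S(2)], of "a' _"]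
      bilinear_expand[OF B[OF S(2)], of "a x"]
    by (simp add: scaleR_add_left sum.distrib algebra_simps)
  finally show ?thesis
    by (rule has_derivative_transform_within_open[OF _ S])
       (simp add: bilinear_expand[OF B, symmetric])
qed

lemma has_derivative_linear_family:
  fixes L :: "'z::real_normed_vector \<Rightarrow> 'b::euclidean_space \<Rightarrow> 'd::real_normed_vector"
  assumes S: "open S" "x \<in> S"
    and "\<And>z. z \<in> S \<Longrightarrow> linear (L z)"
    and "\<And>u. linear (L' u)"
    and der: "\<And>v. ((\<lambda>z. L z v) has_derivative (\<lambda>u. L' u v)) (at x)"
    and a: "(a has_derivative a') (at x)"
  shows "((\<lambda>z. L z (a z)) has_derivative (\<lambda>u. L' u (a x) + L x (a' u))) (at x)"
proof -
  have "((\<lambda>z. (\<lambda>z r v. r *\<^sub>R L z v) z ((\<lambda>_. 1::real) z) (a z)) has_derivative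
     (\<lambda>u. (1::real) *\<^sub>R L' u (a x) + 0 *\<^sub>R L x (a x) + 1 *\<^sub>R L x (a' u))) (at x)"
    by (rule has_derivative_bilinear_family[OF S])
       (auto intro!: assms bilinear_scaleR_linear derivative_eq_intros)
  then show ?thesis by simp
qed

lemma linear_expand:
  fixes L :: "'b::euclidean_space \<Rightarrow> 'd::real_vector"
  assumes "linear L"
  shows "L x = (\<Sum>i\<in>Basis. (x \<bullet> i) *\<^sub>R L i)"
  using linear_sum[OF assms, of "\<lambda>i. (x \<bullet> i) *\<^sub>R i" Basis]
  by (simp add: euclidean_representation linear_scale[OF assms])

subsection \<open>Charts, paths and length\<close>

text \<open>What lengths and distances ask of an atlas. Keeping this apart from smoothness lets the
  same results serve the base and the bundle atlas, whose transition maps are shown to have one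
  continuous derivative.\<close>

locale C1_atlas =
  fixes A :: "('a, 'b::euclidean_space) chart set"
  assumes chart_inj: "c \<in> A \<Longrightarrow> inj_on (snd c) (fst c)"
    and chart_open: "c \<in> A \<Longrightarrow> open (snd c ` fst c)"
    and overlap_open: "c \<in> A \<Longrightarrow> d \<in> A \<Longrightarrow> open (snd c ` (fst c \<inter> fst d))"
    and transition_C1: "c \<in> A \<Longrightarrow> d \<in> A \<Longrightarrow> Ck_on 1 (snd c ` (fst c \<inter> fst d)) (transition c d)"
    and Hausdorff: "Hausdorff_space (atlas_topology A)"
begin

lemma chart_inv_chart: "c \<in> A \<Longrightarrow> p \<in> fst c \<Longrightarrow> chart_inv c (snd c p) = p"
  by (simp add: chart_inv_def chart_inj)

lemma chart_chart_inv: "y \<in> snd c ` fst c \<Longrightarrow> snd c (chart_inv c y) = y"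
  by (simp add: chart_inv_def f_inv_into_f)

lemma chart_inv_in: "y \<in> snd c ` fst c \<Longrightarrow> chart_inv c y \<in> fst c"
  by (simp add: chart_inv_def inv_into_into)

lemma transition_chart: "c \<in> A \<Longrightarrow> p \<in> fst c \<Longrightarrow> transition c d (snd c p) = snd d p"
  by (simp add: transition_def chart_inv_chart)

lemma transition_differentiable:
  assumes "c \<in> A" "d \<in> A" "p \<in> fst c" "p \<in> fst d"
  shows "(transition c d has_derivative frechet_derivative (transition c d) (at (snd c p))) (at (snd c p))"
  using transition_C1[OF assms(1,2)] assms frechet_derivative_works[of "transition c d"]
  by simp

lemma transition_derivative_continuous:
  assumes "c \<in> A" "d \<in> A"
  shows "continuous_on (snd c ` (fst c \<inter> fst d)) (\<lambda>y. frechet_derivative (transition c d) (at y) v)"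
  using transition_C1[OF assms] by simp

text \<open>The chain rule for transition maps. This cocycle identity makes the components in
  \<open>chart_vec\<close> a tangent vector, and with the third chart equal to the first it inverts
  the differential.\<close>

lemma transition_derivative_compose:
  assumes c: "c \<in> A" and d: "d \<in> A" and e: "e \<in> A" and p: "p \<in> fst c" "p \<in> fst d" "p \<in> fst e"
  shows "frechet_derivative (transition d e) (at (snd d p))
           (frechet_derivative (transition c d) (at (snd c p)) x) =
         frechet_derivative (transition c e) (at (snd c p)) x"
proof -
  let ?D = "\<lambda>c d. frechet_derivative (transition c d) (at (snd c p))"
  have "(transition d e \<circ> transition c d has_derivative (?D d e \<circ> ?D c d)) (at (snd c p))"
    using transition_differentiable[OF c d p(1,2)] transition_differentiable[OF d e p(2,3)]
    by (intro diff_chain_at) (simp_all add: transition_chart c p)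
  then have "(transition c e has_derivative (?D d e \<circ> ?D c d)) (at (snd c p))"
  proof (rule has_derivative_transform_within_open)
    show "open (snd c ` (fst c \<inter> fst d))" by (rule overlap_open[OF c d])
    show "(transition d e \<circ> transition c d) y = transition c e y" if "y \<in> snd c ` (fst c \<inter> fst d)" for y
      using that by (auto simp: transition_chart c d)
  qed (use p in auto)
  with transition_differentiable[OF c e p(1,3)] have "?D c e = ?D d e \<circ> ?D c d"
    by (rule has_derivative_unique)
  then show ?thesis by simp
qed

lemma transition_derivative_self:
  assumes c: "c \<in> A" and p: "p \<in> fst c"
  shows "frechet_derivative (transition c c) (at (snd c p)) x = x"
proof -
  have "(transition c c has_derivative (\<lambda>x. x)) (at (snd c p))"
    by (rule has_derivative_transform_within_open[OF has_derivative_ident chart_open[OF c]])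
       (use p in \<open>auto simp: transition_chart c\<close>)
  from has_derivative_unique[OF transition_differentiable[OF c c p p] this] show ?thesis
    by simp
qed

lemma transition_derivative_linear:
  assumes "c \<in> A" "d \<in> A" "p \<in> fst c" "p \<in> fst d"
  shows "linear (frechet_derivative (transition c d) (at (snd c p)))"
  using transition_differentiable[OF assms] by (rule has_derivative_linear)

lemma chart_vec_self: "c \<in> A \<Longrightarrow> p \<in> fst c \<Longrightarrow> chart_vec A c p x c = x"
  by (simp add: chart_vec_def transition_derivative_self)

lemma chart_vec_tangent: "c \<in> A \<Longrightarrow> p \<in> fst c \<Longrightarrow> chart_vec A c p x \<in> tangent_space A p"
  unfolding tangent_space_def chart_vec_def
  using transition_derivative_compose[of c _ _ p x] by simp

lemma tangent_transition:
  "v \<in> tangent_space A p \<Longrightarrow> c \<in> A \<Longrightarrow> d \<in> A \<Longrightarrow> p \<in> fst c \<Longrightarrow> p \<in> fst d \<Longrightarrow>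
     v d = frechet_derivative (transition c d) (at (snd c p)) (v c)"
  unfolding tangent_space_def by blast

lemma tangent_outside: "v \<in> tangent_space A p \<Longrightarrow> \<not> (c \<in> A \<and> p \<in> fst c) \<Longrightarrow> v c = 0"
  unfolding tangent_space_def by blast

lemma chart_vec_of_tangent:
  assumes "c \<in> A" "p \<in> fst c" "v \<in> tangent_space A p"
  shows "chart_vec A c p (v c) = v"
proof
  fix d show "chart_vec A c p (v c) d = v d"
    unfolding chart_vec_def
    using tangent_transition[OF assms(3) assms(1) _ assms(2), of d] tangent_outside[OF assms(3), of d]
    by auto
qed

lemma tangent_eqI:
  "c \<in> A \<Longrightarrow> p \<in> fst c \<Longrightarrow> v \<in> tangent_space A p \<Longrightarrow> w \<in> tangent_space A p \<Longrightarrow> v c = w c \<Longrightarrow> v = w"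
  by (metis chart_vec_of_tangent)

lemma chart_vec_scale:
  "c \<in> A \<Longrightarrow> p \<in> fst c \<Longrightarrow> chart_vec A c p (r *\<^sub>R x) d = r *\<^sub>R chart_vec A c p x d"
  by (simp add: chart_vec_def linear_scale[OF transition_derivative_linear])

lemma chart_vec_add:
  "c \<in> A \<Longrightarrow> p \<in> fst c \<Longrightarrow> chart_vec A c p (x + y) d = chart_vec A c p x d + chart_vec A c p y d"
  by (simp add: chart_vec_def linear_add[OF transition_derivative_linear])

lemma Union_chart_preimages: "\<Union> {fst c \<inter> snd c -` B |c B. c \<in> A \<and> open B} = manifold_points A"
proof -
  have "fst c = fst c \<inter> snd c -` UNIV" for c :: "('a, 'b) chart" by simp
  then have "fst c \<in> {fst c \<inter> snd c -` B |c B. c \<in> A \<and> open B}" if "c \<in> A" for c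
    using that open_UNIV by blast
  then show ?thesis unfolding manifold_points_def by blast
qed

lemma topspace_atlas: "topspace (atlas_topology A) = manifold_points A"
  unfolding atlas_topology_def topology_generated_by_topspace Union_chart_preimages ..

lemma chart_preimage_open: "c \<in> A \<Longrightarrow> open B \<Longrightarrow> openin (atlas_topology A) (fst c \<inter> snd c -` B)"
  unfolding atlas_topology_def by (rule topology_generated_by_Basis) blast

lemma chart_domain_open: "c \<in> A \<Longrightarrow> openin (atlas_topology A) (fst c)"
  using chart_preimage_open[of c UNIV] by simp

lemma continuous_map_chart:
  "c \<in> A \<Longrightarrow> continuous_map (subtopology (atlas_topology A) (fst c)) euclidean (snd c)"
  unfolding continuous_map_def
proof safe
  fix U :: "'b set" assume c: "c \<in> A" and U: "openin euclidean U"
  have "{x \<in> topspace (subtopology (atlas_topology A) (fst c)). snd c x \<in> U} =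
     (fst c \<inter> snd c -` U) \<inter> fst c"
    using chart_domain_open[OF c] openin_subset by fastforce
  then show "openin (subtopology (atlas_topology A) (fst c))
    {x \<in> topspace (subtopology (atlas_topology A) (fst c)). snd c x \<in> U}"
    using chart_preimage_open[OF c] U by (auto simp: openin_subtopology)
qed auto

lemma transition_continuous:
  assumes "c \<in> A" "d \<in> A"
  shows "continuous_on (snd c ` (fst c \<inter> fst d)) (transition c d)"
proof (rule differentiable_imp_continuous_on)
  show "transition c d differentiable_on (snd c ` (fst c \<inter> fst d))"
    unfolding differentiable_on_def
    using transition_C1[OF assms] by (auto intro: differentiable_at_withinI)
qed

text \<open>The topology is generated by chart preimages of open sets, so continuity reduces to that
  of the transition maps.\<close>

lemma continuous_map_chart_inv:
  assumes c: "c \<in> A"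
  shows "continuous_map (top_of_set (snd c ` fst c)) (atlas_topology A) (chart_inv c)"
  unfolding atlas_topology_def continuous_on_generated_topo_iff
proof (intro conjI allI impI)
  fix U assume "U \<in> {fst c \<inter> snd c -` B |c B. c \<in> A \<and> open B}"
  then obtain d B where d: "d \<in> A" and B: "open B" and U: "U = fst d \<inter> snd d -` B" by auto
  have "chart_inv c -` U \<inter> topspace (top_of_set (snd c ` fst c)) =
     snd c ` (fst c \<inter> fst d) \<inter> transition c d -` B"
    unfolding U using c by (auto simp: transition_def chart_inv_chart)
  moreover have "open (snd c ` (fst c \<inter> fst d) \<inter> transition c d -` B)"
    using continuous_open_preimage[OF transition_continuous[OF c d] overlap_open[OF c d] B] .
  ultimately show "openin (top_of_set (snd c ` fst c)) (chart_inv c -` U \<inter> topspace (top_of_set (snd c ` fst c)))"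
    by (metis inf.cobounded2 openin_open_Int openin_subtopology_self topspace_euclidean_subtopology inf.absorb_iff2 inf_commute)
next
  show "chart_inv c ` topspace (top_of_set (snd c ` fst c)) \<subseteq> \<Union> {fst c \<inter> snd c -` B |c B. c \<in> A \<and> open B}"
    unfolding Union_chart_preimages using c by (auto simp: chart_inv_chart manifold_points_def)
qed

lemma chart_image_open:
  assumes "c \<in> A" "openin (atlas_topology A) U"
  shows "open (snd c ` (fst c \<inter> U))"
proof -
  have "openin (top_of_set (snd c ` fst c)) {y \<in> snd c ` fst c. chart_inv c y \<in> U}"
    using openin_continuous_map_preimage[OF continuous_map_chart_inv[OF assms(1)] assms(2)] by simp
  moreover have "{y \<in> snd c ` fst c. chart_inv c y \<in> U} = snd c ` (fst c \<inter> U)"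
    using assms(1) by (auto simp: chart_inv_chart)
  ultimately show ?thesis using chart_open[OF assms(1)] by (metis openin_open_eq)
qed

lemma in_manifold: "c \<in> A \<Longrightarrow> p \<in> fst c \<Longrightarrow> p \<in> manifold_points A"
  by (auto simp: manifold_points_def)

lemma path_in_manifold: "pathin (atlas_topology A) \<gamma> \<Longrightarrow> t \<in> {0..1} \<Longrightarrow> \<gamma> t \<in> manifold_points A"
  using path_image_subset_topspace topspace_atlas by fastforce

lemma path_chart:
  assumes "pathin (atlas_topology A) \<gamma>" "c \<in> A" "t \<in> {0..1}" "\<gamma> t \<in> fst c"
  shows "\<exists>\<delta>>0. \<forall>s\<in>{0..1}. \<bar>s - t\<bar> < \<delta> \<longrightarrow> \<gamma> s \<in> fst c"
proof -
  have "openin (top_of_set {0..1}) {s \<in> {0..1}. \<gamma> s \<in> fst c}"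
    using openin_continuous_map_preimage[OF assms(1)[unfolded pathin_def] chart_domain_open[OF assms(2)]] by simp
  then show ?thesis using assms(3,4) unfolding openin_euclidean_subtopology_iff
    by (auto simp: dist_real_def)
qed

lemma path_chart_continuous:
  assumes "pathin (atlas_topology A) \<gamma>" "c \<in> A" "I \<subseteq> {0..1}" "\<gamma> ` I \<subseteq> fst c"
  shows "continuous_on I (snd c \<circ> \<gamma>)"
proof -
  have "continuous_map (top_of_set I) (subtopology (atlas_topology A) (fst c)) \<gamma>"
    using assms unfolding pathin_def
    by (simp add: continuous_map_in_subtopology continuous_map_from_subtopology_mono image_subset_iff_funcset)
  from continuous_map_compose[OF this continuous_map_chart[OF assms(2)]]
  show ?thesis by simp
qed

end

lemma abs_diff_le_integral:
  fixes F sp :: "real \<Rightarrow> real"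
  assumes T: "finite T" and cont: "continuous_on {0..1} F" and sp: "(sp has_integral I) {0..1}"
    and der: "\<And>t. t \<in> {0<..<1} - T \<Longrightarrow> \<exists>D. (F has_vector_derivative D) (at t) \<and> \<bar>D\<bar> \<le> C * sp t"
  shows "\<bar>F 1 - F 0\<bar> \<le> C * I"
proof -
  obtain D where D: "\<And>t. t \<in> {0<..<1} - T \<Longrightarrow> (F has_vector_derivative D t) (at t) \<and> \<bar>D t\<bar> \<le> C * sp t"
    using der by metis
  have "(D has_integral (F 1 - F 0)) {0..1}"
    by (rule fundamental_theorem_of_calculus_interior_strong[OF T]) (use D cont in auto)
  \<comment> \<open>Nothing bounds the integrand at the ends and on \<open>T\<close>, so both
    integrands are set to 0 there; changing finitely many values preserves the integrals.\<close>
  then have 1: "((\<lambda>t. if t \<in> {0<..<1} - T then D t else 0) has_integral (F 1 - F 0)) {0..1}"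
    by (rule has_integral_spike_finite[rotated 2, of _ _ _ "{0,1} \<union> T"]) (use T in auto)
  have "((\<lambda>t. C * sp t) has_integral C * I) {0..1}"
    using sp by (rule has_integral_mult_right)
  then have 2: "((\<lambda>t. if t \<in> {0<..<1} - T then C * sp t else 0) has_integral C * I) {0..1}"
    by (rule has_integral_spike_finite[rotated 2, of _ _ _ "{0,1} \<union> T"]) (use T in auto)
  have "F 1 - F 0 \<le> C * I"
    by (rule has_integral_le[OF 1 2]) (use D in force)
  moreover have "- (F 1 - F 0) \<le> C * I"
    by (rule has_integral_le[OF has_integral_neg[OF 1] 2]) (use D in force)
  ultimately show ?thesis by linarith
qed

text \<open>The second half of \<open>piecewise_C1_path\<close> with the break set as a parameter,
  so that reparametrised and joined paths can be given explicit break sets.\<close>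

definition C1_off :: "('a, 'b::euclidean_space) chart set \<Rightarrow> real set \<Rightarrow> (real \<Rightarrow> 'a) \<Rightarrow> bool" where
  "C1_off A S \<gamma> \<longleftrightarrow> (\<forall>c\<in>A. \<forall>a b. 0 \<le> a \<and> a < b \<and> b \<le> 1 \<and> {a<..<b} \<inter> S = {} \<and> \<gamma> ` {a..b} \<subseteq> fst c \<longrightarrow>
           (\<exists>D. continuous_on {a..b} D \<and>
              (\<forall>t\<in>{a..b}. ((snd c \<circ> \<gamma>) has_vector_derivative D t) (at t within {a..b}))))"

lemma piecewise_C1_path_iff:
  "piecewise_C1_path A \<gamma> \<longleftrightarrow> pathin (atlas_topology A) \<gamma> \<and> (\<exists>S. finite S \<and> C1_off A S \<gamma>)"
  by (simp add: piecewise_C1_path_def C1_off_def)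

abbreviation speed :: "('a, 'b::euclidean_space) chart set \<Rightarrow> ('a, 'b) metric_tensor \<Rightarrow> (real \<Rightarrow> 'a) \<Rightarrow> real \<Rightarrow> real" where
  "speed A g \<gamma> t \<equiv> tnorm g (\<gamma> t) (velocity A \<gamma> t)"

definition path_join :: "(real \<Rightarrow> 'a) \<Rightarrow> (real \<Rightarrow> 'a) \<Rightarrow> real \<Rightarrow> 'a" where
  "path_join \<gamma> \<gamma>' t = (if t \<le> 1/2 then \<gamma> (2 * t) else \<gamma>' (2 * t - 1))"

section \<open>Velocity of piecewise C1 paths\<close>

context C1_atlas
begin

lemma path_chart_near:
  assumes "pathin (atlas_topology A) \<gamma>" "c \<in> A" "t \<in> {0<..<1}" "\<gamma> t \<in> fst c" "finite S"
  obtains \<eta> where "\<eta> > 0" "{t - \<eta>..t + \<eta>} \<subseteq> {0..1}" "\<gamma> ` {t - \<eta>..t + \<eta>} \<subseteq> fst c"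
    "({t - \<eta>..t + \<eta>} - {t}) \<inter> S = {}"
proof -
  obtain \<delta> where \<delta>: "\<delta> > 0" "\<And>s. s \<in> {0..1} \<Longrightarrow> \<bar>s - t\<bar> < \<delta> \<Longrightarrow> \<gamma> s \<in> fst c"
    using path_chart[OF assms(1,2) _ assms(4)] assms(3) by auto
  \<comment> \<open>Only the breaks other than \<open>t\<close> are removed, so \<open>t\<close>
    itself may be a break point.\<close>
  have "open ({0<..<1} - (S - {t}))"
    using assms(5) by (intro open_Diff finite_imp_closed) auto
  then obtain e where e: "e > 0" "ball t e \<subseteq> {0<..<1} - (S - {t})"
    using assms(3) by (meson DiffI Diff_iff insertI1 open_contains_ball)
  define \<eta> where "\<eta> = min \<delta> e / 2"
  have "s \<in> ball t e" "\<bar>s - t\<bar> < \<delta>" if "s \<in> {t - \<eta>..t + \<eta>}" for s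
    using that \<open>e > 0\<close> \<open>\<delta> > 0\<close> by (auto simp: \<eta>_def dist_real_def min_def split: if_splits)
  then have *: "s \<in> {0<..<1} - (S - {t})" "\<bar>s - t\<bar> < \<delta>" if "s \<in> {t - \<eta>..t + \<eta>}" for s
    using that e(2) by blast+
  show ?thesis
  proof
    show "\<eta> > 0" using \<open>e > 0\<close> \<open>\<delta> > 0\<close> by (simp add: \<eta>_def)
    show "{t - \<eta>..t + \<eta>} \<subseteq> {0..1}" using *(1) by force
    show "\<gamma> ` {t - \<eta>..t + \<eta>} \<subseteq> fst c"
    proof safe
      fix s assume s: "s \<in> {t - \<eta>..t + \<eta>}"
      show "\<gamma> s \<in> fst c" using *[OF s] by (intro \<delta>(2)) auto
    qed
    show "({t - \<eta>..t + \<eta>} - {t}) \<inter> S = {}" using *(1) by blast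
  qed
qed

text \<open>\<open>velocity\<close> is a derivative within the unit interval; off the break points
  it is two-sided, as the chain rule requires.\<close>

lemma velocity_component:
  assumes \<gamma>: "pathin (atlas_topology A) \<gamma>" "C1_off A S \<gamma>" "finite S"
    and t: "t \<in> {0<..<1} - S" and c: "c \<in> A" "\<gamma> t \<in> fst c"
  shows "((snd c \<circ> \<gamma>) has_vector_derivative velocity A \<gamma> t c) (at t)"
proof -
  obtain \<eta> where \<eta>: "\<eta> > 0" "{t - \<eta>..t + \<eta>} \<subseteq> {0..1}" "\<gamma> ` {t - \<eta>..t + \<eta>} \<subseteq> fst c"
    "({t - \<eta>..t + \<eta>} - {t}) \<inter> S = {}"
    using path_chart_near[OF \<gamma>(1) c(1) _ c(2) \<gamma>(3)] t by auto
  have "0 \<le> t - \<eta>" "t + \<eta> \<le> 1" using \<eta>(1,2) by auto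
  moreover have "{t - \<eta><..<t + \<eta>} \<inter> S = {}" using \<eta>(4) t greaterThanLessThan_subseteq_atLeastAtMost_iff[of "t - \<eta>" "t + \<eta>" "t - \<eta>" "t + \<eta>"] by blast
  ultimately obtain D where "\<forall>s\<in>{t - \<eta>..t + \<eta>}. ((snd c \<circ> \<gamma>) has_vector_derivative D s) (at s within {t - \<eta>..t + \<eta>})"
    using \<gamma>(2) c(1) \<eta>(1,3) unfolding C1_off_def by (smt (verit))
  then have "((snd c \<circ> \<gamma>) has_vector_derivative D t) (at t within {t - \<eta>..t + \<eta>})"
    using \<eta>(1) by auto
  then have D: "((snd c \<circ> \<gamma>) has_vector_derivative D t) (at t)"
    using \<eta>(1) by (simp add: at_within_Icc_at)
  moreover have "velocity A \<gamma> t c = D t"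
    using vector_derivative_at_within_ivl[OF D, of 0 1] t c by (simp add: velocity_def)
  ultimately show ?thesis by simp
qed

lemma velocity_eqI:
  assumes "c \<in> A" "\<gamma> t \<in> fst c" "t \<in> {0<..<1}"
    and "((snd c \<circ> \<gamma>) has_vector_derivative v) (at t)"
  shows "velocity A \<gamma> t c = v"
  using vector_derivative_at_within_ivl[OF assms(4), of 0 1] assms by (simp add: velocity_def)

lemma path_transition_derivative:
  assumes \<gamma>: "pathin (atlas_topology A) \<gamma>" and t: "t \<in> {0<..<1}"
    and c: "c \<in> A" "\<gamma> t \<in> fst c" and d: "d \<in> A" "\<gamma> t \<in> fst d"
    and der: "((snd c \<circ> \<gamma>) has_vector_derivative v) (at t)"
  shows "((snd d \<circ> \<gamma>) has_vector_derivative
            frechet_derivative (transition c d) (at (snd c (\<gamma> t))) v) (at t)"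
proof -
  let ?L = "frechet_derivative (transition c d) (at (snd c (\<gamma> t)))"
  obtain \<eta> where \<eta>: "\<eta> > 0" "{t - \<eta>..t + \<eta>} \<subseteq> {0..1}" "\<gamma> ` {t - \<eta>..t + \<eta>} \<subseteq> fst c"
    using path_chart_near[OF \<gamma>(1) c(1) t c(2) finite.emptyI] by auto
  have "(transition c d has_derivative ?L) (at ((snd c \<circ> \<gamma>) t))"
    using transition_differentiable[OF c(1) d(1) c(2) d(2)] by simp
  from diff_chain_at[OF der[unfolded has_vector_derivative_def] this]
  have "((transition c d \<circ> (snd c \<circ> \<gamma>)) has_vector_derivative ?L v) (at t)"
    using linear_scale[OF transition_derivative_linear[OF c(1) d(1) c(2) d(2)]]
    by (simp add: has_vector_derivative_def o_def)
  then show ?thesis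
  proof (rule has_vector_derivative_transform_within_open)
    show "open {t-\<eta><..<t+\<eta>}" "t \<in> {t-\<eta><..<t+\<eta>}" using \<eta>(1) by auto
    fix s assume "s \<in> {t-\<eta><..<t+\<eta>}"
    then have "\<gamma> s \<in> fst c" using \<eta>(3) by auto
    then show "(transition c d \<circ> (snd c \<circ> \<gamma>)) s = (snd d \<circ> \<gamma>) s"
      by (simp add: transition_chart c(1))
  qed
qed

text \<open>The derivative in one chart determines the whole velocity, so speeds may be computed in
  any convenient chart.\<close>

lemma velocity_chart_vec:
  assumes \<gamma>: "pathin (atlas_topology A) \<gamma>" and t: "t \<in> {0<..<1}"
    and c: "c \<in> A" "\<gamma> t \<in> fst c"
    and der: "((snd c \<circ> \<gamma>) has_vector_derivative v) (at t)"
  shows "velocity A \<gamma> t = chart_vec A c (\<gamma> t) v"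
proof
  fix d
  show "velocity A \<gamma> t d = chart_vec A c (\<gamma> t) v d"
  proof (cases "d \<in> A \<and> \<gamma> t \<in> fst d")
    case True
    then show ?thesis
      using velocity_eqI[OF _ _ t path_transition_derivative[OF \<gamma> t c _ _ der]]
      by (simp add: chart_vec_def)
  qed (auto simp: velocity_def chart_vec_def)
qed

text \<open>The definition tests every chart. In a chart other than \<open>c\<close> the path is a
  transition map after a straight line, and its derivative is continuous because the transition is
  C1.\<close>

lemma piecewise_C1_linepath:
  assumes c: "c \<in> A" and yz: "closed_segment y z \<subseteq> snd c ` fst c"
  shows "pathin (atlas_topology A) (chart_inv c \<circ> linepath y z)"
    and "C1_off A {} (chart_inv c \<circ> linepath y z)"
proof -
  have img: "linepath y z t \<in> snd c ` fst c" if "t \<in> {0..1}" for t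
    using that yz linepath_in_path[of t y z] by auto
  have "continuous_map (top_of_set {0..1}) (top_of_set (snd c ` fst c)) (linepath y z)"
    using img by (auto simp: continuous_map_in_subtopology intro: continuous_on_linepath)
  from continuous_map_compose[OF this continuous_map_chart_inv[OF c]]
  show "pathin (atlas_topology A) (chart_inv c \<circ> linepath y z)" by (simp add: pathin_def)
  show "C1_off A {} (chart_inv c \<circ> linepath y z)"
    unfolding C1_off_def
  proof safe
    fix d\<^sub>1 d\<^sub>2 and a b :: real
    assume d: "(d\<^sub>1, d\<^sub>2) \<in> A" and ab: "0 \<le> a" "a < b" "b \<le> 1"
      and sub: "(chart_inv c \<circ> linepath y z) ` {a..b} \<subseteq> fst (d\<^sub>1, d\<^sub>2)"
    let ?d = "(d\<^sub>1, d\<^sub>2)"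
    let ?T = "transition c ?d"
    have in_overlap: "linepath y z t \<in> snd c ` (fst c \<inter> fst ?d)" if "t \<in> {a..b}" for t
    proof -
      have t: "linepath y z t \<in> snd c ` fst c" using img that ab by auto
      have "chart_inv c (linepath y z t) \<in> fst c \<inter> fst ?d"
        using chart_inv_in[OF t] sub that by auto
      with chart_chart_inv[OF t] show ?thesis by (metis imageI)
    qed
    define D where "D t = frechet_derivative ?T (at (linepath y z t)) (z - y)" for t
    have "continuous_on {a..b} D"
      unfolding D_def
      by (rule continuous_on_compose2[OF transition_derivative_continuous[OF c d] continuous_on_linepath])
         (use in_overlap in blast)
    moreover have "((snd ?d \<circ> (chart_inv c \<circ> linepath y z)) has_vector_derivative D t) (at t within {a..b})"
      if t: "t \<in> {a..b}" for t
    proof -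
      obtain p where p: "p \<in> fst c" "p \<in> fst ?d" "snd c p = linepath y z t"
        using in_overlap[OF t] by auto
      have T: "(?T has_derivative frechet_derivative ?T (at (linepath y z t))) (at (linepath y z t))"
        using transition_differentiable[OF c d p(1,2)] p(3) by simp
      have "((?T \<circ> linepath y z) has_derivative
         frechet_derivative ?T (at (linepath y z t)) \<circ> (\<lambda>r. r *\<^sub>R (z - y))) (at t within {a..b})"
        using has_vector_derivative_linepath_within[of y z t "{a..b}"] T
        unfolding has_vector_derivative_def
        by (intro diff_chain_within) (auto intro: has_derivative_at_withinI)
      then show ?thesis
        using linear_scale[OF has_derivative_linear[OF T]]
        unfolding has_vector_derivative_def D_def
        by (simp add: transition_def o_def)
    qed
    ultimately show "\<exists>D. continuous_on {a..b} D \<and> (\<forall>t\<in>{a..b}.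
      ((snd ?d \<circ> (chart_inv c \<circ> linepath y z)) has_vector_derivative D t) (at t within {a..b}))"
      by blast
  qed
qed

text \<open>Both signs of \<open>m\<close> occur: reversal takes \<open>m = -1\<close>, each half of
  a joined path takes \<open>m = 2\<close>. A negative \<open>m\<close> exchanges the ends of the
  interval, hence the case distinction.\<close>

lemma affine_C1:
  assumes \<gamma>: "C1_off A S \<gamma>" and m: "m \<noteq> 0" and c: "c \<in> A" and ab: "a < b"
    and S: "{a<..<b} \<inter> (\<lambda>t. m * t + k) -` S = {}"
    and mem: "\<And>t. t \<in> {a..b} \<Longrightarrow> m * t + k \<in> {0..1} \<and> \<gamma>' t = \<gamma> (m * t + k)"
    and sub: "\<gamma>' ` {a..b} \<subseteq> fst c"
  shows "\<exists>D. continuous_on {a..b} D \<and>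
              (\<forall>t\<in>{a..b}. ((snd c \<circ> \<gamma>') has_vector_derivative D t) (at t within {a..b}))"
proof -
  let ?f = "\<lambda>t. m * t + k"
  obtain a' b' where a'b': "?f ` {a..b} = {a'..b'}" "a' < b'" and io: "?f ` {a<..<b} = {a'<..<b'}"
  proof (cases "m > 0")
    case True
    show ?thesis
    proof
      show "?f ` {a..b} = {m*a+k..m*b+k}" using ab True by (simp add: image_affinity_atLeastAtMost)
      show "m*a+k < m*b+k" using ab True by simp
      show "?f ` {a<..<b} = {m*a+k<..<m*b+k}"
        using True by (auto simp: image_iff field_simps intro!: bexI[of _ "(_ - k) / m"])
    qed
  next
    case False
    then have m0: "m < 0" using m by simp
    show ?thesis
    proof
      show "?f ` {a..b} = {m*b+k..m*a+k}" using ab m0 by (simp add: image_affinity_atLeastAtMost)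
      show "m*b+k < m*a+k" using ab m0 by simp
      show "?f ` {a<..<b} = {m*b+k<..<m*a+k}"
        using m0 by (auto simp: image_iff field_simps intro!: bexI[of _ "(_ - k) / m"])
    qed
  qed
  have "{a'..b'} \<subseteq> {0..1}" using mem a'b'(1)[symmetric] by auto
  moreover have "{a'<..<b'} \<inter> S = {}" using S io[symmetric] by auto
  moreover have "\<gamma> ` {a'..b'} \<subseteq> fst c"
    unfolding a'b'(1)[symmetric] image_image using mem sub by force
  ultimately have "\<exists>D. continuous_on {a'..b'} D \<and>
      (\<forall>t\<in>{a'..b'}. ((snd c \<circ> \<gamma>) has_vector_derivative D t) (at t within {a'..b'}))"
    using \<gamma>[unfolded C1_off_def, rule_format, OF c, of a' b'] a'b'(2) by simp
  then obtain D where D: "continuous_on {a'..b'} D"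
      "\<And>t. t \<in> {a'..b'} \<Longrightarrow> ((snd c \<circ> \<gamma>) has_vector_derivative D t) (at t within {a'..b'})" by blast
  have "continuous_on {a..b} (\<lambda>t. m *\<^sub>R D (?f t))"
    by (intro continuous_intros continuous_on_compose2[OF D(1)]) (use a'b'(1) in auto)
  moreover have "((snd c \<circ> \<gamma>') has_vector_derivative m *\<^sub>R D (?f t)) (at t within {a..b})"
    if t: "t \<in> {a..b}" for t
  proof -
    have "(?f has_vector_derivative m) (at t within {a..b})"
      by (auto intro!: derivative_eq_intros simp flip: has_real_derivative_iff_has_vector_derivative)
    moreover have "((snd c \<circ> \<gamma>) has_vector_derivative D (?f t)) (at (?f t) within ?f ` {a..b})"
      unfolding a'b'(1) using a'b'(1) t by (intro D(2)) blast
    ultimately have "(((snd c \<circ> \<gamma>) \<circ> ?f) has_vector_derivative m *\<^sub>R D (?f t)) (at t within {a..b})"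
      by (rule vector_diff_chain_within)
    then show ?thesis
      by (rule has_vector_derivative_transform_within[OF _ zero_less_one t]) (simp add: mem)
  qed
  ultimately show ?thesis by blast
qed

end

text \<open>The conditions are put on coordinate expressions because the bundle metric enters the
  distance estimates through its formula in bundle charts.\<close>

locale C0_metric = C1_atlas A for A :: "('a, 'b::euclidean_space) chart set" +
  fixes g :: "('a, 'b) metric_tensor"
  assumes metric_bilinear: "c \<in> A \<Longrightarrow> y \<in> snd c ` fst c \<Longrightarrow> bilinear (metric_in_chart A g c y)"
    and metric_pos: "c \<in> A \<Longrightarrow> y \<in> snd c ` fst c \<Longrightarrow> v \<noteq> 0 \<Longrightarrow> metric_in_chart A g c y v v > 0"
    and metric_continuous: "c \<in> A \<Longrightarrow> continuous_on (snd c ` fst c) (\<lambda>y. metric_in_chart A g c y v w)"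
begin

lemma metric_nonneg: "c \<in> A \<Longrightarrow> y \<in> snd c ` fst c \<Longrightarrow> metric_in_chart A g c y v v \<ge> 0"
  using metric_pos[of c y v] by (cases "v = 0") (auto simp: bilinear_lzero[OF metric_bilinear])

lemma metric_scale:
  "c \<in> A \<Longrightarrow> y \<in> snd c ` fst c \<Longrightarrow> metric_in_chart A g c y (r *\<^sub>R v) (r *\<^sub>R v) = r\<^sup>2 * metric_in_chart A g c y v v"
  by (simp add: bilinear_lmul[OF metric_bilinear] bilinear_rmul[OF metric_bilinear] power2_eq_square)

lemma tnorm_chart_vec:
  assumes "c \<in> A" "p \<in> fst c"
  shows "tnorm g p (chart_vec A c p v) = sqrt (metric_in_chart A g c (snd c p) v v)"
  by (simp add: tnorm_def metric_in_chart_def chart_inv_chart assms)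

lemma speed_chart:
  assumes "pathin (atlas_topology A) \<gamma>" "t \<in> {0<..<1}" "c \<in> A" "\<gamma> t \<in> fst c"
    "((snd c \<circ> \<gamma>) has_vector_derivative v) (at t)"
  shows "speed A g \<gamma> t = sqrt (metric_in_chart A g c (snd c (\<gamma> t)) v v)"
  by (simp add: velocity_chart_vec[OF assms] tnorm_chart_vec assms(3,4))

lemma speed_nonneg:
  assumes "pathin (atlas_topology A) \<gamma>" "C1_off A S \<gamma>" "finite S" "t \<in> {0<..<1} - S"
  shows "speed A g \<gamma> t \<ge> 0"
proof -
  obtain c where "c \<in> A" "\<gamma> t \<in> fst c"
    using path_in_manifold[OF assms(1), of t] assms(4) by (auto simp: manifold_points_def)
  then show ?thesis
    using speed_chart[OF assms(1) _ _ _ velocity_component[OF assms]] assms(4)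
    by (simp add: metric_nonneg)
qed

text \<open>On a closed piece there is a continuous choice of derivative, and the speed formed from
  it can differ from the actual one only at the two ends.\<close>

lemma speed_integrable_chart:
  assumes \<gamma>: "pathin (atlas_topology A) \<gamma>" "C1_off A S \<gamma>" and c: "c \<in> A"
    and ab: "0 \<le> a" "a < b" "b \<le> 1" "{a<..<b} \<inter> S = {}" "\<gamma> ` {a..b} \<subseteq> fst c"
  shows "speed A g \<gamma> integrable_on {a..b}"
proof -
  obtain D where D: "continuous_on {a..b} D"
      "\<And>t. t \<in> {a..b} \<Longrightarrow> ((snd c \<circ> \<gamma>) has_vector_derivative D t) (at t within {a..b})"
    using \<gamma>(2) c ab unfolding C1_off_def by meson
  have h: "continuous_on {a..b} (snd c \<circ> \<gamma>)"
    using ab by (intro path_chart_continuous[OF \<gamma>(1) c]) auto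
  have "continuous_on {a..b} (\<lambda>t. metric_in_chart A g c ((snd c \<circ> \<gamma>) t) (D t) (D t))"
  proof (rule continuous_on_bilinear_family[where B = "\<lambda>t. metric_in_chart A g c ((snd c \<circ> \<gamma>) t)", OF _ _ D(1) D(1)])
    show "bilinear (metric_in_chart A g c ((snd c \<circ> \<gamma>) t))" if "t \<in> {a..b}" for t
      using that ab by (intro metric_bilinear[OF c]) (auto simp: image_subset_iff)
    show "continuous_on {a..b} (\<lambda>t. metric_in_chart A g c ((snd c \<circ> \<gamma>) t) v w)" for v w
      by (rule continuous_on_compose2[OF metric_continuous[OF c] h]) (use ab in auto)
  qed
  then have "(\<lambda>t. sqrt (metric_in_chart A g c ((snd c \<circ> \<gamma>) t) (D t) (D t))) integrable_on {a..b}"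
    by (intro integrable_continuous_real continuous_intros)
  then show ?thesis
  proof (rule integrable_spike_finite[rotated 2])
    show "finite {a,b}" by simp
    fix t assume "t \<in> {a..b} - {a,b}"
    then have t: "t \<in> {a<..<b}" by auto
    then have "((snd c \<circ> \<gamma>) has_vector_derivative D t) (at t)"
      using D(2)[of t] by (simp add: at_within_Icc_at)
    from speed_chart[OF \<gamma>(1) _ c _ this]
    show "speed A g \<gamma> t = sqrt (metric_in_chart A g c ((snd c \<circ> \<gamma>) t) (D t) (D t))"
      using t ab by (auto simp: image_subset_iff)
  qed
qed

text \<open>Integrability on all small intervals suffices, by compactness, so no subdivision adapted
  to charts has to be chosen.\<close>

lemma speed_integrable:
  assumes "piecewise_C1_path A \<gamma>"
  shows "speed A g \<gamma> integrable_on {0..1}"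
proof -
  obtain S where S: "pathin (atlas_topology A) \<gamma>" "finite S" "C1_off A S \<gamma>"
    using assms by (auto simp: piecewise_C1_path_iff)
  have "\<exists>d>0. \<forall>u v. t \<in> cbox u v \<and> cbox u v \<subseteq> ball t d \<and> cbox u v \<subseteq> cbox 0 1 \<longrightarrow>
          speed A g \<gamma> integrable_on cbox u v" if t: "t \<in> cbox 0 1" for t
  proof -
    obtain c where c: "c \<in> A" "\<gamma> t \<in> fst c"
      using path_in_manifold[OF S(1), of t] t by (auto simp: manifold_points_def)
    obtain \<delta> where \<delta>: "\<delta> > 0" "\<And>s. s \<in> {0..1} \<Longrightarrow> \<bar>s - t\<bar> < \<delta> \<Longrightarrow> \<gamma> s \<in> fst c"
      using path_chart[OF S(1) c(1) _ c(2)] t by auto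
    have "open (- (S - {t}))" using S(2) by (intro open_Compl finite_imp_closed) auto
    then obtain e where e: "e > 0" "ball t e \<subseteq> - (S - {t})"
      by (meson ComplI Diff_iff insertI1 open_contains_ball)
    have refl: "speed A g \<gamma> integrable_on {s..s}" for s
      using integrable_on_refl[of "speed A g \<gamma>" s] by simp
    \<comment> \<open>The point \<open>t\<close> is the only possible break, so the interval is cut
      there and neither half has a break in its interior.\<close>
    have "speed A g \<gamma> integrable_on {u..v}"
      if uv: "t \<in> {u..v}" "{u..v} \<subseteq> ball t (min \<delta> e)" "{u..v} \<subseteq> {0..1}" for u v
    proof -
      have in_c: "\<gamma> s \<in> fst c" if "s \<in> {u..v}" for s
        using that uv(2,3) by (intro \<delta>(2)) (auto simp: dist_real_def abs_minus_commute)
      have off: "s \<notin> S" if "s \<in> {u..v}" "s \<noteq> t" for s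
        using that uv(2) e(2) by fastforce
      have "speed A g \<gamma> integrable_on {u..t}"
      proof (cases "u < t")
        case True
        then show ?thesis
          using uv in_c off by (intro speed_integrable_chart[OF S(1,3) c(1)]) fastforce+
      qed (use uv refl[of t] in \<open>auto simp: not_less\<close>)
      moreover have "speed A g \<gamma> integrable_on {t..v}"
      proof (cases "t < v")
        case True
        then show ?thesis
          using uv in_c off by (intro speed_integrable_chart[OF S(1,3) c(1)]) fastforce+
      qed (use uv refl[of t] in \<open>auto simp: not_less\<close>)
      ultimately show ?thesis using uv(1) by (intro Henstock_Kurzweil_Integration.integrable_combine[where a = u and c = t and b = v]) auto
    qed
    then show ?thesis using \<delta>(1) e(1) by (intro exI[of _ "min \<delta> e"]) auto
  qed
  then show ?thesis using integrable_on_little_subintervals[of 0 1 "speed A g \<gamma>"] by simp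
qed

lemma has_integral_speed:
  "piecewise_C1_path A \<gamma> \<Longrightarrow> (speed A g \<gamma> has_integral riemannian_length A g \<gamma>) {0..1}"
  unfolding riemannian_length_def by (intro integrable_integral speed_integrable)

lemma length_nonneg:
  assumes "piecewise_C1_path A \<gamma>"
  shows "riemannian_length A g \<gamma> \<ge> 0"
proof -
  obtain S where S: "pathin (atlas_topology A) \<gamma>" "finite S" "C1_off A S \<gamma>"
    using assms by (auto simp: piecewise_C1_path_iff)
  \<comment> \<open>The zero function has derivative 0, which the speed dominates off the breaks;
    the integral bound for it is the claim. At the breaks the sign of the speed is not
    controlled.\<close>
  have "\<bar>(\<lambda>_::real. 0::real) 1 - 0\<bar> \<le> 1 * riemannian_length A g \<gamma>"
    by (rule abs_diff_le_integral[OF S(2) _ has_integral_speed[OF assms]])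
       (auto intro!: exI[of _ 0] simp: speed_nonneg[OF S(1,3,2)])
  then show ?thesis by simp
qed

lemma length_linepath_le:
  assumes c: "c \<in> A" and yz: "closed_segment y z \<subseteq> snd c ` fst c" and L: "L \<ge> 0"
    and le: "\<And>x. x \<in> closed_segment y z \<Longrightarrow> metric_in_chart A g c x (z - y) (z - y) \<le> L\<^sup>2"
  shows "riemannian_length A g (chart_inv c \<circ> linepath y z) \<le> L"
proof -
  let ?\<gamma> = "chart_inv c \<circ> linepath y z"
  note path = piecewise_C1_linepath[OF c yz]
  have "piecewise_C1_path A ?\<gamma>" unfolding piecewise_C1_path_iff using path by blast
  note int = has_integral_speed[OF this]
  have img: "linepath y z t \<in> snd c ` fst c" if "t \<in> {0..1}" for t
    using that yz linepath_in_path[of t y z] by auto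
  have sp: "speed A g ?\<gamma> t \<le> L" if t: "t \<in> {0<..<1}" for t
  proof -
    have tt: "t \<in> {0..1}" using t by auto
    have "((snd c \<circ> ?\<gamma>) has_vector_derivative (z - y)) (at t)"
      by (rule has_vector_derivative_transform_within_open[OF has_vector_derivative_linepath_within, where S="{0<..<1}"])
         (use t img in \<open>auto simp: chart_chart_inv\<close>)
    from speed_chart[OF path(1) t c _ this]
    have "speed A g ?\<gamma> t = sqrt (metric_in_chart A g c (linepath y z t) (z - y) (z - y))"
      using img[OF tt] by (simp add: chart_inv_in chart_chart_inv)
    also have "\<dots> \<le> sqrt (L\<^sup>2)"
      by (intro real_sqrt_le_mono le linepath_in_path[OF tt])
    finally show ?thesis using L by simp
  qed
  \<comment> \<open>The speed is bounded only at interior times. Overwriting it by \<open>L\<close>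
    at the two ends gives a bound everywhere without changing the integral.\<close>
  have int': "((\<lambda>t. if t \<in> {0,1} then L else speed A g ?\<gamma> t) has_integral riemannian_length A g ?\<gamma>) {0..1}"
    by (rule has_integral_spike_finite[of "{0,1}", OF _ _ int]) auto
  have "((\<lambda>t::real. L) has_integral L) {0..1}"
    using has_integral_const_real[of L 0 1] by simp
  from has_integral_le[OF int' this] show ?thesis using sp by force
qed

text \<open>Agreement of the two paths is required on an open interval only, so that each half of a
  joined path can be treated separately.\<close>

lemma speed_affine:
  assumes \<gamma>: "pathin (atlas_topology A) \<gamma>" "C1_off A S \<gamma>" "finite S"
    and \<gamma>': "pathin (atlas_topology A) \<gamma>'"
    and t: "t \<in> {a<..<b}" "t \<in> {0<..<1}" "m * t + k \<in> {0<..<1} - S"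
    and eq: "\<And>s. s \<in> {a<..<b} \<Longrightarrow> \<gamma>' s = \<gamma> (m * s + k)"
  shows "speed A g \<gamma>' t = \<bar>m\<bar> * speed A g \<gamma> (m * t + k)"
proof -
  let ?f = "\<lambda>t. m * t + k"
  obtain c where c: "c \<in> A" "\<gamma>' t \<in> fst c"
    using path_in_manifold[OF \<gamma>', of t] t(2) by (auto simp: manifold_points_def)
  have c': "\<gamma> (?f t) \<in> fst c" using c(2) eq[OF t(1)] by simp
  define v where "v = velocity A \<gamma> (?f t) c"
  have v: "((snd c \<circ> \<gamma>) has_vector_derivative v) (at (?f t))"
    unfolding v_def by (rule velocity_component[OF \<gamma> t(3) c(1) c'])
  have "(?f has_vector_derivative m) (at t)"
    by (auto intro!: derivative_eq_intros simp flip: has_real_derivative_iff_has_vector_derivative)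
  from vector_diff_chain_at[OF this v] have "((snd c \<circ> \<gamma> \<circ> ?f) has_vector_derivative m *\<^sub>R v) (at t)" .
  then have "((snd c \<circ> \<gamma>') has_vector_derivative m *\<^sub>R v) (at t)"
    by (rule has_vector_derivative_transform_within_open[where S="{a<..<b}"]) (use t eq in auto)
  from speed_chart[OF \<gamma>' t(2) c this] speed_chart[OF \<gamma>(1) _ c(1) c' v] show ?thesis
    using t(3) c c' eq[OF t(1)] by (simp add: metric_scale real_sqrt_mult)
qed

lemma piecewise_C1_reverse:
  assumes "piecewise_C1_path A \<gamma>"
  shows "piecewise_C1_path A (\<lambda>t. \<gamma> (1 - t))"
    and "riemannian_length A g (\<lambda>t. \<gamma> (1 - t)) = riemannian_length A g \<gamma>"
proof -
  obtain S where S: "pathin (atlas_topology A) \<gamma>" "finite S" "C1_off A S \<gamma>"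
    using assms by (auto simp: piecewise_C1_path_iff)
  let ?f = "\<lambda>t::real. - 1 * t + 1" and ?\<gamma> = "\<lambda>t. \<gamma> (1 - t)"
  have "continuous_map (top_of_set {0..1}) (top_of_set {0..1}) (\<lambda>t::real. 1 - t)"
    by (auto simp: continuous_map_in_subtopology intro!: continuous_intros)
  from continuous_map_compose[OF this S(1)[unfolded pathin_def]]
  have path: "pathin (atlas_topology A) ?\<gamma>" by (simp add: pathin_def o_def)
  have fin: "finite (?f -` S)" using S(2) by (intro finite_vimageI) (auto simp: inj_def)
  have "C1_off A (?f -` S) ?\<gamma>"
    unfolding C1_off_def
    by (intro ballI allI impI, rule affine_C1[OF S(3), of "-1"]) (auto simp: image_subset_iff)
  with path fin show *: "piecewise_C1_path A ?\<gamma>" by (auto simp: piecewise_C1_path_iff)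
  have "((\<lambda>t. speed A g \<gamma> (- 1 *\<^sub>R t + 1)) has_integral
     (1 / \<bar>- 1\<bar> ^ DIM(real)) *\<^sub>R riemannian_length A g \<gamma>) ((\<lambda>x. (1 / - 1) *\<^sub>R x + - ((1 / - 1) *\<^sub>R 1)) ` cbox 0 1)"
    by (rule has_integral_affinity) (use has_integral_speed[OF assms] in auto)
  moreover have "((\<lambda>x::real. (1 / - 1) *\<^sub>R x + - ((1 / - 1) *\<^sub>R 1)) ` cbox 0 1) = {0..1}"
    using image_affinity_atLeastAtMost[of "-1" 1 0 "1::real"] by simp
  ultimately have "((\<lambda>t. speed A g \<gamma> (1 - t)) has_integral riemannian_length A g \<gamma>) {0..1}"
    by simp
  then have "(speed A g ?\<gamma> has_integral riemannian_length A g \<gamma>) {0..1}"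
  proof (rule has_integral_spike_finite[rotated 2])
    show "finite ({0,1} \<union> ?f -` S)" using fin by simp
    fix t :: real assume "t \<in> {0..1} - ({0,1} \<union> ?f -` S)"
    then show "speed A g ?\<gamma> t = speed A g \<gamma> (1 - t)"
      using speed_affine[OF S(1,3,2) path, of t 0 1 "-1" 1] by force
  qed
  then show "riemannian_length A g ?\<gamma> = riemannian_length A g \<gamma>"
    using has_integral_unique has_integral_speed[OF *] by blast
qed

lemma piecewise_C1_join:
  assumes \<gamma>: "piecewise_C1_path A \<gamma>" and \<gamma>': "piecewise_C1_path A \<gamma>'" and eq: "\<gamma> 1 = \<gamma>' 0"
  shows "piecewise_C1_path A (path_join \<gamma> \<gamma>')"
    and "riemannian_length A g (path_join \<gamma> \<gamma>') = riemannian_length A g \<gamma> + riemannian_length A g \<gamma>'"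
proof -
  obtain S where S: "pathin (atlas_topology A) \<gamma>" "finite S" "C1_off A S \<gamma>"
    using \<gamma> by (auto simp: piecewise_C1_path_iff)
  obtain S' where S': "pathin (atlas_topology A) \<gamma>'" "finite S'" "C1_off A S' \<gamma>'"
    using \<gamma>' by (auto simp: piecewise_C1_path_iff)
  let ?j = "path_join \<gamma> \<gamma>'"
  let ?f = "\<lambda>t::real. 2 * t + 0" and ?f' = "\<lambda>t::real. 2 * t + (- 1)"
  have path: "pathin (atlas_topology A) ?j"
    unfolding pathin_def path_join_def
  proof (rule continuous_map_cases_le)
    let ?X = "top_of_set {0..1::real}"
    show "continuous_map ?X euclideanreal (\<lambda>x. x)" "continuous_map ?X euclideanreal (\<lambda>x. 1/2)"
      by (auto intro!: continuous_intros)
    have "continuous_map (subtopology ?X {x \<in> topspace ?X. x \<le> 1/2}) (top_of_set {0..1}) (\<lambda>t::real. 2 * t)"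
      by (auto simp: continuous_map_in_subtopology subtopology_subtopology intro!: continuous_intros)
    from continuous_map_compose[OF this S(1)[unfolded pathin_def]]
    show "continuous_map (subtopology ?X {x \<in> topspace ?X. x \<le> 1/2}) (atlas_topology A) (\<lambda>x. \<gamma> (2 * x))"
      by (simp add: o_def)
    have "continuous_map (subtopology ?X {x \<in> topspace ?X. 1/2 \<le> x}) (top_of_set {0..1}) (\<lambda>t::real. 2 * t - 1)"
      by (auto simp: continuous_map_in_subtopology subtopology_subtopology intro!: continuous_intros)
    from continuous_map_compose[OF this S'(1)[unfolded pathin_def]]
    show "continuous_map (subtopology ?X {x \<in> topspace ?X. 1/2 \<le> x}) (atlas_topology A) (\<lambda>x. \<gamma>' (2 * x - 1))"
      by (simp add: o_def)
  qed (use eq in \<open>auto simp: field_simps\<close>)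
  \<comment> \<open>With 0, 1 and 1/2 counted as breaks, one finite set also absorbs the ends of
    both halves in the integrals below.\<close>
  let ?T = "{0,1,1/2} \<union> ?f -` S \<union> ?f' -` S'"
  have fin: "finite ?T" using S(2) S'(2) by (intro finite_UnI finite_vimageI) (auto simp: inj_def)
  have off: "C1_off A ?T ?j"
    unfolding C1_off_def
  proof (intro ballI allI impI, elim conjE)
    fix c and a b :: real
    assume c: "c \<in> A" and ab: "0 \<le> a" "a < b" "b \<le> 1" "{a<..<b} \<inter> ?T = {}" "?j ` {a..b} \<subseteq> fst c"
    have "b \<le> 1/2 \<or> 1/2 \<le> a" using ab(4) by (smt (verit) UnCI disjoint_iff greaterThanLessThan_iff insertCI)
    then show "\<exists>D. continuous_on {a..b} D \<and>
              (\<forall>t\<in>{a..b}. ((snd c \<circ> ?j) has_vector_derivative D t) (at t within {a..b}))"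
    proof
      assume "b \<le> 1/2"
      then show ?thesis
        by (intro affine_C1[OF S(3), of 2 _ _ _ 0] c) (use ab in \<open>auto simp: path_join_def\<close>)
    next
      assume "1/2 \<le> a"
      \<comment> \<open>At 1/2 \<open>path_join\<close> still follows the first path; the matching
        end points make the second formula valid there too.\<close>
      then have "?j t = \<gamma>' (2 * t + -1)" if "t \<in> {a..b}" for t
        using that eq by (cases "t = 1/2") (auto simp: path_join_def field_simps)
      then show ?thesis
        using \<open>1/2 \<le> a\<close> by (intro affine_C1[OF S'(3), of 2 _ _ _ "-1"] c) (use ab in auto)
    qed
  qed
  show *: "piecewise_C1_path A ?j"
    unfolding piecewise_C1_path_iff by (intro conjI exI[of _ ?T] path fin off)
  have I1: "{0..1/2} = (\<lambda>x::real. (1/2) *\<^sub>R x + - ((1/2) *\<^sub>R 0)) ` cbox 0 1"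
    and I2: "{1/2..1} = (\<lambda>x::real. (1/2) *\<^sub>R x + - ((1/2) *\<^sub>R (-1))) ` cbox 0 1"
    using image_affinity_atLeastAtMost[of "1/2" 0 0 "1::real"] image_affinity_atLeastAtMost[of "1/2" "1/2" 0 "1::real"] by simp_all
  have "((\<lambda>t. speed A g \<gamma> (2 *\<^sub>R t + 0)) has_integral
     (1 / \<bar>2\<bar> ^ DIM(real)) *\<^sub>R riemannian_length A g \<gamma>) {0..1/2}" unfolding I1
    by (rule has_integral_affinity) (use has_integral_speed[OF \<gamma>] in auto)
  \<comment> \<open>The factor 1/2 of the substitution is cancelled by the doubled speed.\<close>
  from has_integral_mult_right[OF this, of 2]
  have "((\<lambda>t. 2 * speed A g \<gamma> (2 * t + 0)) has_integral riemannian_length A g \<gamma>) {0..1/2}" by simp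
  then have 1: "(speed A g ?j has_integral riemannian_length A g \<gamma>) {0..1/2}"
  proof (rule has_integral_spike_finite[OF fin, rotated])
    fix t assume t: "t \<in> {0..1/2} - ?T"
    have "speed A g ?j t = \<bar>2\<bar> * speed A g \<gamma> (2 * t + 0)"
      by (rule speed_affine[OF S(1,3,2) path, of t 0 "1/2"]) (use t in \<open>auto simp: path_join_def\<close>)
    then show "speed A g ?j t = 2 * speed A g \<gamma> (2 * t + 0)" by simp
  qed
  have "((\<lambda>t. speed A g \<gamma>' (2 *\<^sub>R t + -1)) has_integral
     (1 / \<bar>2\<bar> ^ DIM(real)) *\<^sub>R riemannian_length A g \<gamma>') {1/2..1}" unfolding I2
    by (rule has_integral_affinity) (use has_integral_speed[OF \<gamma>'] in auto)
  from has_integral_mult_right[OF this, of 2]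
  have "((\<lambda>t. 2 * speed A g \<gamma>' (2 * t + -1)) has_integral riemannian_length A g \<gamma>') {1/2..1}" by simp
  then have 2: "(speed A g ?j has_integral riemannian_length A g \<gamma>') {1/2..1}"
  proof (rule has_integral_spike_finite[OF fin, rotated])
    fix t assume t: "t \<in> {1/2..1} - ?T"
    have "speed A g ?j t = \<bar>2\<bar> * speed A g \<gamma>' (2 * t + -1)"
      by (rule speed_affine[OF S'(1,3,2) path, of t "1/2" 1]) (use t in \<open>auto simp: path_join_def\<close>)
    then show "speed A g ?j t = 2 * speed A g \<gamma>' (2 * t + -1)" by simp
  qed
  have "(speed A g ?j has_integral riemannian_length A g \<gamma> + riemannian_length A g \<gamma>') {0..1}"
    by (rule has_integral_combine[OF _ _ 1 2]) auto
  then show "riemannian_length A g ?j = riemannian_length A g \<gamma> + riemannian_length A g \<gamma>'"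
    using has_integral_unique has_integral_speed[OF *] by blast
qed

end

text \<open>The cut-off profile of the bump functions: squaring removes the corner of
  \<open>max 0 x\<close> at 0.\<close>

lemma has_real_derivative_max0_square:
  "((\<lambda>x::real. (max 0 x)\<^sup>2) has_real_derivative 2 * max 0 x) (at x)"
proof (cases "x = 0")
  case True
  have "((\<lambda>h::real. (max 0 h)\<^sup>2 / h) \<longlongrightarrow> 0) (at 0)"
  proof (rule tendsto_rabs_zero_cancel, rule tendsto_sandwich[of "\<lambda>_. 0" _ _ "\<lambda>h. \<bar>h\<bar>"])
    show "\<forall>\<^sub>F h::real in at 0. \<bar>(max 0 h)\<^sup>2 / h\<bar> \<le> \<bar>h\<bar>"
      by (intro always_eventually) (auto simp: max_def power2_eq_square)
    show "((\<lambda>h::real. \<bar>h\<bar>) \<longlongrightarrow> 0) (at 0)" using tendsto_rabs[OF tendsto_ident_at[of "0::real" UNIV]] by simp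
  qed auto
  then show ?thesis using True by (simp add: DERIV_def)
next
  case False
  show ?thesis
  proof (cases "x > 0")
    case True
    have "((\<lambda>x::real. x\<^sup>2) has_real_derivative 2 * x) (at x)"
      by (auto intro!: derivative_eq_intros)
    then have "((\<lambda>x::real. (max 0 x)\<^sup>2) has_real_derivative 2 * x) (at x)"
      by (rule has_field_derivative_transform_within_open[of _ _ _ "{0<..}"]) (use True in auto)
    then show ?thesis using True by simp
  next
    case neg: False
    have "((\<lambda>x::real. (max 0 x)\<^sup>2) has_real_derivative 0) (at x)"
      by (rule has_field_derivative_transform_within_open[of "\<lambda>_. 0" _ _ "{..<0}"]) (use neg False in auto)
    then show ?thesis using neg by simp
  qed
qed

section \<open>Comparison with the Euclidean norm, and functions with bounded differential\<close>

context C0_metric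
begin

lemma metric_continuous_pair:
  assumes c: "c \<in> A" and K: "K \<subseteq> snd c ` fst c"
  shows "continuous_on (K \<times> T) (\<lambda>z. metric_in_chart A g c (fst z) (snd z) (snd z))"
proof (rule continuous_on_bilinear_family[where B = "\<lambda>z. metric_in_chart A g c (fst z)"])
  show "bilinear (metric_in_chart A g c (fst z))" if "z \<in> K \<times> T" for z
    using that K by (intro metric_bilinear[OF c]) auto
  show "continuous_on (K \<times> T) (\<lambda>z. metric_in_chart A g c (fst z) v w)" for v w
    by (rule continuous_on_compose2[OF metric_continuous[OF c]]) (use K in \<open>auto intro!: continuous_intros\<close>)
qed (auto intro!: continuous_intros)

text \<open>The metric attains a positive minimum and a maximum on the compact product of
  \<open>K\<close> with the unit sphere; homogeneity extends both bounds to all vectors.\<close>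

lemma metric_compact_bounds:
  assumes c: "c \<in> A" and K: "compact K" "K \<subseteq> snd c ` fst c"
  obtains m M where "m > 0" "M > 0"
    "\<And>y v. y \<in> K \<Longrightarrow> m * (norm v)\<^sup>2 \<le> metric_in_chart A g c y v v"
    "\<And>y v. y \<in> K \<Longrightarrow> metric_in_chart A g c y v v \<le> M * (norm v)\<^sup>2"
proof (cases "K = {}")
  case True
  then show ?thesis using that[of 1 1] by auto
next
  case False
  let ?G = "\<lambda>z. metric_in_chart A g c (fst z) (snd z) (snd z)"
  let ?T = "K \<times> sphere (0::'b) 1"
  obtain b :: 'b where "b \<in> Basis" using nonempty_Basis by blast
  then have ne: "?T \<noteq> {}" using False by (auto intro!: exI[of _ b])
  have cpt: "compact ?T" using K(1) by (intro compact_Times compact_sphere)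
  have cont: "continuous_on ?T ?G" by (rule metric_continuous_pair[OF c K(2)])
  obtain z where z: "z \<in> ?T" "\<And>x. x \<in> ?T \<Longrightarrow> ?G z \<le> ?G x"
    using continuous_attains_inf[OF cpt ne cont] by blast
  obtain z' where z': "z' \<in> ?T" "\<And>x. x \<in> ?T \<Longrightarrow> ?G x \<le> ?G z'"
    using continuous_attains_sup[OF cpt ne cont] by blast
  have pos: "?G x > 0" if "x \<in> ?T" for x
    using that K(2) by (intro metric_pos[OF c]) auto
  have eq: "metric_in_chart A g c y v v = ?G (y, v /\<^sub>R norm v) * (norm v)\<^sup>2" if "y \<in> K" "v \<noteq> 0" for y v
    using metric_scale[OF c, of y "norm v" "v /\<^sub>R norm v"] that K(2) by (auto simp: mult.commute)
  have zero: "metric_in_chart A g c y 0 0 = 0" if "y \<in> K" for y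
    using that K(2) by (intro bilinear_lzero[OF metric_bilinear[OF c]]) auto
  show ?thesis
  proof (rule that[OF pos[OF z(1)] pos[OF z'(1)]])
    fix y v assume y: "y \<in> K"
    show "?G z * (norm v)\<^sup>2 \<le> metric_in_chart A g c y v v"
    proof (cases "v = 0")
      case False
      then have "?G z \<le> ?G (y, v /\<^sub>R norm v)" using y by (intro z(2)) simp
      then show ?thesis unfolding eq[OF y False] by (intro mult_right_mono) auto
    qed (simp add: zero y)
    show "metric_in_chart A g c y v v \<le> ?G z' * (norm v)\<^sup>2"
    proof (cases "v = 0")
      case False
      then have "?G (y, v /\<^sub>R norm v) \<le> ?G z'" using y by (intro z'(2)) simp
      then show ?thesis unfolding eq[OF y False] by (intro mult_right_mono) auto
    qed (simp add: zero y)
  qed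
qed

text \<open>One chart around each point is enough. A bump function can thus be treated in its own
  chart where that chart is defined, and elsewhere in any chart, near points where it
  vanishes.\<close>

definition Lipschitz_differential :: "('a \<Rightarrow> real) \<Rightarrow> real \<Rightarrow> bool" where
  "Lipschitz_differential f C \<longleftrightarrow> (\<forall>p\<in>manifold_points A. \<exists>c\<in>A. p \<in> fst c \<and>
     (\<exists>F'. ((f \<circ> chart_inv c) has_derivative F') (at (snd c p)) \<and>
           (\<forall>v. \<bar>F' v\<bar> \<le> C * sqrt (metric_in_chart A g c (snd c p) v v))))"

lemma Lipschitz_differentialD:
  "Lipschitz_differential f C \<Longrightarrow> p \<in> manifold_points A \<Longrightarrow> \<exists>c F'. c \<in> A \<and> p \<in> fst c \<and>
     ((f \<circ> chart_inv c) has_derivative F') (at (snd c p)) \<and>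
     (\<forall>v. \<bar>F' v\<bar> \<le> C * sqrt (metric_in_chart A g c (snd c p) v v))"
  unfolding Lipschitz_differential_def Bex_def by (drule (1) bspec) (elim exE conjE, intro exI conjI)

text \<open>Along the path the derivative of \<open>f\<close> is at most \<open>C\<close> times the
  speed. Continuity along the path, needed to integrate across the breaks, follows from
  differentiability in the charts.\<close>

lemma Lipschitz_length:
  assumes \<gamma>: "piecewise_C1_path A \<gamma>" and f: "Lipschitz_differential f C"
  shows "\<bar>f (\<gamma> 1) - f (\<gamma> 0)\<bar> \<le> C * riemannian_length A g \<gamma>"
proof -
  obtain S where S: "pathin (atlas_topology A) \<gamma>" "finite S" "C1_off A S \<gamma>"
    using \<gamma> by (auto simp: piecewise_C1_path_iff)
  have "\<bar>(f \<circ> \<gamma>) 1 - (f \<circ> \<gamma>) 0\<bar> \<le> C * riemannian_length A g \<gamma>"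
  proof (rule abs_diff_le_integral[OF S(2) _ has_integral_speed[OF \<gamma>]])
    show "continuous_on {0..1} (f \<circ> \<gamma>)"
      unfolding continuous_on_eq_continuous_within
    proof
      fix t :: real assume t: "t \<in> {0..1}"
      note Lipschitz_differentialD[OF f path_in_manifold[OF S(1) t]]
      then obtain c F' where c: "c \<in> A" "\<gamma> t \<in> fst c" and F': "((f \<circ> chart_inv c) has_derivative F') (at (snd c (\<gamma> t)))"
        by (elim exE conjE) (rule that)
      obtain \<delta> where \<delta>: "\<delta> > 0" "\<And>s. s \<in> {0..1} \<Longrightarrow> \<bar>s - t\<bar> < \<delta> \<Longrightarrow> \<gamma> s \<in> fst c"
        using path_chart[OF S(1) c(1) t c(2)] by auto
      let ?I = "{0..1} \<inter> ball t \<delta>"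
      have in_c: "\<gamma> s \<in> fst c" if "s \<in> ?I" for s
        using that by (intro \<delta>(2)) (auto simp: dist_real_def abs_minus_commute)
      have tI: "t \<in> ?I" using t \<delta>(1) by auto
      have "continuous_on ?I (snd c \<circ> \<gamma>)"
        using in_c by (intro path_chart_continuous[OF S(1) c(1)]) auto
      then have "continuous (at t within ?I) (snd c \<circ> \<gamma>)"
        using tI continuous_on_eq_continuous_within by blast
      moreover have "continuous (at ((snd c \<circ> \<gamma>) t) within (snd c \<circ> \<gamma>) ` ?I) (f \<circ> chart_inv c)"
        using has_derivative_continuous[OF F'] by (simp add: continuous_at_imp_continuous_at_within)
      ultimately have "continuous (at t within ?I) ((f \<circ> chart_inv c) \<circ> (snd c \<circ> \<gamma>))"
        by (rule continuous_within_compose)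
      then have "continuous (at t within ?I) (f \<circ> \<gamma>)"
        by (rule continuous_transform_within[OF _ zero_less_one tI])
           (use in_c c(1) in \<open>auto simp: chart_inv_chart\<close>)
      moreover have "at t within ?I = at t within {0..1}"
        using \<delta>(1) by (intro at_within_nhd[of _ "ball t \<delta>"]) auto
      ultimately show "continuous (at t within {0..1}) (f \<circ> \<gamma>)" by simp
    qed
  next
    fix t assume t: "t \<in> {0<..<1} - S"
    then have "\<gamma> t \<in> manifold_points A" using path_in_manifold[OF S(1), of t] by auto
    note Lipschitz_differentialD[OF f this]
    then obtain c F' where c: "c \<in> A" "\<gamma> t \<in> fst c"
      and F': "((f \<circ> chart_inv c) has_derivative F') (at (snd c (\<gamma> t)))"
      and le: "\<forall>v. \<bar>F' v\<bar> \<le> C * sqrt (metric_in_chart A g c (snd c (\<gamma> t)) v v)"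
      by (elim exE conjE) (rule that)
    let ?v = "velocity A \<gamma> t c"
    have v: "((snd c \<circ> \<gamma>) has_vector_derivative ?v) (at t)"
      by (rule velocity_component[OF S(1,3,2) t c])
    obtain \<eta> where \<eta>: "\<eta> > 0" "{t - \<eta>..t + \<eta>} \<subseteq> {0..1}" "\<gamma> ` {t - \<eta>..t + \<eta>} \<subseteq> fst c"
      by (rule path_chart_near[OF S(1) c(1) _ c(2) S(2)]) (use t in simp, rule that)
    have "((f \<circ> chart_inv c \<circ> (snd c \<circ> \<gamma>)) has_vector_derivative F' ?v) (at t)"
      using diff_chain_at[OF v[unfolded has_vector_derivative_def], of "f \<circ> chart_inv c" F'] F'
        linear_scale[OF has_derivative_linear[OF F']]
      by (simp add: has_vector_derivative_def o_def)
    then have "((f \<circ> \<gamma>) has_vector_derivative F' ?v) (at t)"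
    proof (rule has_vector_derivative_transform_within_open)
      show "open {t-\<eta><..<t+\<eta>}" "t \<in> {t-\<eta><..<t+\<eta>}" using \<eta>(1) by auto
      fix s assume "s \<in> {t-\<eta><..<t+\<eta>}"
      then have "\<gamma> s \<in> fst c" using \<eta>(3) by auto
      then show "(f \<circ> chart_inv c \<circ> (snd c \<circ> \<gamma>)) s = (f \<circ> \<gamma>) s"
        by (simp add: chart_inv_chart c(1))
    qed
    moreover have "\<bar>F' ?v\<bar> \<le> C * speed A g \<gamma> t"
      using le[rule_format, of ?v] speed_chart[OF S(1) _ c v] t by simp
    ultimately show "\<exists>D. ((f \<circ> \<gamma>) has_vector_derivative D) (at t) \<and> \<bar>D\<bar> \<le> C * speed A g \<gamma> t"
      by blast
  qed
  then show ?thesis by simp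
qed

lemma dist_le_length:
  assumes "piecewise_C1_path A \<gamma>" "\<gamma> 0 = p" "\<gamma> 1 = q"
  shows "riemannian_dist A g p q \<le> riemannian_length A g \<gamma>"
proof -
  have "pathin (atlas_topology A) \<gamma>" using assms by (auto simp: piecewise_C1_path_def)
  then have pq: "p \<in> manifold_points A" "q \<in> manifold_points A"
    using path_in_manifold[of \<gamma> 0] path_in_manifold[of \<gamma> 1] assms by auto
  have "bdd_below (riemannian_length A g ` {\<gamma>. piecewise_C1_path A \<gamma> \<and> \<gamma> 0 = p \<and> \<gamma> 1 = q})"
    by (rule bdd_belowI2[of _ 0]) (auto intro: length_nonneg)
  then show ?thesis
    unfolding riemannian_dist_def using pq assms by (auto intro!: cINF_lower)
qed

lemma chart_segment_path:
  assumes "c \<in> A" "closed_segment y z \<subseteq> snd c ` fst c"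
  shows "piecewise_C1_path A (chart_inv c \<circ> linepath y z)"
    "(chart_inv c \<circ> linepath y z) 0 = chart_inv c y" "(chart_inv c \<circ> linepath y z) 1 = chart_inv c z"
  using piecewise_C1_linepath[OF assms] unfolding piecewise_C1_path_iff
  by (auto simp: linepath_def)

lemma dist_chart_segment:
  assumes "c \<in> A" "closed_segment y z \<subseteq> snd c ` fst c" "L \<ge> 0"
    and "\<And>x. x \<in> closed_segment y z \<Longrightarrow> metric_in_chart A g c x (z - y) (z - y) \<le> L\<^sup>2"
  shows "riemannian_dist A g (chart_inv c y) (chart_inv c z) \<le> L"
  using dist_le_length[OF chart_segment_path[OF assms(1,2)]] length_linepath_le[OF assms] by linarith

text \<open>Straight segments stay inside a coordinate ball, where the metric is at most a constant
  times the Euclidean one, so they bound the distance from above.\<close>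

lemma dist_small_of_chart:
  assumes c: "c \<in> A" and p: "p \<in> fst c" and \<epsilon>: "\<epsilon> > 0"
  shows "\<exists>\<delta>>0. \<forall>q\<in>fst c. dist (snd c q) (snd c p) < \<delta> \<longrightarrow> riemannian_dist A g q p < \<epsilon>"
proof -
  obtain r where r: "r > 0" "cball (snd c p) r \<subseteq> snd c ` fst c"
    using chart_open[OF c] p by (meson imageI open_contains_cball)
  obtain m M where M: "M > 0"
    "\<And>y v. y \<in> cball (snd c p) r \<Longrightarrow> metric_in_chart A g c y v v \<le> M * (norm v)\<^sup>2"
    using metric_compact_bounds[OF c compact_cball r(2)] by metis
  show ?thesis
  proof (intro exI conjI ballI impI)
    show "min r (\<epsilon> / (2 * sqrt M)) > 0" using r(1) M(1) \<epsilon> by simp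
    fix q assume q: "q \<in> fst c" "dist (snd c q) (snd c p) < min r (\<epsilon> / (2 * sqrt M))"
    have seg: "closed_segment (snd c q) (snd c p) \<subseteq> cball (snd c p) r"
      using q r(1) by (intro closed_segment_subset convex_cball) (auto simp: dist_commute)
    have "riemannian_dist A g (chart_inv c (snd c q)) (chart_inv c (snd c p)) \<le> sqrt M * dist (snd c q) (snd c p)"
    proof (rule dist_chart_segment[OF c])
      show "closed_segment (snd c q) (snd c p) \<subseteq> snd c ` fst c" using seg r(2) by blast
      fix x assume "x \<in> closed_segment (snd c q) (snd c p)"
      then have "x \<in> cball (snd c p) r" using seg by blast
      from M(2)[OF this, of "snd c p - snd c q"] M(1)
      show "metric_in_chart A g c x (snd c p - snd c q) (snd c p - snd c q) \<le> (sqrt M * dist (snd c q) (snd c p))\<^sup>2"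
        by (simp add: power_mult_distrib dist_norm norm_minus_commute)
    qed (use M in auto)
    also have "\<dots> \<le> sqrt M * (\<epsilon> / (2 * sqrt M))" using q(2) M(1) by (intro mult_left_mono) auto
    also have "\<dots> < \<epsilon>" using M(1) \<epsilon> by simp
    finally show "riemannian_dist A g q p < \<epsilon>" using q(1) p c by (simp add: chart_inv_chart)
  qed
qed

text \<open>Joinability is an equivalence relation by reversal and concatenation, and coordinate
  balls lie in single classes because they are convex. So the class of \<open>p\<close> and its
  complement are both open.\<close>

lemma joined_of_connected:
  assumes conn: "connected_space (atlas_topology A)" and p: "p \<in> manifold_points A" and q: "q \<in> manifold_points A"
  shows "\<exists>\<gamma>. piecewise_C1_path A \<gamma> \<and> \<gamma> 0 = p \<and> \<gamma> 1 = q"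
proof -
  define J where "J p q \<longleftrightarrow> (\<exists>\<gamma>. piecewise_C1_path A \<gamma> \<and> \<gamma> 0 = p \<and> \<gamma> 1 = q)" for p q
  have trans: "J x z" if J: "J x y" "J y z" for x y z
  proof -
    obtain \<gamma> \<gamma>' where "piecewise_C1_path A \<gamma>" "\<gamma> 0 = x" "\<gamma> 1 = y" "piecewise_C1_path A \<gamma>'" "\<gamma>' 0 = y" "\<gamma>' 1 = z"
      using J unfolding J_def by blast
    then show ?thesis using piecewise_C1_join(1)[of \<gamma> \<gamma>'] unfolding J_def
      by (intro exI[of _ "path_join \<gamma> \<gamma>'"]) (simp add: path_join_def)
  qed
  have sym: "J y x" if xy: "J x y" for x y
  proof -
    obtain \<gamma> where "piecewise_C1_path A \<gamma>" "\<gamma> 0 = x" "\<gamma> 1 = y" using xy unfolding J_def by blast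
    then show ?thesis using piecewise_C1_reverse(1)[of \<gamma>] unfolding J_def
      by (intro exI[of _ "\<lambda>t. \<gamma> (1 - t)"]) simp
  qed
  have loc: "\<exists>U. openin (atlas_topology A) U \<and> x \<in> U \<and> (\<forall>y\<in>U. y \<in> manifold_points A \<and> J x y)"
    if x: "x \<in> manifold_points A" for x
  proof -
    obtain c where c: "c \<in> A" "x \<in> fst c" using x by (auto simp: manifold_points_def)
    obtain r where r: "r > 0" "ball (snd c x) r \<subseteq> snd c ` fst c"
      using chart_open[OF c(1)] c(2) by (meson imageI open_contains_ball)
    have "J x y" if y: "y \<in> fst c" "snd c y \<in> ball (snd c x) r" for y
    proof -
      have "closed_segment (snd c x) (snd c y) \<subseteq> ball (snd c x) r"
        using y r(1) by (intro closed_segment_subset) auto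
      then have "closed_segment (snd c x) (snd c y) \<subseteq> snd c ` fst c" using r(2) by blast
      from chart_segment_path[OF c(1) this] show ?thesis unfolding J_def
        using c y by (intro exI[of _ "chart_inv c \<circ> linepath (snd c x) (snd c y)"]) (simp add: chart_inv_chart)
    qed
    then show ?thesis
      using chart_preimage_open[OF c(1) open_ball, of "snd c x" r] c r(1) in_manifold[OF c(1)]
      by (intro exI[of _ "fst c \<inter> snd c -` ball (snd c x) r"]) auto
  qed
  define R where "R = {q \<in> manifold_points A. J p q}"
  have R_sub: "R \<subseteq> manifold_points A" by (auto simp: R_def)
  have "openin (atlas_topology A) R"
    unfolding openin_subopen[of _ R]
  proof
    fix x assume x: "x \<in> R"
    then obtain U where "openin (atlas_topology A) U" "x \<in> U" "\<forall>y\<in>U. y \<in> manifold_points A \<and> J x y"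
      using loc[of x] by (auto simp: R_def)
    then show "\<exists>T. openin (atlas_topology A) T \<and> x \<in> T \<and> T \<subseteq> R"
      using x trans by (intro exI[of _ U]) (auto simp: R_def)
  qed
  moreover have "openin (atlas_topology A) (manifold_points A - R)"
    unfolding openin_subopen[of _ "_ - _"]
  proof
    fix x assume x: "x \<in> manifold_points A - R"
    then obtain U where U: "openin (atlas_topology A) U" "x \<in> U" "\<forall>y\<in>U. y \<in> manifold_points A \<and> J x y"
      using loc[of x] by auto
    have "y \<notin> R" if "y \<in> U" for y
      using x U(3) that trans[of p y x] sym[of x y] by (auto simp: R_def)
    then show "\<exists>T. openin (atlas_topology A) T \<and> x \<in> T \<and> T \<subseteq> manifold_points A - R"
      using U by (intro exI[of _ U]) auto
  qed
  ultimately have "R = {} \<or> R = manifold_points A"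
    using conn[unfolded connected_space_clopen_in, rule_format, of R]
    by (simp add: topspace_atlas closedin_def R_sub)
  moreover have "p \<in> R"
  proof -
    obtain U where "p \<in> U" "\<forall>y\<in>U. y \<in> manifold_points A \<and> J p y" using loc[OF p] by blast
    then show ?thesis by (simp add: R_def)
  qed
  ultimately have "q \<in> R" using q by blast
  then show ?thesis by (simp add: R_def J_def)
qed

text \<open>The extension by \<open>0\<close> is differentiable because the compact coordinate ball is closed in the
  Hausdorff space.\<close>

lemma chart_bump:
  assumes c: "c \<in> A" and p: "p \<in> fst c" and r: "r > 0" "cball (snd c p) r \<subseteq> snd c ` fst c"
  shows "\<exists>C>0. Lipschitz_differential
    (\<lambda>q. if q \<in> fst c then (max 0 (r\<^sup>2 - (norm (snd c q - snd c p))\<^sup>2))\<^sup>2 else 0) C"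
proof -
  let ?y = "snd c p" let ?B = "cball ?y r"
  define f where "f = (\<lambda>q. if q \<in> fst c then (max 0 (r\<^sup>2 - (norm (snd c q - ?y))\<^sup>2))\<^sup>2 else 0)"
  obtain m M where m: "m > 0" "\<And>y v. y \<in> ?B \<Longrightarrow> m * (norm v)\<^sup>2 \<le> metric_in_chart A g c y v v"
    using metric_compact_bounds[OF c compact_cball r(2)] by metis
  \<comment> \<open>On the ball the differential is at most \<open>4 * r\<^sup>2 * r\<close> times
    the Euclidean norm; the lower bound \<open>m\<close> turns that norm into the metric
    one.\<close>
  define C where "C = 4 * r\<^sup>2 * r / sqrt m"
  have C: "C > 0" using r m by (simp add: C_def)
  have "compactin (atlas_topology A) (chart_inv c ` ?B)"
    using r(2) by (intro image_compactin[OF _ continuous_map_chart_inv[OF c]]) (simp add: compactin_subtopology)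
  then have closed: "closedin (atlas_topology A) (chart_inv c ` ?B)"
    by (rule compactin_imp_closedin[OF Hausdorff])
  define U where "U = manifold_points A - chart_inv c ` ?B"
  have U: "openin (atlas_topology A) U"
    unfolding U_def topspace_atlas[symmetric] using closed by (rule openin_diff[OF openin_topspace])
  have f0: "f q = 0" if "q \<in> U" for q
  proof (cases "q \<in> fst c")
    case True
    have "snd c q \<notin> ?B"
    proof
      assume "snd c q \<in> ?B"
      then have "q \<in> chart_inv c ` ?B" using chart_inv_chart[OF c True] by (metis imageI)
      then show False using that by (simp add: U_def)
    qed
    then have "(norm (snd c q - ?y))\<^sup>2 \<ge> r\<^sup>2"
      using r(1) by (intro power_mono) (auto simp: dist_norm norm_minus_commute)
    then show ?thesis by (simp add: f_def)
  qed (simp add: f_def)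
  have "Lipschitz_differential f C"
    unfolding Lipschitz_differential_def
  proof
    fix q assume q: "q \<in> manifold_points A"
    show "\<exists>c\<in>A. q \<in> fst c \<and> (\<exists>F'. ((f \<circ> chart_inv c) has_derivative F') (at (snd c q)) \<and>
           (\<forall>v. \<bar>F' v\<bar> \<le> C * sqrt (metric_in_chart A g c (snd c q) v v)))"
    proof (cases "q \<in> fst c")
      case True
      let ?x = "snd c q"
      let ?s = "\<lambda>z. r\<^sup>2 - (z - ?y) \<bullet> (z - ?y)"
      let ?F' = "\<lambda>v. 2 * max 0 (?s ?x) * (- 2 * ((?x - ?y) \<bullet> v))"
      have "(?s has_derivative (\<lambda>v. - 2 * ((?x - ?y) \<bullet> v))) (at ?x)"
        by (auto intro!: derivative_eq_intros simp: inner_commute)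
      moreover have "((\<lambda>x::real. (max 0 x)\<^sup>2) has_derivative (*) (2 * max 0 (?s ?x))) (at (?s ?x))"
        using has_real_derivative_max0_square[of "?s ?x"] by (simp add: has_field_derivative_def)
      ultimately have "((\<lambda>x::real. (max 0 x)\<^sup>2) \<circ> ?s has_derivative ((*) (2 * max 0 (?s ?x)) \<circ> (\<lambda>v. - 2 * ((?x - ?y) \<bullet> v)))) (at ?x)"
        by (rule diff_chain_at)
      then have "((\<lambda>x::real. (max 0 x)\<^sup>2) \<circ> ?s has_derivative ?F') (at ?x)"
        by (simp add: o_def)
      then have der: "((f \<circ> chart_inv c) has_derivative ?F') (at ?x)"
        by (rule has_derivative_transform_within_open[OF _ chart_open[OF c]])
           (use True c in \<open>auto simp: f_def chart_inv_chart power2_norm_eq_inner\<close>)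
      have F'_le: "\<bar>?F' v\<bar> \<le> C * sqrt (metric_in_chart A g c ?x v v)" for v
      proof (cases "?x \<in> ?B")
        case inB: True
        then have n: "norm (?x - ?y) \<le> r" by (simp add: dist_norm norm_minus_commute)
        have "\<bar>?F' v\<bar> = 4 * max 0 (?s ?x) * \<bar>(?x - ?y) \<bullet> v\<bar>" by (simp add: abs_mult)
        also have "\<dots> \<le> 4 * r\<^sup>2 * (norm (?x - ?y) * norm v)"
          by (intro mult_mono Cauchy_Schwarz_ineq2) auto
        also have "\<dots> \<le> 4 * r\<^sup>2 * (r * norm v)"
          using n by (intro mult_left_mono mult_right_mono) auto
        also have "\<dots> = C * sqrt (m * (norm v)\<^sup>2)"
          using m(1) by (simp add: C_def real_sqrt_mult)
        also have "\<dots> \<le> C * sqrt (metric_in_chart A g c ?x v v)"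
          using m(2)[OF inB] C by (intro mult_left_mono real_sqrt_le_mono) auto
        finally show ?thesis .
      next
        case False
        then have "(norm (?x - ?y))\<^sup>2 \<ge> r\<^sup>2"
          using r(1) by (intro power_mono) (auto simp: dist_norm norm_minus_commute)
        then have "max 0 (?s ?x) = 0" by (simp add: power2_norm_eq_inner)
        then have "\<bar>?F' v\<bar> = 0" by simp
        also have "0 \<le> C * sqrt (metric_in_chart A g c ?x v v)"
          using C metric_nonneg[OF c, of ?x v] True by simp
        finally show ?thesis .
      qed
      show ?thesis by (intro bexI[of _ c] conjI exI[of _ ?F'] allI der F'_le True c)
    next
      case False
      obtain d where d: "d \<in> A" "q \<in> fst d" using q by (auto simp: manifold_points_def)
      have "chart_inv c ` ?B \<subseteq> fst c"
      proof (rule image_subsetI)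
        fix x assume "x \<in> ?B"
        then show "chart_inv c x \<in> fst c" by (intro chart_inv_in subsetD[OF r(2)])
      qed
      then have "q \<notin> chart_inv c ` ?B" using False by (rule contra_subsetD)
      then have qU: "q \<in> U" using q by (simp add: U_def)
      have "((f \<circ> chart_inv d) has_derivative (\<lambda>_. 0)) (at (snd d q))"
        by (rule has_derivative_transform_within_open[OF has_derivative_const[of 0] chart_image_open[OF d(1) U]])
           (use qU d f0 in \<open>auto simp: chart_inv_chart\<close>)
      moreover have "0 \<le> C * sqrt (metric_in_chart A g d (snd d q) v v)" for v
        using C metric_nonneg[OF d(1), of "snd d q" v] d(2) by simp
      ultimately show ?thesis using d by (intro bexI[of _ d] conjI exI[of _ "\<lambda>_. 0"]) simp_all
    qed
  qed
  then show ?thesis using C unfolding f_def by blast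
qed

end

subsection \<open>The distance function\<close>

text \<open>Joinability is assumed directly: on the base it comes from connectedness, on the disk
  bundle from explicitly constructed paths.\<close>

locale joined_metric = C0_metric A g for A :: "('a, 'b::euclidean_space) chart set" and g +
  assumes joined: "p \<in> manifold_points A \<Longrightarrow> q \<in> manifold_points A \<Longrightarrow>
     \<exists>\<gamma>. piecewise_C1_path A \<gamma> \<and> \<gamma> 0 = p \<and> \<gamma> 1 = q"
begin

abbreviation "M \<equiv> manifold_points A"
abbreviation "d \<equiv> riemannian_dist A g"

lemma dist_geI:
  assumes "p \<in> M" "q \<in> M"
    and "\<And>\<gamma>. piecewise_C1_path A \<gamma> \<Longrightarrow> \<gamma> 0 = p \<Longrightarrow> \<gamma> 1 = q \<Longrightarrow> L \<le> riemannian_length A g \<gamma>"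
  shows "L \<le> d p q"
  unfolding riemannian_dist_def using joined[OF assms(1,2)] assms
  by (auto intro!: cINF_greatest)

lemma dist_approx:
  assumes "p \<in> M" "q \<in> M" "d p q < L"
  obtains \<gamma> where "piecewise_C1_path A \<gamma>" "\<gamma> 0 = p" "\<gamma> 1 = q" "riemannian_length A g \<gamma> < L"
  using dist_geI[OF assms(1,2), of L] assms(3) by (meson leD not_le)

lemma Lipschitz_dist:
  assumes f: "Lipschitz_differential f C" and C: "C > 0" and pq: "p \<in> M" "q \<in> M"
  shows "\<bar>f p - f q\<bar> \<le> C * d p q"
proof -
  have "\<bar>f p - f q\<bar> / C \<le> d p q"
    by (rule dist_geI[OF pq]) (use Lipschitz_length[OF _ f] C in \<open>auto simp: field_simps abs_minus_commute\<close>)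
  then show ?thesis using C by (simp add: field_simps)
qed

text \<open>A path leaving a coordinate ball has length bounded below, since the bump function drops to
  \<open>0\<close> along it.\<close>

lemma chart_near_of_dist:
  assumes c: "c \<in> A" and p: "p \<in> fst c" and \<epsilon>: "\<epsilon> > 0"
  shows "\<exists>\<delta>>0. \<forall>q\<in>M. d p q < \<delta> \<longrightarrow> q \<in> fst c \<and> dist (snd c q) (snd c p) < \<epsilon>"
proof -
  obtain r0 where r0: "r0 > 0" "cball (snd c p) r0 \<subseteq> snd c ` fst c"
    using chart_open[OF c] p by (meson imageI open_contains_cball)
  define r where "r = min r0 \<epsilon>"
  have r: "r > 0" "cball (snd c p) r \<subseteq> snd c ` fst c" using r0 \<epsilon> by (auto simp: r_def)
  define f where "f = (\<lambda>q. if q \<in> fst c then (max 0 (r\<^sup>2 - (norm (snd c q - snd c p))\<^sup>2))\<^sup>2 else 0)"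
  obtain C where C: "C > 0" "Lipschitz_differential f C"
    using chart_bump[OF c p r] unfolding f_def by blast
  have fp: "f p = (r\<^sup>2)\<^sup>2" using p by (simp add: f_def)
  show ?thesis
  proof (intro exI conjI ballI impI)
    \<comment> \<open>The bump equals \<open>(r\<^sup>2)\<^sup>2\<close> at \<open>p\<close>, so
      within a distance below this threshold it cannot drop to 0.\<close>
    show "(r\<^sup>2)\<^sup>2 / C > 0" using r C by simp
    fix q assume q: "q \<in> M" "d p q < (r\<^sup>2)\<^sup>2 / C"
    have "\<bar>f p - f q\<bar> \<le> C * d p q" by (rule Lipschitz_dist[OF C(2,1) in_manifold[OF c p] q(1)])
    also have "\<dots> < (r\<^sup>2)\<^sup>2" using q(2) C(1) by (simp add: field_simps)
    finally have fq: "f q > 0" unfolding fp by linarith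
    then show "q \<in> fst c" by (auto simp: f_def split: if_splits)
    with fq have "(norm (snd c q - snd c p))\<^sup>2 < r\<^sup>2" by (auto simp: f_def max_def split: if_splits)
    then have "norm (snd c q - snd c p) < r" using r(1) power_less_imp_less_base by fastforce
    then show "dist (snd c q) (snd c p) < \<epsilon>" by (simp add: dist_norm r_def)
  qed
qed

text \<open>Reversal gives symmetry and concatenation the triangle inequality. Separation has the
  topological content: small distance forces closeness in a chart, which rests on the Hausdorff
  property through the bump functions.\<close>

sublocale Metric_space M d
proof
  show nonneg: "0 \<le> d p q" for p q
  proof (cases "p \<in> M \<and> q \<in> M")
    case True
    then show ?thesis by (intro dist_geI length_nonneg) auto
  qed (auto simp: riemannian_dist_def)
  have le: "d p q \<le> d q p" for p q
  proof (cases "p \<in> M \<and> q \<in> M")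
    case True
    show ?thesis
    proof (rule dist_geI)
      fix \<gamma> assume "piecewise_C1_path A \<gamma>" "\<gamma> 0 = q" "\<gamma> 1 = p"
      with dist_le_length[OF piecewise_C1_reverse(1)[of \<gamma>], of p q] piecewise_C1_reverse(2)[of \<gamma>]
      show "d p q \<le> riemannian_length A g \<gamma>" by simp
    qed (use True in auto)
  qed (auto simp: riemannian_dist_def)
  show "d p q = d q p" for p q using le[of p q] le[of q p] by simp
  show "d p r \<le> d p q + d q r" if pqr: "p \<in> M" "q \<in> M" "r \<in> M" for p q r
  proof (rule field_le_epsilon)
    \<comment> \<open>The infimum need not be attained, so each distance is approximated by a path
      up to \<open>e / 2\<close>.\<close>
    fix e :: real assume e: "e > 0"
    obtain \<gamma> where \<gamma>: "piecewise_C1_path A \<gamma>" "\<gamma> 0 = p" "\<gamma> 1 = q" "riemannian_length A g \<gamma> < d p q + e / 2"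
      using dist_approx[OF pqr(1,2), of "d p q + e/2"] e by auto
    obtain \<gamma>' where \<gamma>': "piecewise_C1_path A \<gamma>'" "\<gamma>' 0 = q" "\<gamma>' 1 = r" "riemannian_length A g \<gamma>' < d q r + e / 2"
      using dist_approx[OF pqr(2,3), of "d q r + e/2"] e by auto
    have "d p r \<le> riemannian_length A g \<gamma> + riemannian_length A g \<gamma>'"
      using dist_le_length[OF piecewise_C1_join(1)[OF \<gamma>(1) \<gamma>'(1)], of p r] piecewise_C1_join(2)[OF \<gamma>(1) \<gamma>'(1)] \<gamma> \<gamma>'
      by (simp add: path_join_def)
    then show "d p r \<le> d p q + d q r + e" using \<gamma>(4) \<gamma>'(4) by linarith
  qed
  show "d p q = 0 \<longleftrightarrow> p = q" if pq: "p \<in> M" "q \<in> M" for p q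
  proof
    obtain c where c: "c \<in> A" "p \<in> fst c" using pq(1) by (auto simp: manifold_points_def)
    {
      assume "d p q = 0"
      then have near: "q \<in> fst c \<and> dist (snd c q) (snd c p) < \<epsilon>" if "\<epsilon> > 0" for \<epsilon>
        using chart_near_of_dist[OF c that] pq(2) by auto
      then have "dist (snd c q) (snd c p) \<le> 0" by (meson dense not_le less_asym)
      then have "snd c q = snd c p" by simp
      then show "p = q" using near[of 1] c chart_inj[OF c(1)] by (auto dest: inj_onD)
    next
      assume "p = q"
      moreover have "d (chart_inv c (snd c p)) (chart_inv c (snd c p)) \<le> 0"
        by (rule dist_chart_segment[OF c(1)])
           (use c bilinear_lzero[OF metric_bilinear[OF c(1)]] in auto)
      ultimately show "d p q = 0" using nonneg[of p q] c by (simp add: chart_inv_chart)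
    }
  qed
qed

end

subsection \<open>The Levi-Civita connection\<close>

text \<open>The second difference is symmetric in \<open>u\<close> and \<open>v\<close>, so dividing by \<open>t\<^sup>2\<close> yields the symmetry of
  the second derivative without assuming it continuous.\<close>

lemma second_difference_bound:
  fixes f :: "'b::real_normed_vector \<Rightarrow> real"
  assumes S: "open S" "x \<in> S" and f': "\<And>y. y \<in> S \<Longrightarrow> (f has_derivative f' y) (at y)"
    and f'': "((\<lambda>y. f' y u) has_derivative (\<lambda>w. f'' w)) (at x)" and e: "e > 0"
  shows "\<exists>\<delta>>0. \<forall>t. 0 < t \<and> t < \<delta> \<longrightarrow>
     \<bar>f (x + t *\<^sub>R u + t *\<^sub>R v) - f (x + t *\<^sub>R u) - f (x + t *\<^sub>R v) + f x - t\<^sup>2 * f'' v\<bar>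
        \<le> t\<^sup>2 * e * (2 * (norm u + norm v))"
proof -
  let ?N = "norm u + norm v"
  obtain r where r: "r > 0" "ball x r \<subseteq> S" using S by (meson open_contains_ball)
  obtain r' where r': "r' > 0" "\<And>y. norm (y - x) < r' \<Longrightarrow> norm (f' y u - f' x u - f'' (y - x)) \<le> e * norm (y - x)"
    using f'' e unfolding has_derivative_at_alt by blast
  have lin: "linear f''" using f'' by (rule has_derivative_linear)
  \<comment> \<open>The summand 1 avoids division by zero when \<open>u\<close> and \<open>v\<close>
    both vanish.\<close>
  define \<delta> where "\<delta> = min r r' / (?N + 1)"
  have \<delta>: "\<delta> > 0" using r r' by (simp add: \<delta>_def add_nonneg_pos)
  show ?thesis
  proof (rule exI[of _ \<delta>], intro conjI allI impI, rule \<delta>)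
    fix t assume t: "0 < t \<and> t < \<delta>"
    have small: "norm (t *\<^sub>R (a *\<^sub>R u + b *\<^sub>R v)) \<le> t * ?N \<and> t * ?N < min r r'" if "0 \<le> a" "a \<le> 1" "0 \<le> b" "b \<le> 1" for a b
    proof
      have "norm (a *\<^sub>R u + b *\<^sub>R v) \<le> a * norm u + b * norm v"
        using norm_triangle_ineq[of "a *\<^sub>R u" "b *\<^sub>R v"] that by simp
      also have "\<dots> \<le> 1 * norm u + 1 * norm v" using that by (intro add_mono mult_right_mono) auto
      finally show "norm (t *\<^sub>R (a *\<^sub>R u + b *\<^sub>R v)) \<le> t * ?N" using t by simp
      have "t * (?N + 1) < min r r'" using t by (simp add: \<delta>_def pos_less_divide_eq add_nonneg_pos)
      then show "t * ?N < min r r'" using t by (simp add: algebra_simps)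
    qed
    have in_S: "x + t *\<^sub>R (a *\<^sub>R u + b *\<^sub>R v) \<in> S" if "0 \<le> a" "a \<le> 1" "0 \<le> b" "b \<le> 1" for a b
      using small[OF that] r(2) by (intro subsetD[OF r(2)]) (simp add: dist_norm)
    \<comment> \<open>With the increment along \<open>v\<close> frozen, only the position along
      \<open>u\<close> varies. The mean value theorem turns the second difference into a difference
      of two first derivatives, which \<open>f''\<close> approximates.\<close>
    define h where "h s = f (x + t *\<^sub>R (s *\<^sub>R u + 1 *\<^sub>R v)) - f (x + t *\<^sub>R (s *\<^sub>R u + 0 *\<^sub>R v))" for s
    have der: "((\<lambda>s. f (x + t *\<^sub>R (s *\<^sub>R u + b *\<^sub>R v))) has_real_derivative f' (x + t *\<^sub>R (s *\<^sub>R u + b *\<^sub>R v)) u * t) (at s)"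
      if s: "0 \<le> s" "s \<le> 1" "0 \<le> b" "b \<le> 1" for s b
    proof -
      let ?y = "x + t *\<^sub>R (s *\<^sub>R u + b *\<^sub>R v)"
      have "((\<lambda>s. x + t *\<^sub>R (s *\<^sub>R u + b *\<^sub>R v)) has_derivative (\<lambda>r. t *\<^sub>R (r *\<^sub>R u))) (at s)"
        by (auto intro!: derivative_eq_intros)
      from diff_chain_at[OF this f'[OF in_S[OF s]]]
      have "((\<lambda>s. f (x + t *\<^sub>R (s *\<^sub>R u + b *\<^sub>R v))) has_derivative (\<lambda>r. f' ?y (t *\<^sub>R r *\<^sub>R u))) (at s)"
        by (simp add: o_def)
      moreover have "(\<lambda>r. f' ?y (t *\<^sub>R r *\<^sub>R u)) = (*) (f' ?y u * t)"
        using linear_scale[OF has_derivative_linear[OF f'[OF in_S[OF s]]]] by (auto simp: fun_eq_iff)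
      ultimately show ?thesis by (simp add: has_field_derivative_def)
    qed
    have "(h has_real_derivative (f' (x + t *\<^sub>R (s *\<^sub>R u + 1 *\<^sub>R v)) u * t - f' (x + t *\<^sub>R (s *\<^sub>R u + 0 *\<^sub>R v)) u * t)) (at s)"
      if "0 \<le> s" "s \<le> 1" for s
      unfolding h_def using that by (intro DERIV_diff der) auto
    from MVT2[OF zero_less_one this] obtain s where s: "0 < s" "s < 1" and
      hs: "h 1 - h 0 = f' (x + t *\<^sub>R (s *\<^sub>R u + 1 *\<^sub>R v)) u * t - f' (x + t *\<^sub>R (s *\<^sub>R u + 0 *\<^sub>R v)) u * t"
      by auto
    have err: "\<bar>f' (x + t *\<^sub>R (s *\<^sub>R u + b *\<^sub>R v)) u - f' x u - f'' (t *\<^sub>R (s *\<^sub>R u + b *\<^sub>R v))\<bar> \<le> e * (t * ?N)"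
      if b: "0 \<le> b" "b \<le> 1" for b
    proof -
      have *: "norm (t *\<^sub>R (s *\<^sub>R u + b *\<^sub>R v)) \<le> t * ?N" "t * ?N < r'" using small[of s b] s b by auto
      then have "\<bar>f' (x + t *\<^sub>R (s *\<^sub>R u + b *\<^sub>R v)) u - f' x u - f'' (t *\<^sub>R (s *\<^sub>R u + b *\<^sub>R v))\<bar> \<le> e * norm (t *\<^sub>R (s *\<^sub>R u + b *\<^sub>R v))"
        using r'(2)[of "x + t *\<^sub>R (s *\<^sub>R u + b *\<^sub>R v)"] by (simp del: norm_scaleR)
      also have "\<dots> \<le> e * (t * ?N)" using e *(1) by (intro mult_left_mono) auto
      finally show ?thesis .
    qed
    have "f'' (t *\<^sub>R (s *\<^sub>R u + 1 *\<^sub>R v)) - f'' (t *\<^sub>R (s *\<^sub>R u + 0 *\<^sub>R v)) = t * f'' v"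
      by (simp add: linear_add[OF lin] linear_scale[OF lin] algebra_simps)
    then have "\<bar>(f' (x + t *\<^sub>R (s *\<^sub>R u + 1 *\<^sub>R v)) u - f' (x + t *\<^sub>R (s *\<^sub>R u + 0 *\<^sub>R v)) u) - t * f'' v\<bar> \<le> 2 * (e * (t * ?N))"
      using err[of 1] err[of 0] by linarith
    then have "t * \<bar>(f' (x + t *\<^sub>R (s *\<^sub>R u + 1 *\<^sub>R v)) u - f' (x + t *\<^sub>R (s *\<^sub>R u + 0 *\<^sub>R v)) u) - t * f'' v\<bar> \<le> t * (2 * (e * (t * ?N)))"
      using t by (intro mult_left_mono) auto
    moreover have "t * \<bar>(f' (x + t *\<^sub>R (s *\<^sub>R u + 1 *\<^sub>R v)) u - f' (x + t *\<^sub>R (s *\<^sub>R u + 0 *\<^sub>R v)) u) - t * f'' v\<bar> = \<bar>h 1 - h 0 - t\<^sup>2 * f'' v\<bar>"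
    proof -
      have "t * \<bar>z\<bar> = \<bar>t * z\<bar>" for z using t by (simp add: abs_mult)
      then show ?thesis unfolding hs by (simp add: algebra_simps power2_eq_square)
    qed
    moreover have "h 1 - h 0 = f (x + t *\<^sub>R u + t *\<^sub>R v) - f (x + t *\<^sub>R u) - f (x + t *\<^sub>R v) + f x"
      by (simp add: h_def scaleR_add_right add.assoc)
    ultimately show "\<bar>f (x + t *\<^sub>R u + t *\<^sub>R v) - f (x + t *\<^sub>R u) - f (x + t *\<^sub>R v) + f x - t\<^sup>2 * f'' v\<bar>
        \<le> t\<^sup>2 * e * (2 * ?N)"
      by (simp add: power2_eq_square algebra_simps)
  qed
qed

lemma second_derivative_symmetric_real:
  fixes f :: "'b::real_normed_vector \<Rightarrow> real"
  assumes S: "open S" "x \<in> S" and f': "\<And>y. y \<in> S \<Longrightarrow> (f has_derivative f' y) (at y)"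
    and f'': "\<And>v. ((\<lambda>y. f' y v) has_derivative (\<lambda>w. f'' w v)) (at x)"
  shows "f'' u v = f'' v u"
proof -
  let ?N = "norm u + norm v"
  have "\<bar>f'' u v - f'' v u\<bar> \<le> 0 + e'" if e': "e' > 0" for e'
  proof -
    \<comment> \<open>The two second differences contribute \<open>2 * ?N\<close> each; the summand
      1 keeps the denominator positive.\<close>
    define e where "e = e' / (4 * ?N + 1)"
    have N: "4 * ?N + 1 > 0" by (simp add: add_nonneg_pos)
    have e: "e > 0" using e' N by (simp add: e_def)
    obtain \<delta> where \<delta>: "\<delta> > 0" "\<And>t. 0 < t \<Longrightarrow> t < \<delta> \<Longrightarrow>
     \<bar>f (x + t *\<^sub>R u + t *\<^sub>R v) - f (x + t *\<^sub>R u) - f (x + t *\<^sub>R v) + f x - t\<^sup>2 * f'' v u\<bar> \<le> t\<^sup>2 * e * (2 * ?N)"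
      using second_difference_bound[OF S f' f'' e, of u v] by blast
    obtain \<delta>' where \<delta>': "\<delta>' > 0" "\<And>t. 0 < t \<Longrightarrow> t < \<delta>' \<Longrightarrow>
     \<bar>f (x + t *\<^sub>R v + t *\<^sub>R u) - f (x + t *\<^sub>R v) - f (x + t *\<^sub>R u) + f x - t\<^sup>2 * f'' u v\<bar> \<le> t\<^sup>2 * e * (2 * (norm v + norm u))"
      using second_difference_bound[OF S f' f'' e, of v u] by blast
    define t where "t = min \<delta> \<delta>' / 2"
    have t: "0 < t" "t < \<delta>" "t < \<delta>'" using \<delta>(1) \<delta>'(1) by (auto simp: t_def min_def)
    have "\<bar>t\<^sup>2 * f'' u v - t\<^sup>2 * f'' v u\<bar> \<le> t\<^sup>2 * (e * (4 * ?N))"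
      using \<delta>(2)[OF t(1,2)] \<delta>'(2)[OF t(1,3)] by (simp add: algebra_simps)
    then have "t\<^sup>2 * \<bar>f'' u v - f'' v u\<bar> \<le> t\<^sup>2 * (e * (4 * ?N))"
      by (simp add: abs_mult flip: right_diff_distrib)
    then have "\<bar>f'' u v - f'' v u\<bar> \<le> e * (4 * ?N)" using t(1) by simp
    also have "\<dots> \<le> e * (4 * ?N + 1)" using e by (intro mult_left_mono) auto
    also have "\<dots> = 0 + e'" using N by (simp add: e_def)
    finally show ?thesis .
  qed
  then have "\<bar>f'' u v - f'' v u\<bar> \<le> 0" by (rule field_le_epsilon)
  then show ?thesis by simp
qed

lemma second_derivative_symmetric:
  fixes f :: "'b::real_normed_vector \<Rightarrow> 'c::euclidean_space"
  assumes S: "open S" "x \<in> S" and f': "\<And>y. y \<in> S \<Longrightarrow> (f has_derivative f' y) (at y)"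
    and f'': "\<And>v. ((\<lambda>y. f' y v) has_derivative (\<lambda>w. f'' w v)) (at x)"
  shows "f'' u v = f'' v u"
proof (rule euclidean_eqI)
  fix b :: 'c
  show "f'' u v \<bullet> b = f'' v u \<bullet> b"
    by (rule second_derivative_symmetric_real[OF S, of "\<lambda>y. f y \<bullet> b" "\<lambda>y v. f' y v \<bullet> b" "\<lambda>w v. f'' w v \<bullet> b"])
       (auto intro!: has_derivative_inner_left f' f'')
qed

text \<open>Recording the values of \<open>B x\<close> on the basis is a linear map, injective by
  definiteness and hence surjective in finite dimension. It is used to solve for Christoffel symbols
  without an inverse matrix.\<close>

lemma bilinear_Riesz:
  fixes B :: "'b::euclidean_space \<Rightarrow> 'b \<Rightarrow> real"
  assumes B: "bilinear B" and pos: "\<And>v. v \<noteq> 0 \<Longrightarrow> B v v > 0" and f: "linear f"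
  shows "\<exists>!x. \<forall>w. B x w = f w"
proof -
  have lin: "linear (\<lambda>x. B x w)" "linear (B w)" for w using B by (auto simp: bilinear_def)
  define L where "L x = (\<Sum>b\<in>Basis. B x b *\<^sub>R b)" for x
  have "linear L"
    unfolding L_def by (rule linearI)
      (simp_all add: linear_add[OF lin(1)] linear_scale[OF lin(1)] scaleR_add_left sum.distrib scaleR_sum_right)
  have Lb: "L x \<bullet> b = B x b" if "b \<in> Basis" for x b
    unfolding L_def using that by (simp add: inner_sum_left inner_Basis if_distrib sum.delta cong: if_cong)
  have eq: "(\<forall>w. B x w = h w) \<longleftrightarrow> (\<forall>b\<in>Basis. B x b = h b)" if "linear h" for x h
    using linear_eq_stdbasis[OF lin(2) that, of x] by auto
  have "inj L"
    unfolding linear_injective_0[OF \<open>linear L\<close>]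
  proof (intro allI impI)
    fix x assume "L x = 0"
    then have "\<forall>b\<in>Basis. B x b = 0" using Lb[of _ x] by simp
    then have "\<forall>w. B x w = 0" using eq[OF module_hom_zero, of x] by simp
    then show "x = 0" using pos[of x] by force
  qed
  then have "surj L" using \<open>linear L\<close> linear_injective_imp_surjective by blast
  then obtain x where x: "L x = (\<Sum>b\<in>Basis. f b *\<^sub>R b)" by (metis surjD)
  have "B x b = f b" if "b \<in> Basis" for b
    using Lb[OF that, of x] that unfolding x
    by (simp add: inner_sum_left inner_Basis if_distrib sum.delta cong: if_cong)
  then have "\<forall>w. B x w = f w" using eq[OF f] by blast
  moreover have "x' = x" if "\<forall>w. B x' w = f w" for x'
  proof -
    have "L x' = L x" unfolding L_def using that calculation by simp
    then show ?thesis using \<open>inj L\<close> by (simp add: inj_eq)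
  qed
  ultimately show ?thesis by blast
qed

section \<open>Christoffel symbols by the Koszul formula\<close>

locale riemannian_manifold =
  fixes A :: "('a, 'b::euclidean_space) chart set" and g :: "('a, 'b) metric_tensor"
  assumes manifold: "smooth_manifold A" and metric: "riemannian_metric A g"
begin

lemma transition_smooth: "c \<in> A \<Longrightarrow> d \<in> A \<Longrightarrow> Ck_on k (snd c ` (fst c \<inter> fst d)) (transition c d)"
  using manifold unfolding smooth_manifold_def smooth_on_def by blast

sublocale C1_atlas A
proof
  show "Hausdorff_space (atlas_topology A)"
    and "\<And>c. c \<in> A \<Longrightarrow> inj_on (snd c) (fst c)" and "\<And>c. c \<in> A \<Longrightarrow> open (snd c ` fst c)"
    and "\<And>c d. c \<in> A \<Longrightarrow> d \<in> A \<Longrightarrow> open (snd c ` (fst c \<inter> fst d))"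
    using manifold unfolding smooth_manifold_def by blast+
  show "Ck_on 1 (snd c ` (fst c \<inter> fst d)) (transition c d)" if "c \<in> A" "d \<in> A" for c d
    using transition_smooth[OF that] .
qed

abbreviation "G \<equiv> metric_in_chart A g"

lemma metric_smooth: "c \<in> A \<Longrightarrow> Ck_on k (snd c ` fst c) (\<lambda>y. G c y v w)"
  using metric unfolding riemannian_metric_def smooth_on_def by blast

lemma metric_tangent:
  assumes "p \<in> manifold_points A" "u \<in> tangent_space A p"
  shows metric_sym: "v \<in> tangent_space A p \<Longrightarrow> g p u v = g p v u"
    and metric_tangent_pos: "u \<noteq> (\<lambda>c. 0) \<Longrightarrow> g p u u > 0"
    and metric_lin: "v \<in> tangent_space A p \<Longrightarrow> w \<in> tangent_space A p \<Longrightarrow>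
      g p (\<lambda>c. a *\<^sub>R u c + b *\<^sub>R v c) w = a * g p u w + b * g p v w"
  using metric assms unfolding riemannian_metric_def by blast+

lemma metric_chart_sym:
  assumes "c \<in> A" "y \<in> snd c ` fst c"
  shows "G c y v w = G c y w v"
  unfolding metric_in_chart_def
  by (rule metric_sym[OF in_manifold[OF assms(1)]]) (intro chart_vec_tangent chart_inv_in assms)+

lemma metric_chart_lin:
  assumes c: "c \<in> A" and y: "y \<in> snd c ` fst c"
  shows "G c y (a *\<^sub>R u + b *\<^sub>R v) w = a * G c y u w + b * G c y v w"
proof -
  let ?p = "chart_inv c y"
  have p: "?p \<in> fst c" by (rule chart_inv_in[OF y])
  have "chart_vec A c ?p (a *\<^sub>R u + b *\<^sub>R v) = (\<lambda>d. a *\<^sub>R chart_vec A c ?p u d + b *\<^sub>R chart_vec A c ?p v d)"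
    by (simp add: fun_eq_iff chart_vec_add[OF c p] chart_vec_scale[OF c p])
  then show ?thesis
    unfolding metric_in_chart_def
    by (simp add: metric_lin[OF in_manifold[OF c p] chart_vec_tangent[OF c p] chart_vec_tangent[OF c p] chart_vec_tangent[OF c p]])
qed

sublocale C0_metric A g
proof
  fix c y v w assume c: "c \<in> A"
  show "continuous_on (snd c ` fst c) (\<lambda>y. G c y v w)"
    using metric_smooth[OF c, of 0] by simp
  assume y: "y \<in> snd c ` fst c"
  have lin: "linear (\<lambda>u. G c y u w)" for w
    using metric_chart_lin[OF c y, of 1 _ 1 _ w] metric_chart_lin[OF c y, of _ _ 0 0 w] by (intro linearI) simp_all
  then show "bilinear (metric_in_chart A g c y)"
    unfolding bilinear_def by (auto simp: metric_chart_sym[OF c y, of _ "_::'b"] intro: lin)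
  assume "v \<noteq> 0"
  then have "chart_vec A c (chart_inv c y) v \<noteq> (\<lambda>c. 0)"
    using chart_vec_self[OF c chart_inv_in[OF y], of v] by metis
  then show "G c y v v > 0"
    unfolding metric_in_chart_def
    by (intro metric_tangent_pos[OF in_manifold[OF c]] chart_vec_tangent[OF c] chart_inv_in[OF y])
qed

definition DG :: "('a, 'b) chart \<Rightarrow> 'b \<Rightarrow> 'b \<Rightarrow> 'b \<Rightarrow> 'b \<Rightarrow> real" where
  "DG c y u v w = frechet_derivative (\<lambda>z. G c z v w) (at y) u"

lemma has_derivative_G:
  assumes "c \<in> A" "y \<in> snd c ` fst c"
  shows "((\<lambda>z. G c z v w) has_derivative (\<lambda>u. DG c y u v w)) (at y)"
  unfolding DG_def using metric_smooth[OF assms(1), of 1 v w] assms(2)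
  by (auto simp: frechet_derivative_works[symmetric])

lemma DG_continuous: "c \<in> A \<Longrightarrow> continuous_on (snd c ` fst c) (\<lambda>y. DG c y u v w)"
  unfolding DG_def using metric_smooth[of c 1 v w] by simp

text \<open>The source of symmetry and linearity of \<open>DG\<close> in its last two arguments:
  identities between metric coefficients on the chart image pass to the derivatives by
  uniqueness.\<close>

lemma DG_eqI:
  assumes c: "c \<in> A" and y: "y \<in> snd c ` fst c"
    and der: "(f has_derivative f') (at y)" and eq: "\<And>z. z \<in> snd c ` fst c \<Longrightarrow> f z = G c z v w"
  shows "DG c y u v w = f' u"
proof -
  have "((\<lambda>z. G c z v w) has_derivative f') (at y)"
    by (rule has_derivative_transform_within_open[OF der chart_open[OF c] y eq])
  from has_derivative_unique[OF has_derivative_G[OF c y] this] show ?thesis by metis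
qed

lemma DG_sym:
  assumes c: "c \<in> A" and y: "y \<in> snd c ` fst c"
  shows "DG c y u v w = DG c y u w v"
  by (rule DG_eqI[OF c y has_derivative_G[OF c y]]) (rule metric_chart_sym[OF c])

lemma DG_bilinear:
  assumes c: "c \<in> A" and y: "y \<in> snd c ` fst c"
  shows "bilinear (DG c y u)"
proof -
  have lin: "linear (\<lambda>v. DG c y u v w)" for w
  proof (rule linearI)
    fix v v' r
    show "DG c y u (v + v') w = DG c y u v w + DG c y u v' w"
      by (rule DG_eqI[OF c y has_derivative_add[OF has_derivative_G[OF c y] has_derivative_G[OF c y]]])
         (simp add: bilinear_ladd[OF metric_bilinear[OF c]])
    show "DG c y u (r *\<^sub>R v) w = r *\<^sub>R DG c y u v w"
      by (rule DG_eqI[OF c y has_derivative_scaleR_right[OF has_derivative_G[OF c y]]])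
         (simp add: bilinear_lmul[OF metric_bilinear[OF c]])
  qed
  moreover have "linear (\<lambda>v. DG c y u w v)" for w
    using lin[of w] by (simp add: DG_sym[OF c y, of u w])
  ultimately show ?thesis by (simp add: bilinear_def)
qed

lemma DG_linear:
  assumes "c \<in> A" "y \<in> snd c ` fst c"
  shows "linear (\<lambda>u. DG c y u v w)"
  by (rule has_derivative_linear[OF has_derivative_G[OF assms]])

text \<open>The right-hand side of the Koszul formula for constant coordinate fields, whose brackets
  vanish: the Christoffel symbols of the first kind.\<close>

definition koszul :: "('a, 'b) chart \<Rightarrow> 'b \<Rightarrow> 'b \<Rightarrow> 'b \<Rightarrow> 'b \<Rightarrow> real" where
  "koszul c y u v w = (DG c y u v w + DG c y v u w - DG c y w u v) / 2"

lemma koszul_linear: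
  assumes c: "c \<in> A" and y: "y \<in> snd c ` fst c"
  shows "linear (\<lambda>w. koszul c y u v w)" "linear (\<lambda>v. koszul c y u v w)" "koszul c y u v w = koszul c y v u w"
proof -
  note [simp] = linear_add[OF DG_linear[OF c y]] linear_scale[OF DG_linear[OF c y]]
    bilinear_ladd[OF DG_bilinear[OF c y]] bilinear_radd[OF DG_bilinear[OF c y]]
    bilinear_lmul[OF DG_bilinear[OF c y]] bilinear_rmul[OF DG_bilinear[OF c y]]
  show "linear (\<lambda>w. koszul c y u v w)" "linear (\<lambda>v. koszul c y u v w)"
    by (rule linearI; simp add: koszul_def algebra_simps add_divide_distrib diff_divide_distrib)+
  show "koszul c y u v w = koszul c y v u w"
    by (simp add: koszul_def DG_sym[OF c y, of w u v])
qed

abbreviation "\<Gamma> \<equiv> christoffel A g"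

text \<open>For symmetric \<open>X\<close>, adding two cyclic permutations of the compatibility
  equation and subtracting the third isolates one term; the resulting equation determines
  \<open>X\<close>.\<close>

lemma christoffel_koszul_conv:
  assumes c: "c \<in> A" and y: "y \<in> snd c ` fst c" and sym: "\<forall>v w. X v w = X w v"
  shows "(\<forall>u v w. DG c y u v w = G c y (X u v) w + G c y v (X u w)) \<longleftrightarrow>
         (\<forall>u v w. G c y (X u v) w = koszul c y u v w)"
proof
  assume *: "\<forall>u v w. DG c y u v w = G c y (X u v) w + G c y v (X u w)"
  show "\<forall>u v w. G c y (X u v) w = koszul c y u v w"
  proof (intro allI)
    fix u v w
    have "X w u = X u w" "X w v = X v w" "X v u = X u v" using sym by auto
    then show "G c y (X u v) w = koszul c y u v w"
      by (simp add: koszul_def *[rule_format] metric_chart_sym[OF c y, of "X u w" v])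
  qed
next
  assume *: "\<forall>u v w. G c y (X u v) w = koszul c y u v w"
  show "\<forall>u v w. DG c y u v w = G c y (X u v) w + G c y v (X u w)"
    by (simp add: metric_chart_sym[OF c y, of _ "X _ _"] *[rule_format] koszul_def
        DG_sym[OF c y] field_simps)
qed

text \<open>Both existence and uniqueness are needed to evaluate the definite description. They come
  from representing the Koszul functional by the metric.\<close>

lemma christoffel:
  assumes c: "c \<in> A" and y: "y \<in> snd c ` fst c"
  shows christoffel_bilinear: "bilinear (\<Gamma> c y)"
    and christoffel_koszul: "G c y (\<Gamma> c y u v) w = koszul c y u v w"
    and christoffel_compat: "DG c y u v w = G c y (\<Gamma> c y u v) w + G c y v (\<Gamma> c y u w)"
proof -
  note bil = metric_bilinear[OF c y]
  have ex1: "\<exists>!x. \<forall>w. G c y x w = koszul c y u v w" for u v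
    by (rule bilinear_Riesz[OF bil metric_pos[OF c y] koszul_linear(1)[OF c y]])
  define X where "X u v = (THE x. \<forall>w. G c y x w = koszul c y u v w)" for u v
  have X: "G c y (X u v) w = koszul c y u v w" for u v w
    using theI'[OF ex1, of u v] unfolding X_def by blast
  have Xeq: "X u v = x" if "\<And>w. G c y x w = koszul c y u v w" for u v x
    using the1_equality[OF ex1, of x u v] that unfolding X_def by blast
  have Xsym: "X u v = X v u" for u v by (rule Xeq) (simp add: X koszul_linear(3)[OF c y, of u v])
  have lin: "linear (\<lambda>v. X u v)" for u
    by (rule linearI; rule Xeq)
       (simp_all add: X bilinear_ladd[OF bil] bilinear_lmul[OF bil] linear_add[OF koszul_linear(2)[OF c y]] linear_scale[OF koszul_linear(2)[OF c y]])
  moreover have "linear (\<lambda>v. X v u)" for u using lin[of u] by (simp add: Xsym[of u])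
  ultimately have Xbil: "bilinear X" by (simp add: bilinear_def)
  let ?P = "\<lambda>X. bilinear X \<and> (\<forall>v w. X v w = X w v) \<and> (\<forall>u v w. DG c y u v w = G c y (X u v) w + G c y v (X u w))"
  have PX: "?P X" using Xbil Xsym X christoffel_koszul_conv[OF c y, of X] by blast
  have "Y = X" if "?P Y" for Y
  proof (intro ext)
    fix u v
    have "\<forall>u v w. G c y (Y u v) w = koszul c y u v w"
      using that christoffel_koszul_conv[OF c y, of Y] by blast
    then show "Y u v = X u v" using Xeq[of "Y u v" u v] by simp
  qed
  then have "\<Gamma> c y = X" unfolding christoffel_def DG_def[symmetric] using PX by (intro the_equality)
  then show "bilinear (\<Gamma> c y)" "G c y (\<Gamma> c y u v) w = koszul c y u v w"
    "DG c y u v w = G c y (\<Gamma> c y u v) w + G c y v (\<Gamma> c y u w)"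
    using PX X by blast+
qed

text \<open>The value at \<open>y0\<close> solves the Koszul equation at a nearby \<open>y\<close>
  up to a residual \<open>E\<close> that tends to 0. The uniform lower bound \<open>m\<close> on the
  metric bounds the error of the solution by this residual.\<close>

lemma christoffel_continuous:
  assumes c: "c \<in> A"
  shows "continuous_on (snd c ` fst c) (\<lambda>y. \<Gamma> c y u v)"
  unfolding continuous_on_eq_continuous_at[OF chart_open[OF c]]
proof
  fix y0 assume y0: "y0 \<in> snd c ` fst c"
  obtain r where r: "r > 0" "cball y0 r \<subseteq> snd c ` fst c"
    using chart_open[OF c] y0 by (meson open_contains_cball)
  obtain m M where m: "m > 0" "\<And>y v. y \<in> cball y0 r \<Longrightarrow> m * (norm v)\<^sup>2 \<le> G c y v v"
    using metric_compact_bounds[OF c compact_cball r(2)] by metis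
  let ?X = "\<Gamma> c y0 u v"
  define E where "E y w = koszul c y u v w - G c y ?X w" for y w
  have E_cont: "continuous (at y0) (\<lambda>y. E y w)" for w
  proof -
    have "continuous_on (snd c ` fst c) (\<lambda>y. E y w)"
      unfolding E_def koszul_def by (intro continuous_intros DG_continuous metric_continuous c) simp_all
    then show ?thesis using continuous_on_eq_continuous_at[OF chart_open[OF c]] y0 by blast
  qed
  have E0: "E y0 w = 0" for w by (simp add: E_def christoffel_koszul[OF c y0])
  let ?bound = "\<lambda>y. (\<Sum>b\<in>Basis. \<bar>E y b\<bar>) / m"
  have lim: "(?bound \<longlongrightarrow> 0) (at y0)"
  proof -
    have "((\<lambda>y. E y b) \<longlongrightarrow> 0) (at y0)" for b using E_cont[of b] E0[of b] by (simp add: isCont_def)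
    then have "(?bound \<longlongrightarrow> (\<Sum>b\<in>(Basis::'b set). \<bar>0\<bar>) / m) (at y0)"
      by (intro tendsto_intros) (use m in auto)
    then show ?thesis by simp
  qed
  have bound: "norm (\<Gamma> c y u v - ?X) \<le> ?bound y" if "y \<in> cball y0 r" for y
  proof -
    have y: "y \<in> snd c ` fst c" using that r(2) by blast
    let ?x = "\<Gamma> c y u v - ?X"
    have Elin: "linear (E y)"
      unfolding E_def using koszul_linear(1)[OF c y] metric_bilinear[OF c y]
      by (intro linear_compose_sub) (auto simp: bilinear_def)
    have "m * (norm ?x)\<^sup>2 \<le> G c y ?x ?x" by (rule m(2)[OF that])
    also have "\<dots> = E y ?x"
      by (simp add: E_def bilinear_lsub[OF metric_bilinear[OF c y]] christoffel_koszul[OF c y])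
    also have "\<dots> = (\<Sum>b\<in>Basis. (?x \<bullet> b) * E y b)"
      by (subst linear_expand[OF Elin]) simp
    also have "\<dots> \<le> (\<Sum>b\<in>Basis. norm ?x * \<bar>E y b\<bar>)"
    proof (rule sum_mono)
      fix b :: 'b assume b: "b \<in> Basis"
      have "(?x \<bullet> b) * E y b \<le> \<bar>?x \<bullet> b\<bar> * \<bar>E y b\<bar>" by (metis abs_ge_self abs_mult)
      also have "\<dots> \<le> norm ?x * \<bar>E y b\<bar>" by (intro mult_right_mono Basis_le_norm b) auto
      finally show "(?x \<bullet> b) * E y b \<le> norm ?x * \<bar>E y b\<bar>" .
    qed
    also have "\<dots> = norm ?x * (\<Sum>b\<in>Basis. \<bar>E y b\<bar>)" by (simp add: sum_distrib_left)
    finally have "norm ?x * (m * norm ?x) \<le> norm ?x * (\<Sum>b\<in>Basis. \<bar>E y b\<bar>)" by (simp add: power2_eq_square algebra_simps)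
    then have "m * norm ?x \<le> (\<Sum>b\<in>Basis. \<bar>E y b\<bar>)"
      by (cases "norm ?x = 0") (auto simp: sum_nonneg)
    then show ?thesis using m(1) by (simp add: field_simps)
  qed
  have "((\<lambda>y. \<Gamma> c y u v - ?X) \<longlongrightarrow> 0) (at y0)"
    by (rule Lim_null_comparison[OF _ lim])
       (use bound r(1) in \<open>auto simp: eventually_at dist_commute intro!: exI[of _ r]\<close>)
  then show "continuous (at y0) (\<lambda>y. \<Gamma> c y u v)"
    by (simp add: isCont_def LIM_zero_iff)
qed

section \<open>The metric and the connection under a change of chart\<close>

abbreviation "D\<tau> c d y \<equiv> frechet_derivative (transition c d) (at y)"

definition D2\<tau> :: "('a, 'b) chart \<Rightarrow> ('a, 'b) chart \<Rightarrow> 'b \<Rightarrow> 'b \<Rightarrow> 'b \<Rightarrow> 'b" where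
  "D2\<tau> c d y u v = frechet_derivative (\<lambda>z. D\<tau> c d z v) (at y) u"

context
  fixes c d U
  assumes c: "c \<in> A" and d: "d \<in> A" and U_def: "U = snd c ` (fst c \<inter> fst d)"
begin

lemma U_sub: "U \<subseteq> snd c ` fst c" by (auto simp: U_def)

lemma U_chart_inv: "y \<in> U \<Longrightarrow> chart_inv c y \<in> fst c \<inter> fst d \<and> snd c (chart_inv c y) = y"
  by (auto simp: U_def chart_inv_chart[OF c])

lemma U_open: "open U" unfolding U_def by (rule overlap_open[OF c d])

lemma has_derivative_\<tau>: "y \<in> U \<Longrightarrow> (transition c d has_derivative D\<tau> c d y) (at y)"
  using transition_differentiable[OF c d, of "chart_inv c y"] U_chart_inv[of y] by simp

lemma D\<tau>_linear: "y \<in> U \<Longrightarrow> linear (D\<tau> c d y)"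
  by (rule has_derivative_linear[OF has_derivative_\<tau>])

lemma \<tau>_in: "y \<in> U \<Longrightarrow> transition c d y \<in> snd d ` fst d"
  using U_chart_inv[of y] by (auto simp: transition_def)

lemma has_derivative_D\<tau>: "y \<in> U \<Longrightarrow> ((\<lambda>z. D\<tau> c d z v) has_derivative (\<lambda>u. D2\<tau> c d y u v)) (at y)"
  unfolding D2\<tau>_def using transition_smooth[OF c d, of 2]
  by (simp add: numeral_2_eq_2 U_def[symmetric] frechet_derivative_works[symmetric])

lemma D2\<tau>_continuous: "continuous_on U (\<lambda>y. D2\<tau> c d y u v)"
  unfolding D2\<tau>_def using transition_smooth[OF c d, of 2]
  by (simp add: numeral_2_eq_2 U_def[symmetric])

lemma D2\<tau>_sym: "y \<in> U \<Longrightarrow> D2\<tau> c d y u v = D2\<tau> c d y v u"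
  by (rule second_derivative_symmetric[OF U_open _ has_derivative_\<tau> has_derivative_D\<tau>])

lemma D2\<tau>_linear:
  assumes "y \<in> U"
  shows "linear (\<lambda>u. D2\<tau> c d y u v)" "linear (\<lambda>v. D2\<tau> c d y u v)"
proof -
  show *: "linear (\<lambda>u. D2\<tau> c d y u v)" for v
    by (rule has_derivative_linear[OF has_derivative_D\<tau>[OF assms]])
  show "linear (\<lambda>v. D2\<tau> c d y u v)" using *[of u] by (simp add: D2\<tau>_sym[OF assms, of _ u])
qed

lemma chart_vec_transition:
  assumes "p \<in> fst c" "p \<in> fst d"
  shows "chart_vec A c p v = chart_vec A d p (D\<tau> c d (snd c p) v)"
proof (rule tangent_eqI[OF d assms(2) chart_vec_tangent[OF c assms(1)] chart_vec_tangent[OF d assms(2)]])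
  show "chart_vec A c p v d = chart_vec A d p (D\<tau> c d (snd c p) v) d"
    using assms d by (simp add: chart_vec_self) (simp add: chart_vec_def)
qed

lemma metric_transition:
  assumes "y \<in> U"
  shows "G c y v w = G d (transition c d y) (D\<tau> c d y v) (D\<tau> c d y w)"
proof -
  let ?p = "chart_inv c y"
  have p: "?p \<in> fst c" "?p \<in> fst d" "snd c ?p = y" using U_chart_inv[OF assms] by auto
  have "chart_inv d (transition c d y) = ?p" by (simp add: transition_def chart_inv_chart[OF d p(2)])
  then show ?thesis
    unfolding metric_in_chart_def using chart_vec_transition[OF p(1,2)] p(3) by simp
qed

text \<open>The derivative of the tensor law \<open>metric_transition\<close>: the two vectors move
  with the point as well, and each contributes a second derivative of the transition map.\<close>

lemma DG_transition:
  assumes y: "y \<in> U"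
  shows "DG c y u v w = DG d (transition c d y) (D\<tau> c d y u) (D\<tau> c d y v) (D\<tau> c d y w)
     + G d (transition c d y) (D2\<tau> c d y u v) (D\<tau> c d y w) + G d (transition c d y) (D\<tau> c d y v) (D2\<tau> c d y u w)"
proof -
  have "((\<lambda>z. G d (transition c d z) (D\<tau> c d z v) (D\<tau> c d z w)) has_derivative
     (\<lambda>u. DG d (transition c d y) (D\<tau> c d y u) (D\<tau> c d y v) (D\<tau> c d y w)
     + G d (transition c d y) (D2\<tau> c d y u v) (D\<tau> c d y w) + G d (transition c d y) (D\<tau> c d y v) (D2\<tau> c d y u w))) (at y)"
  proof (rule has_derivative_bilinear_family[where B = "\<lambda>z. G d (transition c d z)", OF U_open y])
    show "bilinear (G d (transition c d z))" if "z \<in> U" for z by (rule metric_bilinear[OF d \<tau>_in[OF that]])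
    show "bilinear (DG d (transition c d y) (D\<tau> c d y u))" for u by (rule DG_bilinear[OF d \<tau>_in[OF y]])
    show "((\<lambda>z. G d (transition c d z) v w) has_derivative (\<lambda>u. DG d (transition c d y) (D\<tau> c d y u) v w)) (at y)" for v w
      using diff_chain_at[OF has_derivative_\<tau>[OF y] has_derivative_G[OF d \<tau>_in[OF y]]] by (simp add: o_def)
  qed (rule has_derivative_D\<tau>[OF y])+
  then have "((\<lambda>z. G c z v w) has_derivative
     (\<lambda>u. DG d (transition c d y) (D\<tau> c d y u) (D\<tau> c d y v) (D\<tau> c d y w)
     + G d (transition c d y) (D2\<tau> c d y u v) (D\<tau> c d y w) + G d (transition c d y) (D\<tau> c d y v) (D2\<tau> c d y u w))) (at y)"
    by (rule has_derivative_transform_within_open[OF _ U_open y]) (rule metric_transition[symmetric])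
  from has_derivative_unique[OF has_derivative_G[OF c subsetD[OF U_sub y]] this] show ?thesis by metis
qed

text \<open>The difference of the two sides is orthogonal to the image of \<open>D\<tau>\<close>.
  That image is the whole space, since the opposite transition inverts the differential, so
  definiteness makes the difference 0.\<close>

lemma christoffel_transition:
  assumes y: "y \<in> U"
  shows "\<Gamma> d (transition c d y) (D\<tau> c d y u) (D\<tau> c d y v) = D\<tau> c d y (\<Gamma> c y u v) - D2\<tau> c d y u v"
proof -
  let ?z = "transition c d y" and ?L = "D\<tau> c d y" and ?H = "D2\<tau> c d y"
  have z: "?z \<in> snd d ` fst d" by (rule \<tau>_in[OF y])
  have yc: "y \<in> snd c ` fst c" by (rule subsetD[OF U_sub y])
  note sym = metric_chart_sym[OF d z]
  let ?x = "\<Gamma> d ?z (?L u) (?L v) - (?L (\<Gamma> c y u v) - ?H u v)"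
  have *: "G d ?z ?x (?L w) = 0" for w
  proof -
    have "G d ?z (?L (\<Gamma> c y u v)) (?L w) = koszul c y u v w"
      by (simp add: metric_transition[OF y, symmetric] christoffel_koszul[OF c yc])
    \<comment> \<open>Six terms with second derivatives arise. By symmetry of the second derivative
      and of the metric four of them cancel and the other two coincide.\<close>
    also have "\<dots> = koszul d ?z (?L u) (?L v) (?L w) + G d ?z (?H u v) (?L w)"
      unfolding koszul_def DG_transition[OF y]
      using D2\<tau>_sym[OF y, of v u] D2\<tau>_sym[OF y, of w u] D2\<tau>_sym[OF y, of w v]
        sym[of "?L v" "?H u w"] sym[of "?L u" "?H v w"]
      by (simp add: field_simps)
    finally show ?thesis
      by (simp add: bilinear_lsub[OF metric_bilinear[OF d z]] christoffel_koszul[OF d z])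
  qed
  obtain w where "?L w = ?x"
  proof
    let ?p = "chart_inv c y"
    have p: "?p \<in> fst c" "?p \<in> fst d" "snd c ?p = y" using U_chart_inv[OF y] by auto
    have "D\<tau> c d (snd c ?p) (D\<tau> d c (snd d ?p) ?x) = D\<tau> d d (snd d ?p) ?x"
      by (rule transition_derivative_compose[OF d c d p(2,1,2)])
    then show "?L (D\<tau> d c (snd d ?p) ?x) = ?x"
      using transition_derivative_self[OF d p(2)] p(3) by simp
  qed
  with *[of w] have "?x = 0" using metric_pos[OF d z, of ?x] by fastforce
  then show ?thesis by simp
qed

end

end

section \<open>Coordinates on the total space\<close>

context riemannian_manifold
begin

text \<open>The inverse of the bundle chart, written without \<open>W\<close>, so that the condition
  on an admissible \<open>W\<close> can be stated through it.\<close>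

definition chart_point :: "('a, 'b) chart \<Rightarrow> 'b \<times> 'b \<Rightarrow> 'a \<times> ('a, 'b) tvec" where
  "chart_point c z = (chart_inv c (fst z), chart_vec A c (chart_inv c (fst z)) (snd z))"

lemma zero_tangent: "(\<lambda>_. 0) \<in> tangent_space A p"
proof -
  have "frechet_derivative (transition c d) (at (snd c p)) 0 = 0" if "c \<in> A" "d \<in> A" "p \<in> fst c" "p \<in> fst d" for c d
    by (rule linear_0[OF transition_derivative_linear[OF that]])
  then show ?thesis unfolding tangent_space_def by simp
qed

end

subsection \<open>The tangent bundle\<close>

text \<open>Openness of \<open>W\<close> is required in coordinates: there it can be checked as a
  continuous strict inequality, and it says that the images of the bundle charts are open.\<close>

locale bundle_domain = riemannian_manifold A g for A :: "('a, 'b::euclidean_space) chart set" and g +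
  fixes W :: "('a \<times> ('a, 'b) tvec) set"
  assumes W_sub: "W \<subseteq> total_space A"
    and W_open: "c \<in> A \<Longrightarrow> open {z. fst z \<in> snd c ` fst c \<and> chart_point c z \<in> W}"
begin

abbreviation "bc \<equiv> bundle_chart A W"
abbreviation "BA \<equiv> bundle_atlas A W"

definition chart_image :: "('a, 'b) chart \<Rightarrow> ('b \<times> 'b) set" where
  "chart_image c = {z. fst z \<in> snd c ` fst c \<and> chart_point c z \<in> W}"

lemma W_tangent: "e \<in> W \<Longrightarrow> snd e \<in> tangent_space A (fst e)"
  using W_sub by (auto simp: total_space_def)

lemma W_base: "e \<in> W \<Longrightarrow> fst e \<in> manifold_points A"
  using W_sub by (auto simp: total_space_def)

lemma bc_in_atlas: "c \<in> A \<Longrightarrow> bc c \<in> BA" by (simp add: bundle_atlas_def)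

lemma fst_bc: "fst (bc c) = {e \<in> W. fst e \<in> fst c}"
  using W_tangent by (auto simp: bundle_chart_def)

lemma snd_bc: "snd (bc c) e = (snd c (fst e), snd e c)"
  by (simp add: bundle_chart_def case_prod_unfold)

lemma chart_point_bc:
  assumes "c \<in> A" "e \<in> W" "fst e \<in> fst c"
  shows "chart_point c (snd (bc c) e) = e"
  using chart_vec_of_tangent[OF assms(1,3) W_tangent[OF assms(2)]]
  by (simp add: chart_point_def snd_bc chart_inv_chart[OF assms(1,3)])

lemma bc_chart_point:
  assumes c: "c \<in> A" and z: "z \<in> chart_image c"
  shows "chart_point c z \<in> fst (bc c)" "snd (bc c) (chart_point c z) = z"
proof -
  have y: "fst z \<in> snd c ` fst c" using z by (simp add: chart_image_def)
  show "chart_point c z \<in> fst (bc c)"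
    using z chart_inv_in[OF y] by (simp add: chart_image_def fst_bc) (simp add: chart_point_def)
  show "snd (bc c) (chart_point c z) = z"
    by (simp add: snd_bc chart_point_def chart_chart_inv[OF y] chart_vec_self[OF c chart_inv_in[OF y]])
qed

lemma bc_in_image:
  assumes "c \<in> A" "e \<in> W" "fst e \<in> fst c"
  shows "snd (bc c) e \<in> chart_image c"
  using assms(2,3) chart_point_bc[OF assms] by (simp add: chart_image_def) (simp add: snd_bc)

lemma bc_image:
  assumes c: "c \<in> A"
  shows "snd (bc c) ` fst (bc c) = chart_image c"
proof (intro equalityI subsetI)
  show "z \<in> chart_image c" if "z \<in> snd (bc c) ` fst (bc c)" for z
    using that bc_in_image[OF c] by (auto simp only: fst_bc)
  show "z \<in> snd (bc c) ` fst (bc c)" if "z \<in> chart_image c" for z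
    by (rule image_eqI[OF _ bc_chart_point(1)[OF c that]]) (rule bc_chart_point(2)[OF c that, symmetric])
qed

lemma bc_overlap:
  assumes c: "c \<in> A" and d: "d \<in> A"
  shows "snd (bc c) ` (fst (bc c) \<inter> fst (bc d)) = {z \<in> chart_image c. fst z \<in> snd c ` (fst c \<inter> fst d)}"
proof (intro equalityI subsetI)
  fix z assume "z \<in> snd (bc c) ` (fst (bc c) \<inter> fst (bc d))"
  then obtain e where e: "e \<in> W" "fst e \<in> fst c" "fst e \<in> fst d" "z = snd (bc c) e" by (auto simp: fst_bc)
  then show "z \<in> {z \<in> chart_image c. fst z \<in> snd c ` (fst c \<inter> fst d)}"
    using bc_in_image[OF c e(1,2)] by (simp add: snd_bc)
next
  fix z assume z: "z \<in> {z \<in> chart_image c. fst z \<in> snd c ` (fst c \<inter> fst d)}"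
  then have "chart_point c z \<in> fst (bc c)" "snd (bc c) (chart_point c z) = z"
    using bc_chart_point[OF c] by auto
  moreover have "fst (chart_point c z) \<in> fst d"
    using z by (auto simp: chart_point_def chart_inv_chart[OF c])
  ultimately have "chart_point c z \<in> fst (bc c) \<inter> fst (bc d)" by (simp add: fst_bc)
  then show "z \<in> snd (bc c) ` (fst (bc c) \<inter> fst (bc d))"
    using \<open>snd (bc c) (chart_point c z) = z\<close> by (metis imageI)
qed

lemma bc_inj: "c \<in> A \<Longrightarrow> inj_on (snd (bc c)) (fst (bc c))"
  by (rule inj_on_inverseI[of _ "chart_point c"]) (simp add: fst_bc chart_point_bc)

lemma chart_inv_bc: "c \<in> A \<Longrightarrow> z \<in> chart_image c \<Longrightarrow> chart_inv (bc c) z = chart_point c z"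
  unfolding chart_inv_def
  by (rule inv_into_f_eq[OF bc_inj]) (simp_all add: bc_chart_point)

lemma open_chart_image: "c \<in> A \<Longrightarrow> open (chart_image c)"
  unfolding chart_image_def by (rule W_open)

context
  fixes c d U V
  assumes c: "c \<in> A" and d: "d \<in> A" and U_def: "U = snd c ` (fst c \<inter> fst d)"
    and V_def: "V = snd (bc c) ` (fst (bc c) \<inter> fst (bc d))"
begin

lemma V_eq: "V = chart_image c \<inter> fst -` U"
  unfolding V_def bc_overlap[OF c d] U_def by auto

lemma V_open: "open V"
  unfolding V_eq by (intro open_Int open_chart_image[OF c] open_vimage_fst U_open[OF c d U_def])

lemma transition_bc:
  assumes z: "z \<in> V"
  shows "transition (bc c) (bc d) z = (transition c d (fst z), D\<tau> c d (fst z) (snd z))"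
proof -
  have z': "z \<in> chart_image c" "fst z \<in> U" using z by (auto simp: V_eq)
  let ?p = "chart_inv c (fst z)"
  have p: "?p \<in> fst c" "?p \<in> fst d" "snd c ?p = fst z"
    using U_chart_inv[OF c d U_def z'(2)] by auto
  have "transition (bc c) (bc d) z = snd (bc d) (chart_point c z)"
    by (simp add: transition_def chart_inv_bc[OF c z'(1)])
  also have "\<dots> = (snd d ?p, chart_vec A c ?p (snd z) d)" by (simp add: snd_bc chart_point_def)
  also have "\<dots> = (transition c d (fst z), D\<tau> c d (fst z) (snd z))"
    using d p by (simp add: chart_vec_def transition_def)
  finally show ?thesis .
qed

text \<open>The fibre coordinate is transformed by a linear map that varies with the base point,
  hence the second derivative. This term is what the Christoffel symbols compensate.\<close>

lemma has_derivative_transition_bc: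
  assumes z: "z \<in> V"
  shows "(transition (bc c) (bc d) has_derivative
    (\<lambda>h. (D\<tau> c d (fst z) (fst h), D2\<tau> c d (fst z) (fst h) (snd z) + D\<tau> c d (fst z) (snd h)))) (at z)"
proof -
  have U: "fst z \<in> U" if "z \<in> V" for z using that by (auto simp: V_eq)
  have fst: "(fst has_derivative fst) (at z)" by (rule has_derivative_fst[OF has_derivative_ident])
  have "((\<lambda>z. D\<tau> c d (fst z) (snd z)) has_derivative
     (\<lambda>h. D2\<tau> c d (fst z) (fst h) (snd z) + D\<tau> c d (fst z) (snd h))) (at z)"
  proof (rule has_derivative_linear_family[where L = "\<lambda>z. D\<tau> c d (fst z)", OF V_open z])
    show "linear (D\<tau> c d (fst z))" if "z \<in> V" for z by (rule D\<tau>_linear[OF c d U_def U[OF that]])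
    show "linear (D2\<tau> c d (fst z) (fst h))" for h by (rule D2\<tau>_linear(2)[OF c d U_def U[OF z]])
    show "((\<lambda>z. D\<tau> c d (fst z) v) has_derivative (\<lambda>h. D2\<tau> c d (fst z) (fst h) v)) (at z)" for v
      using diff_chain_at[OF fst has_derivative_D\<tau>[OF c d U_def U[OF z]]] by (simp add: o_def)
    show "(snd has_derivative snd) (at z)" by (rule has_derivative_snd[OF has_derivative_ident])
  qed
  moreover have "((\<lambda>z. transition c d (fst z)) has_derivative (\<lambda>h. D\<tau> c d (fst z) (fst h))) (at z)"
    using diff_chain_at[OF fst has_derivative_\<tau>[OF c d U_def U[OF z]]] by (simp add: o_def)
  ultimately have "((\<lambda>z. (transition c d (fst z), D\<tau> c d (fst z) (snd z))) has_derivative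
    (\<lambda>h. (D\<tau> c d (fst z) (fst h), D2\<tau> c d (fst z) (fst h) (snd z) + D\<tau> c d (fst z) (snd h)))) (at z)"
    by (intro has_derivative_Pair)
  then show ?thesis
    by (rule has_derivative_transform_within_open[OF _ V_open z]) (simp add: transition_bc)
qed

lemma D_transition_bc:
  "z \<in> V \<Longrightarrow> frechet_derivative (transition (bc c) (bc d)) (at z) h =
    (D\<tau> c d (fst z) (fst h), D2\<tau> c d (fst z) (fst h) (snd z) + D\<tau> c d (fst z) (snd h))"
  by (rule fun_cong[OF frechet_derivative_at[OF has_derivative_transition_bc], symmetric])

text \<open>Two continuous derivatives of the base transition yield one of the bundle transition,
  which already contains \<open>D\<tau>\<close>.\<close>

lemma transition_bc_C1: "Ck_on 1 V (transition (bc c) (bc d))"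
proof -
  have U: "fst ` V \<subseteq> U" by (auto simp: V_eq)
  have cont: "continuous_on V (\<lambda>z. f (fst z))" if "continuous_on U f" for f :: "'b \<Rightarrow> 'b"
    by (rule continuous_on_compose2[OF that _ U]) (intro continuous_intros)
  have D: "continuous_on U (\<lambda>y. D\<tau> c d y v)" for v
    unfolding U_def by (rule transition_derivative_continuous[OF c d])
  have "continuous_on V (\<lambda>z. (D\<tau> c d (fst z) (fst h), D2\<tau> c d (fst z) (fst h) (snd z) + D\<tau> c d (fst z) (snd h)))" for h
  proof (intro continuous_on_Pair continuous_on_add)
    show "continuous_on V (\<lambda>z. D\<tau> c d (fst z) v)" for v by (rule cont[OF D])
    then show "continuous_on V (\<lambda>z. D\<tau> c d (fst z) v)" for v .
    show "continuous_on V (\<lambda>z. D2\<tau> c d (fst z) (fst h) (snd z))"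
    proof (rule continuous_on_linear_family[where L = "\<lambda>z. D2\<tau> c d (fst z) (fst h)"])
      show "linear (D2\<tau> c d (fst z) (fst h))" if "z \<in> V" for z
        using that U by (intro D2\<tau>_linear(2)[OF c d U_def]) auto
      show "continuous_on V (\<lambda>z. D2\<tau> c d (fst z) (fst h) v)" for v
        by (rule cont[OF D2\<tau>_continuous[OF c d U_def]])
    qed (intro continuous_intros)
  qed
  then have "continuous_on V (\<lambda>z. frechet_derivative (transition (bc c) (bc d)) (at z) h)" for h
    by (rule continuous_on_eq) (simp add: D_transition_bc)
  moreover have "transition (bc c) (bc d) differentiable (at z)" if "z \<in> V" for z
    by (rule differentiableI[OF has_derivative_transition_bc[OF that]])
  ultimately show ?thesis by simp
qed

end

lemma bundle_points: "manifold_points BA = W"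
  using W_base by (fastforce simp: manifold_points_def bundle_atlas_def fst_bc)

lemma bc_preimage_open: "c \<in> A \<Longrightarrow> open B \<Longrightarrow> openin (atlas_topology BA) (fst (bc c) \<inter> snd (bc c) -` B)"
  unfolding atlas_topology_def by (rule topology_generated_by_Basis) (blast intro: bc_in_atlas)

lemma topspace_bundle: "topspace (atlas_topology BA) = W"
proof -
  have "fst C \<inter> snd C -` B \<subseteq> W" if "C \<in> BA" for C B
    using that by (auto simp: bundle_atlas_def fst_bc)
  then have "topspace (atlas_topology BA) \<subseteq> W"
    unfolding atlas_topology_def topology_generated_by_topspace by blast
  moreover have "e \<in> topspace (atlas_topology BA)" if eW: "e \<in> W" for e
  proof -
    obtain c where "c \<in> A" "fst e \<in> fst c" using W_base[OF eW] by (auto simp: manifold_points_def)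
    then show ?thesis using openin_subset[OF bc_preimage_open[of c UNIV]] eW by (auto simp: fst_bc)
  qed
  ultimately show ?thesis by blast
qed

lemma continuous_projection: "continuous_map (atlas_topology BA) (atlas_topology A) fst"
  unfolding atlas_topology_def[of A] continuous_on_generated_topo_iff Union_chart_preimages
proof (intro conjI allI impI)
  show "fst ` topspace (atlas_topology BA) \<subseteq> manifold_points A"
    using W_base by (auto simp: topspace_bundle)
  fix U assume "U \<in> {fst c \<inter> snd c -` B |c B. c \<in> A \<and> open B}"
  then obtain c B where cB: "c \<in> A" "open B" "U = fst c \<inter> snd c -` B" by auto
  have "fst -` U \<inter> topspace (atlas_topology BA) = fst (bc c) \<inter> snd (bc c) -` (B \<times> UNIV)"
    by (auto simp: topspace_bundle cB fst_bc snd_bc)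
  then show "openin (atlas_topology BA) (fst -` U \<inter> topspace (atlas_topology BA))"
    using bc_preimage_open[OF cB(1), of "B \<times> UNIV"] cB(2) by (simp add: open_Times)
qed

text \<open>Different base points are separated by pulling back along the projection; two points of
  one fibre lie in the domain of a common bundle chart.\<close>

lemma bundle_Hausdorff: "Hausdorff_space (atlas_topology BA)"
  unfolding Hausdorff_space_def topspace_bundle
proof (intro allI impI, elim conjE)
  fix e e' assume e: "e \<in> W" "e' \<in> W" "e \<noteq> e'"
  show "\<exists>U V. openin (atlas_topology BA) U \<and> openin (atlas_topology BA) V \<and> e \<in> U \<and> e' \<in> V \<and> disjnt U V"
  proof (cases "fst e = fst e'")
    case False
    then obtain U V where UV: "openin (atlas_topology A) U" "openin (atlas_topology A) V" "fst e \<in> U" "fst e' \<in> V" "disjnt U V"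
      using Hausdorff W_base[OF e(1)] W_base[OF e(2)] unfolding Hausdorff_space_def topspace_atlas by metis
    let ?f = "\<lambda>U. {x \<in> topspace (atlas_topology BA). fst x \<in> U}"
    have "openin (atlas_topology BA) (?f U)" "openin (atlas_topology BA) (?f V)"
      using openin_continuous_map_preimage[OF continuous_projection] UV by blast+
    then show ?thesis
      using UV e by (intro exI[of _ "?f U"] exI[of _ "?f V"]) (auto simp: topspace_bundle disjnt_def)
  next
    case True
    obtain c where c: "c \<in> A" "fst e \<in> fst c" using W_base[OF e(1)] by (auto simp: manifold_points_def)
    have "snd (bc c) e \<noteq> snd (bc c) e'"
      using chart_point_bc[OF c(1) e(1) c(2)] chart_point_bc[OF c(1) e(2)] True c(2) e(3) by metis
    then obtain B B' where B: "open B" "open B'" "snd (bc c) e \<in> B" "snd (bc c) e' \<in> B'" "B \<inter> B' = {}"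
      using hausdorff by metis
    have "e \<in> fst (bc c)" "e' \<in> fst (bc c)" using e c True by (auto simp: fst_bc)
    then show ?thesis
      using bc_preimage_open[OF c(1) B(1)] bc_preimage_open[OF c(1) B(2)] B
      by (intro exI[of _ "fst (bc c) \<inter> snd (bc c) -` B"] exI[of _ "fst (bc c) \<inter> snd (bc c) -` B'"]) (auto simp: disjnt_def)
  qed
qed

sublocale BA: C1_atlas BA
proof
  show "Hausdorff_space (atlas_topology BA)" by (rule bundle_Hausdorff)
  fix C assume "C \<in> BA" then obtain c where c: "c \<in> A" "C = bc c" by (auto simp: bundle_atlas_def)
  show "inj_on (snd C) (fst C)" using bc_inj c by simp
  show "open (snd C ` fst C)" using bc_image open_chart_image c by simp
  fix D assume "D \<in> BA" then obtain d where d: "d \<in> A" "D = bc d" by (auto simp: bundle_atlas_def)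
  show "open (snd C ` (fst C \<inter> fst D))" unfolding c(2) d(2) by (rule V_open[OF c(1) d(1) refl refl])
  show "Ck_on 1 (snd C ` (fst C \<inter> fst D)) (transition C D)"
    unfolding c(2) d(2) by (rule transition_bc_C1[OF c(1) d(1) refl refl])
qed

section \<open>Lifts and the splitting in bundle coordinates\<close>

lemma tangent_bundle_eqI:
  assumes "c \<in> A" "e \<in> W" "fst e \<in> fst c"
    and "\<xi> \<in> tangent_space BA e" "\<eta> \<in> tangent_space BA e" "\<xi> (bc c) = \<eta> (bc c)"
  shows "\<xi> = \<eta>"
  using assms by (intro BA.tangent_eqI[OF bc_in_atlas[of c] _ assms(4,5,6)]) (simp_all add: fst_bc)

lemma chart_vec_bc:
  assumes c: "c \<in> A" and d: "d \<in> A" and e: "e \<in> W" "fst e \<in> fst c" "fst e \<in> fst d"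
  shows "chart_vec BA (bc c) e h (bc d) =
    (D\<tau> c d (snd c (fst e)) (fst h), D2\<tau> c d (snd c (fst e)) (fst h) (snd e c) + D\<tau> c d (snd c (fst e)) (snd h))"
proof -
  have in_fst: "e \<in> fst (bc c) \<inter> fst (bc d)" using e by (simp add: fst_bc)
  show ?thesis
    unfolding chart_vec_def using D_transition_bc[OF c d refl refl imageI[OF in_fst], of h] in_fst bc_in_atlas[OF d]
    by (simp add: snd_bc)
qed

lemma chart_vec_bc_tangent:
  "c \<in> A \<Longrightarrow> e \<in> W \<Longrightarrow> fst e \<in> fst c \<Longrightarrow> chart_vec BA (bc c) e h \<in> tangent_space BA e"
  by (rule BA.chart_vec_tangent) (simp_all add: bc_in_atlas fst_bc)

lemma chart_vec_bc_self:
  "c \<in> A \<Longrightarrow> e \<in> W \<Longrightarrow> fst e \<in> fst c \<Longrightarrow> chart_vec BA (bc c) e h (bc c) = h"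
  by (rule BA.chart_vec_self) (simp_all add: bc_in_atlas fst_bc)

text \<open>The second-derivative term of the bundle transition cancels the inhomogeneous term in
  \<open>christoffel_transition\<close>. The coordinate prescriptions in all charts therefore
  describe one vector, and the definite description has a value.\<close>

lemma hor_lift_eq:
  assumes c: "c \<in> A" and e: "e \<in> W" "fst e \<in> fst c" and w: "w \<in> tangent_space A (fst e)"
  shows "hor_lift A g W e w = chart_vec BA (bc c) e (w c, - \<Gamma> c (snd c (fst e)) (w c) (snd e c))"
proof -
  let ?X = "chart_vec BA (bc c) e (w c, - \<Gamma> c (snd c (fst e)) (w c) (snd e c))"
  let ?P = "\<lambda>\<xi>. \<xi> \<in> tangent_space BA e \<and> (\<forall>c\<in>A. fst e \<in> fst c \<longrightarrow>
        \<xi> (bc c) = (w c, - \<Gamma> c (snd c (fst e)) (w c) (snd e c)))"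
  have "?X (bc d) = (w d, - \<Gamma> d (snd d (fst e)) (w d) (snd e d))" if d: "d \<in> A" "fst e \<in> fst d" for d
  proof -
    let ?y = "snd c (fst e)"
    have y: "?y \<in> snd c ` (fst c \<inter> fst d)" using e(2) d(2) by blast
    have "\<Gamma> d (transition c d ?y) (D\<tau> c d ?y (w c)) (D\<tau> c d ?y (snd e c)) =
       D\<tau> c d ?y (\<Gamma> c ?y (w c) (snd e c)) - D2\<tau> c d ?y (w c) (snd e c)"
      by (rule christoffel_transition[OF c d(1) refl y])
    moreover have "transition c d ?y = snd d (fst e)" by (rule transition_chart[OF c e(2)])
    moreover have "D\<tau> c d ?y (w c) = w d" "D\<tau> c d ?y (snd e c) = snd e d"
      using tangent_transition[OF w c d(1) e(2) d(2)] tangent_transition[OF W_tangent[OF e(1)] c d(1) e(2) d(2)]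
      by simp_all
    ultimately have \<Gamma>d: "\<Gamma> d (snd d (fst e)) (w d) (snd e d) = D\<tau> c d ?y (\<Gamma> c ?y (w c) (snd e c)) - D2\<tau> c d ?y (w c) (snd e c)"
      and wd: "D\<tau> c d ?y (w c) = w d" by simp_all
    show ?thesis
      unfolding chart_vec_bc[OF c d(1) e d(2)]
      by (simp add: \<Gamma>d wd linear_neg[OF D\<tau>_linear[OF c d(1) refl y]])
  qed
  then have "?P ?X" using chart_vec_bc_tangent[OF c e] by blast
  moreover have "\<xi> = ?X" if "?P \<xi>" for \<xi>
    by (rule tangent_bundle_eqI[OF c e]) (use that \<open>?P ?X\<close> c e in auto)
  ultimately have "(THE \<xi>. ?P \<xi>) = ?X" by (rule the_equality)
  then show ?thesis by (simp add: hor_lift_def case_prod_unfold)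
qed

text \<open>With zero base component the second-derivative term vanishes, so the prescription is
  compatible without any connection.\<close>

lemma vert_lift_eq:
  assumes c: "c \<in> A" and e: "e \<in> W" "fst e \<in> fst c" and w: "w \<in> tangent_space A (fst e)"
  shows "vert_lift A W e w = chart_vec BA (bc c) e (0, w c)"
proof -
  let ?X = "chart_vec BA (bc c) e (0, w c)"
  let ?P = "\<lambda>\<xi>. \<xi> \<in> tangent_space BA e \<and> (\<forall>c\<in>A. fst e \<in> fst c \<longrightarrow> \<xi> (bc c) = (0, w c))"
  have "?X (bc d) = (0, w d)" if d: "d \<in> A" "fst e \<in> fst d" for d
  proof -
    let ?y = "snd c (fst e)"
    have y: "?y \<in> snd c ` (fst c \<inter> fst d)" using e(2) d(2) by blast
    show ?thesis
      unfolding chart_vec_bc[OF c d(1) e d(2)]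
      using tangent_transition[OF w c d(1) e(2) d(2)]
      by (simp add: linear_0[OF D\<tau>_linear[OF c d(1) refl y]] linear_0[OF D2\<tau>_linear(1)[OF c d(1) refl y]])
  qed
  then have "?P ?X" using chart_vec_bc_tangent[OF c e] by blast
  moreover have "\<xi> = ?X" if "?P \<xi>" for \<xi>
    by (rule tangent_bundle_eqI[OF c e]) (use that \<open>?P ?X\<close> c e in auto)
  ultimately have "(THE \<xi>. ?P \<xi>) = ?X" by (rule the_equality)
  then show ?thesis by (simp add: vert_lift_def case_prod_unfold)
qed

text \<open>The system is triangular: the base component of the vector fixes \<open>w\<close>, and
  then the fibre component, with the Christoffel term added back, fixes \<open>z\<close>.\<close>

lemma hv_split_eq:
  assumes c: "c \<in> A" and e: "e \<in> W" "fst e \<in> fst c"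
  shows "hv_split A g W e (chart_vec BA (bc c) e h) =
    (chart_vec A c (fst e) (fst h),
     chart_vec A c (fst e) (snd h + \<Gamma> c (snd c (fst e)) (fst h) (snd e c)))"
proof -
  let ?\<xi> = "chart_vec BA (bc c) e h" and ?p = "fst e"
  let ?\<Gamma> = "\<lambda>v. \<Gamma> c (snd c ?p) v (snd e c)"
  let ?w = "chart_vec A c ?p (fst h)" and ?z = "chart_vec A c ?p (snd h + ?\<Gamma> (fst h))"
  have C: "bc c \<in> BA" "e \<in> fst (bc c)" using c e by (simp_all add: bc_in_atlas fst_bc)
  have lifts: "(\<lambda>C. hor_lift A g W e w C + vert_lift A W e z C) = chart_vec BA (bc c) e (w c, z c - ?\<Gamma> (w c))"
    if "w \<in> tangent_space A ?p" "z \<in> tangent_space A ?p" for w z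
    by (simp add: hor_lift_eq[OF c e that(1)] vert_lift_eq[OF c e that(2)] BA.chart_vec_add[OF C, symmetric])
  have iff: "?\<xi> = (\<lambda>C. hor_lift A g W e w C + vert_lift A W e z C) \<longleftrightarrow> w = ?w \<and> z = ?z"
    if wz: "w \<in> tangent_space A ?p" "z \<in> tangent_space A ?p" for w z
  proof -
    have "?\<xi> = (\<lambda>C. hor_lift A g W e w C + vert_lift A W e z C) \<longleftrightarrow> h = (w c, z c - ?\<Gamma> (w c))"
      unfolding lifts[OF wz] using chart_vec_bc_self[OF c e] by metis
    also have "\<dots> \<longleftrightarrow> w c = fst h \<and> z c = snd h + ?\<Gamma> (fst h)" by (cases h) auto
    also have "\<dots> \<longleftrightarrow> w = ?w \<and> z = ?z"
      using chart_vec_of_tangent[OF c e(2) wz(1)] chart_vec_of_tangent[OF c e(2) wz(2)] chart_vec_self[OF c e(2)] by metis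
    finally show ?thesis .
  qed
  have tan: "?w \<in> tangent_space A ?p" "?z \<in> tangent_space A ?p" by (intro chart_vec_tangent c e)+
  show ?thesis
    unfolding hv_split_def
  proof (rule the_equality)
    show "case (?w, ?z) of (w, z) \<Rightarrow> w \<in> tangent_space A ?p \<and> z \<in> tangent_space A ?p \<and>
        ?\<xi> = (\<lambda>C. hor_lift A g W e w C + vert_lift A W e z C)"
      unfolding prod.case using tan iff[OF tan] by blast
    fix x assume "case x of (w, z) \<Rightarrow> w \<in> tangent_space A ?p \<and> z \<in> tangent_space A ?p \<and>
        ?\<xi> = (\<lambda>C. hor_lift A g W e w C + vert_lift A W e z C)"
    moreover obtain w z where x: "x = (w, z)" by (cases x)
    ultimately have "w \<in> tangent_space A ?p" "z \<in> tangent_space A ?p"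
      "?\<xi> = (\<lambda>C. hor_lift A g W e w C + vert_lift A W e z C)" by simp_all
    then show "x = (?w, ?z)" using iff x by blast
  qed
qed

text \<open>Eliminates the lifts and the splitting; the estimates below use only these coordinate
  expressions.\<close>

lemma pullbacks_chart:
  assumes c: "c \<in> A" and z: "z \<in> chart_image c"
  shows "metric_in_chart BA (hor_pullback A g W) (bc c) z h h' = G c (fst z) (fst h) (fst h')"
    and "metric_in_chart BA (vert_pullback A g W) (bc c) z h h' =
       G c (fst z) (snd h + \<Gamma> c (fst z) (fst h) (snd z)) (snd h' + \<Gamma> c (fst z) (fst h') (snd z))"
proof -
  let ?e = "chart_point c z"
  have e: "?e \<in> W" "fst ?e \<in> fst c" using bc_chart_point(1)[OF c z] by (auto simp: fst_bc)
  have "snd (bc c) ?e = z" by (rule bc_chart_point(2)[OF c z])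
  from arg_cong[OF this, of fst] arg_cong[OF this, of snd]
  have z': "snd c (fst ?e) = fst z" "snd ?e c = snd z" by (simp_all add: snd_bc)
  have p: "fst ?e = chart_inv c (fst z)" by (simp add: chart_point_def)
  show "metric_in_chart BA (hor_pullback A g W) (bc c) z h h' = G c (fst z) (fst h) (fst h')"
    unfolding metric_in_chart_def hor_pullback_def chart_inv_bc[OF c z] hv_split_eq[OF c e] z'
    by (simp add: p)
  show "metric_in_chart BA (vert_pullback A g W) (bc c) z h h' =
       G c (fst z) (snd h + \<Gamma> c (fst z) (fst h) (snd z)) (snd h' + \<Gamma> c (fst z) (fst h') (snd z))"
    unfolding metric_in_chart_def vert_pullback_def chart_inv_bc[OF c z] hv_split_eq[OF c e] z'
    by (simp add: p)
qed

end

subsection \<open>Completeness\<close>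

lemma bilinear_Cauchy_Schwarz:
  fixes B :: "'b::real_vector \<Rightarrow> 'b \<Rightarrow> real"
  assumes B: "bilinear B" and sym: "\<And>u v. B u v = B v u" and pos: "\<And>v. v \<noteq> 0 \<Longrightarrow> B v v > 0"
  shows "(B u v)\<^sup>2 \<le> B u u * B v v"
proof (cases "v = 0")
  case False
  \<comment> \<open>The multiple of \<open>v\<close> whose subtraction from \<open>u\<close>
    minimises the form.\<close>
  let ?t = "B u v / B v v"
  have nn: "B w w \<ge> 0" for w using pos[of w] by (cases "w = 0") (auto simp: bilinear_lzero[OF B])
  have "0 \<le> B (u - ?t *\<^sub>R v) (u - ?t *\<^sub>R v)" by (rule nn)
  also have "\<dots> = B u u - ?t * B u v"
    using pos[OF False] sym[of v u]
    by (simp add: bilinear_lsub[OF B] bilinear_rsub[OF B] bilinear_lmul[OF B] bilinear_rmul[OF B] field_simps)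
  finally show ?thesis using pos[OF False] by (simp add: field_simps power2_eq_square)
qed (simp add: bilinear_rzero[OF B])

lemma has_integral_le_off_finite:
  fixes f h :: "real \<Rightarrow> real"
  assumes f: "(f has_integral I) {0..1}" and h: "(h has_integral J) {0..1}" and T: "finite T"
    and le: "\<And>t. t \<in> {0<..<1} - T \<Longrightarrow> f t \<le> h t"
  shows "I \<le> J"
proof -
  have fin: "finite ({0,1} \<union> T)" using T by simp
  have "((\<lambda>t. if t \<in> {0<..<1} - T then f t else 0) has_integral I) {0..1}"
    by (rule has_integral_spike_finite[OF fin _ f]) auto
  moreover have "((\<lambda>t. if t \<in> {0<..<1} - T then h t else 0) has_integral J) {0..1}"
    by (rule has_integral_spike_finite[OF fin _ h]) auto
  ultimately show ?thesis by (rule has_integral_le) (use le in auto)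
qed

lemma (in Metric_space) MCauchy_geometric:
  assumes \<sigma>: "range \<sigma> \<subseteq> M" and C: "C \<ge> 0" and le: "\<And>n. d (\<sigma> n) (\<sigma> (Suc n)) \<le> C * (1/2) ^ n"
  shows "MCauchy \<sigma>"
proof -
  have in_M: "\<sigma> n \<in> M" for n using \<sigma> by auto
  \<comment> \<open>The last factor records the exact partial geometric sum, so that the induction
    closes; it is discarded afterwards.\<close>
  have "d (\<sigma> n) (\<sigma> (n + k)) \<le> 2 * C * (1/2) ^ n * (1 - (1/2) ^ k)" for n k
  proof (induction k)
    case 0 show ?case using in_M by simp
  next
    case (Suc k)
    have "d (\<sigma> n) (\<sigma> (n + Suc k)) \<le> d (\<sigma> n) (\<sigma> (n + k)) + d (\<sigma> (n + k)) (\<sigma> (Suc (n + k)))"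
      using triangle[OF in_M in_M in_M] by simp
    also have "\<dots> \<le> 2 * C * (1/2) ^ n * (1 - (1/2) ^ k) + C * (1/2) ^ (n + k)"
      by (intro add_mono Suc le)
    also have "\<dots> = 2 * C * (1/2) ^ n * (1 - (1/2) ^ Suc k)" by (simp add: power_add algebra_simps)
    finally show ?case .
  qed
  moreover have "2 * C * (1/2) ^ n * (1 - (1/2) ^ k) \<le> 2 * C * (1/2) ^ n" for n k
    using C by (intro mult_left_le) auto
  ultimately have bound: "d (\<sigma> n) (\<sigma> (n + k)) \<le> 2 * C * (1/2) ^ n" for n k by (rule order_trans)
  have bound': "d (\<sigma> N) (\<sigma> n) \<le> 2 * C * (1/2) ^ N" if "N \<le> n" for N n
    using bound[of N "n - N"] that by simp
  have lim: "(\<lambda>N. 4 * C * (1/2) ^ N) \<longlonglongrightarrow> 4 * C * 0"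
    by (intro tendsto_mult_left LIMSEQ_realpow_zero) auto
  show ?thesis
    unfolding MCauchy_def
  proof (intro conjI allI impI \<sigma>)
    fix \<epsilon> :: real assume "\<epsilon> > 0"
    then obtain N where N: "4 * C * (1/2) ^ N < \<epsilon>"
      using order_tendstoD(2)[OF lim, of \<epsilon>] by (auto simp: eventually_sequentially)
    have "d (\<sigma> n) (\<sigma> n') < \<epsilon>" if "N \<le> n" "N \<le> n'" for n n'
    proof -
      have "d (\<sigma> n) (\<sigma> n') \<le> d (\<sigma> N) (\<sigma> n) + d (\<sigma> N) (\<sigma> n')"
        using triangle[OF in_M in_M in_M, of n n' N] commute[of "\<sigma> n" "\<sigma> N"] by simp
      also have "\<dots> \<le> 4 * C * (1/2) ^ N" using bound'[OF that(1)] bound'[OF that(2)] by simp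
      finally show ?thesis using N by simp
    qed
    then show "\<exists>N. \<forall>n n'. N \<le> n \<longrightarrow> N \<le> n' \<longrightarrow> d (\<sigma> n) (\<sigma> n') < \<epsilon>" by blast
  qed
qed

section \<open>The disk bundle and its metric in coordinates\<close>

locale disk_bundle_setup = riemannian_manifold A g
  for A :: "('a, 'b::euclidean_space) chart set" and g +
  fixes K c\<^sub>1 :: real and r\<^sub>0 :: ereal
  assumes connected: "connected_space (atlas_topology A)"
    and c\<^sub>1: "c\<^sub>1 > 0"
    and r\<^sub>0: "r\<^sub>0 = (if K < 0 then ereal (sqrt (- c\<^sub>1 / K)) else \<infinity>)"
begin

sublocale joined_metric A g
  by unfold_locales (rule joined_of_connected[OF connected])

abbreviation "W \<equiv> disk_bundle A g r\<^sub>0"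
abbreviation "GW \<equiv> disk_bundle_metric A g c\<^sub>1 K r\<^sub>0"

abbreviation "GB \<equiv> metric_in_chart (bundle_atlas A W) GW"

text \<open>The squared fibre norm in bundle coordinates.\<close>

definition sq :: "('a, 'b) chart \<Rightarrow> 'b \<times> 'b \<Rightarrow> real" where
  "sq c z = G c (fst z) (snd z) (snd z)"

definition scale :: "('a, 'b) chart \<Rightarrow> 'b \<times> 'b \<Rightarrow> real" where
  "scale c z = sqrt (c\<^sub>1 + K * sq c z)"

text \<open>Merges the two cases of \<open>r\<^sub>0\<close> into positivity of the radicand: for
  negative \<open>K\<close> the radicand vanishes exactly at the radius \<open>r\<^sub>0\<close>,
  otherwise both sides always hold.\<close>

lemma in_disk_iff: "x \<ge> 0 \<Longrightarrow> ereal (sqrt x) < r\<^sub>0 \<longleftrightarrow> c\<^sub>1 + K * x > 0"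
proof (cases "K < 0")
  case True
  assume "x \<ge> 0"
  have "ereal (sqrt x) < r\<^sub>0 \<longleftrightarrow> x < - c\<^sub>1 / K" using True by (simp add: r\<^sub>0)
  also have "\<dots> \<longleftrightarrow> c\<^sub>1 + K * x > 0" using True by (simp add: field_simps) linarith
  finally show ?thesis .
next
  case False
  assume "x \<ge> 0"
  then have "K * x \<ge> 0" using False by simp
  then show ?thesis using False c\<^sub>1 by (simp add: r\<^sub>0)
qed

lemma sq_nonneg: "c \<in> A \<Longrightarrow> fst z \<in> snd c ` fst c \<Longrightarrow> sq c z \<ge> 0"
  unfolding sq_def by (rule metric_nonneg)

lemma tnorm_chart_point:
  assumes c: "c \<in> A" and z: "fst z \<in> snd c ` fst c"
  shows "tnorm g (fst (chart_point c z)) (snd (chart_point c z)) = sqrt (sq c z)"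
  using tnorm_chart_vec[OF c chart_inv_in[OF z]] by (simp add: chart_point_def sq_def chart_chart_inv[OF z])

lemma chart_point_disk:
  assumes c: "c \<in> A" and z: "fst z \<in> snd c ` fst c"
  shows "chart_point c z \<in> W \<longleftrightarrow> c\<^sub>1 + K * sq c z > 0"
proof -
  have "chart_point c z \<in> total_space A"
    unfolding total_space_def chart_point_def
    using chart_vec_tangent[OF c chart_inv_in[OF z]] in_manifold[OF c chart_inv_in[OF z]] by blast
  then have "chart_point c z \<in> W \<longleftrightarrow> ereal (sqrt (sq c z)) < r\<^sub>0"
    unfolding disk_bundle_def tnorm_chart_point[OF c z, symmetric] by (simp add: case_prod_unfold)
  then show ?thesis using in_disk_iff[OF sq_nonneg[OF c z]] by simp
qed

lemma sq_continuous: "c \<in> A \<Longrightarrow> continuous_on (snd c ` fst c \<times> UNIV) (sq c)"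
  using metric_continuous_pair[of c "snd c ` fst c" UNIV] by (simp add: sq_def[abs_def])

sublocale bundle_domain A g W
proof
  show "W \<subseteq> total_space A" by (auto simp: disk_bundle_def)
  fix c assume c: "c \<in> A"
  have "open ((snd c ` fst c \<times> UNIV) \<inter> (\<lambda>z. c\<^sub>1 + K * sq c z) -` {0<..})"
    by (intro continuous_open_preimage continuous_intros sq_continuous c open_Times chart_open) auto
  moreover have "(snd c ` fst c \<times> UNIV) \<inter> (\<lambda>z. c\<^sub>1 + K * sq c z) -` {0<..} =
     {z. fst z \<in> snd c ` fst c \<and> chart_point c z \<in> W}"
    using chart_point_disk[OF c] by (auto simp: mem_Times_iff)
  ultimately show "open {z. fst z \<in> snd c ` fst c \<and> chart_point c z \<in> W}" by simp
qed

lemma chart_image_iff: "c \<in> A \<Longrightarrow> z \<in> chart_image c \<longleftrightarrow> fst z \<in> snd c ` fst c \<and> c\<^sub>1 + K * sq c z > 0"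
  unfolding chart_image_def using chart_point_disk by blast

lemma scale_pos: "c \<in> A \<Longrightarrow> z \<in> chart_image c \<Longrightarrow> scale c z > 0"
  by (simp add: scale_def chart_image_iff)

text \<open>The connection map in coordinates; its kernel is the horizontal space.\<close>

definition vert :: "('a, 'b) chart \<Rightarrow> 'b \<times> 'b \<Rightarrow> 'b \<times> 'b \<Rightarrow> 'b" where
  "vert c z h = snd h + \<Gamma> c (fst z) (fst h) (snd z)"

lemma GW_chart:
  assumes c: "c \<in> A" and z: "z \<in> chart_image c"
  shows "GB (bc c) z h h' =
    scale c z * G c (fst z) (fst h) (fst h') + 1 / scale c z * G c (fst z) (vert c z h) (vert c z h')"
proof -
  have zi: "fst z \<in> snd c ` fst c" using z by (simp add: chart_image_def)
  have "sqrt (c\<^sub>1 + K * (tnorm g (fst (chart_inv (bc c) z)) (snd (chart_inv (bc c) z)))\<^sup>2) = scale c z"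
    by (simp add: chart_inv_bc[OF c z] tnorm_chart_point[OF c zi] sq_nonneg[OF c zi] scale_def)
  then have "GB (bc c) z h h' =
      scale c z * metric_in_chart BA (hor_pullback A g W) (bc c) z h h' +
      1 / scale c z * metric_in_chart BA (vert_pullback A g W) (bc c) z h h'"
    unfolding metric_in_chart_def disk_bundle_metric_def Let_def by simp
  then show ?thesis unfolding pullbacks_chart[OF c z] vert_def .
qed

lemma vert_linear: "c \<in> A \<Longrightarrow> z \<in> chart_image c \<Longrightarrow> linear (vert c z)"
  unfolding vert_def chart_image_def
  by (intro linearI) (auto simp: algebra_simps bilinear_ladd[OF christoffel_bilinear] bilinear_lmul[OF christoffel_bilinear])

lemma vert_continuous:
  assumes c: "c \<in> A"
  shows "continuous_on (chart_image c) (\<lambda>z. vert c z h)"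
  unfolding vert_def
proof (rule continuous_on_add[OF continuous_on_const])
  show "continuous_on (chart_image c) (\<lambda>z. \<Gamma> c (fst z) (fst h) (snd z))"
  proof (rule continuous_on_bilinear_family[where B = "\<lambda>z. \<Gamma> c (fst z)"])
    show "bilinear (\<Gamma> c (fst z))" if "z \<in> chart_image c" for z
      using that by (intro christoffel_bilinear[OF c]) (simp add: chart_image_def)
    show "continuous_on (chart_image c) (\<lambda>z. \<Gamma> c (fst z) v w)" for v w
      by (rule continuous_on_compose2[OF christoffel_continuous[OF c]])
         (auto intro!: continuous_intros simp: chart_image_def)
  qed (intro continuous_intros)+
qed

lemma G_fst_continuous:
  assumes c: "c \<in> A"
  shows "continuous_on (chart_image c) (\<lambda>z. G c (fst z) v w)"
  by (rule continuous_on_compose2[OF metric_continuous[OF c]])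
     (auto intro!: continuous_intros simp: chart_image_def)

lemma GW_bilinear:
  assumes c: "c \<in> A" and z: "z \<in> chart_image c"
  shows "bilinear (GB (bc c) z)"
proof -
  have "fst z \<in> snd c ` fst c" using z by (simp add: chart_image_def)
  note B = metric_bilinear[OF c this]
  note V = vert_linear[OF c z]
  show ?thesis
    unfolding bilinear_def GW_chart[OF c z]
    by (intro conjI allI linearI) (simp_all add: linear_add[OF V] linear_scale[OF V] bilinear_ladd[OF B]
        bilinear_radd[OF B] bilinear_lmul[OF B] bilinear_rmul[OF B] algebra_simps add_divide_distrib)
qed

text \<open>Each bound drops one nonnegative summand. The first serves the projection to the base;
  the second, cleared of the division by \<open>scale\<close>, serves the derivative of the fibre
  norm.\<close>

lemma GW_bounds:
  assumes c: "c \<in> A" and z: "z \<in> chart_image c"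
  shows "scale c z * G c (fst z) (fst h) (fst h) \<le> GB (bc c) z h h"
    and "G c (fst z) (vert c z h) (vert c z h) \<le> scale c z * GB (bc c) z h h"
proof -
  have y: "fst z \<in> snd c ` fst c" using z by (simp add: chart_image_def)
  note s = scale_pos[OF c z]
  have nn: "G c (fst z) v v \<ge> 0" for v by (rule metric_nonneg[OF c y])
  show "scale c z * G c (fst z) (fst h) (fst h) \<le> GB (bc c) z h h"
    unfolding GW_chart[OF c z] using nn s by simp
  have "scale c z * GB (bc c) z h h =
     scale c z * scale c z * G c (fst z) (fst h) (fst h) + G c (fst z) (vert c z h) (vert c z h)"
    unfolding GW_chart[OF c z] using s by (simp add: field_simps)
  then show "G c (fst z) (vert c z h) (vert c z h) \<le> scale c z * GB (bc c) z h h"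
    using nn s by simp
qed

sublocale BM: C0_metric BA GW
proof
  fix C z h h' assume "C \<in> BA"
  then obtain c where c: "c \<in> A" "C = bc c" by (auto simp: bundle_atlas_def)
  note img = bc_image[OF c(1)]
  have "continuous_on (chart_image c) (\<lambda>z. scale c z * G c (fst z) (fst h) (fst h') +
      1 / scale c z * G c (fst z) (vert c z h) (vert c z h'))"
  proof (intro continuous_on_add continuous_on_mult continuous_on_divide continuous_on_const G_fst_continuous c)
    show "continuous_on (chart_image c) (scale c)"
      unfolding scale_def
      by (intro continuous_intros continuous_on_subset[OF sq_continuous[OF c(1)]])
         (auto simp: chart_image_def mem_Times_iff)
    then show "continuous_on (chart_image c) (scale c)" .
    show "\<forall>z\<in>chart_image c. scale c z \<noteq> 0" using scale_pos[OF c(1)] by force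
    show "continuous_on (chart_image c) (\<lambda>z. G c (fst z) (vert c z h) (vert c z h'))"
      by (rule continuous_on_bilinear_family[where B = "\<lambda>z. G c (fst z)"])
         (rule metric_bilinear[OF c(1)] G_fst_continuous[OF c(1)] vert_continuous[OF c(1)] | simp add: chart_image_def)+
  qed
  then show "continuous_on (snd C ` fst C) (\<lambda>z. GB C z h h')"
    unfolding c(2) img by (rule continuous_on_eq) (simp add: GW_chart[OF c(1)])
  assume "z \<in> snd C ` fst C"
  then have z: "z \<in> chart_image c" unfolding c(2) img .
  have y: "fst z \<in> snd c ` fst c" using z by (simp add: chart_image_def)
  show "bilinear (GB C z)" unfolding c(2) by (rule GW_bilinear[OF c(1) z])
  assume h: "h \<noteq> 0"
  note s = scale_pos[OF c(1) z]
  show "GB C z h h > 0"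
  proof (cases "fst h = 0")
    case False
    then have "0 < scale c z * G c (fst z) (fst h) (fst h)" using metric_pos[OF c(1) y] s by simp
    then show ?thesis using GW_bounds(1)[OF c(1) z, of h] c(2) by simp
  next
    case True
    \<comment> \<open>A vector with zero base component is vertical, and the Christoffel term
      vanishes with it, so the second summand detects it.\<close>
    then have "vert c z h = snd h" by (simp add: vert_def bilinear_lzero[OF christoffel_bilinear[OF c(1) y]])
    moreover have "snd h \<noteq> 0" using h True by (simp add: prod_eq_iff)
    ultimately have "0 < scale c z * GB C z h h"
      using metric_pos[OF c(1) y, of "snd h"] GW_bounds(2)[OF c(1) z, of h] c(2) by simp
    then show ?thesis using s by (simp add: zero_less_mult_iff)
  qed
qed

section \<open>Joining points of the disk bundle by paths\<close>

lemma zero_in_disk: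
  assumes p: "p \<in> manifold_points A"
  shows "(p, \<lambda>_. 0) \<in> W"
proof -
  obtain c where c: "c \<in> A" "p \<in> fst c" using p by (auto simp: manifold_points_def)
  have y: "snd c p \<in> snd c ` fst c" using c by blast
  have "chart_point c (snd c p, 0) = (p, \<lambda>_. 0)"
    using chart_vec_of_tangent[OF c zero_tangent] by (simp add: chart_point_def chart_inv_chart[OF c])
  moreover have "chart_point c (snd c p, 0) \<in> W"
    using chart_point_disk[OF c(1), of "(snd c p, 0)"] y c\<^sub>1
    by (simp add: sq_def bilinear_lzero[OF metric_bilinear[OF c(1) y]])
  ultimately show ?thesis by simp
qed

text \<open>The zero section lies in the disk bundle for either sign of \<open>K\<close>, so it
  carries base paths into the bundle with no need to control a fibre norm.\<close>

lemma zero_section_path: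
  assumes \<gamma>: "piecewise_C1_path A \<gamma>"
  shows "piecewise_C1_path BA (\<lambda>t. (\<gamma> t, \<lambda>_. 0))"
proof -
  let ?o = "\<lambda>p. (p, \<lambda>_. 0) :: 'a \<times> ('a, 'b) tvec"
  obtain S where S: "pathin (atlas_topology A) \<gamma>" "finite S" "C1_off A S \<gamma>"
    using \<gamma> by (auto simp: piecewise_C1_path_iff)
  have "continuous_map (atlas_topology A) (atlas_topology BA) ?o"
    unfolding atlas_topology_def[of BA] continuous_on_generated_topo_iff BA.Union_chart_preimages
  proof (intro conjI allI impI)
    show "?o ` topspace (atlas_topology A) \<subseteq> manifold_points BA"
      using zero_in_disk by (auto simp: bundle_points topspace_atlas)
    fix U assume "U \<in> {fst C \<inter> snd C -` B |C B. C \<in> BA \<and> open B}"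
    then obtain C B where "C \<in> BA" and B: "open B" "U = fst C \<inter> snd C -` B" by blast
    then obtain c where c: "c \<in> A" "open B" "U = fst (bc c) \<inter> snd (bc c) -` B"
      unfolding bundle_atlas_def by blast
    have "?o -` U \<inter> topspace (atlas_topology A) = fst c \<inter> snd c -` ((\<lambda>y. (y, 0)) -` B)"
      using zero_in_disk in_manifold[OF c(1)] by (auto simp: c fst_bc snd_bc topspace_atlas)
    moreover have "open ((\<lambda>y::'b. (y, 0::'b)) -` B)" by (intro open_vimage c continuous_intros)
    ultimately show "openin (atlas_topology A) (?o -` U \<inter> topspace (atlas_topology A))"
      using chart_preimage_open[OF c(1)] by simp
  qed
  from pathin_compose[OF S(1) this] have path: "pathin (atlas_topology BA) (\<lambda>t. ?o (\<gamma> t))" by (simp add: o_def)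
  have "C1_off BA S (\<lambda>t. ?o (\<gamma> t))"
    unfolding C1_off_def
  proof (intro ballI allI impI, elim conjE)
    fix C and a b :: real
    assume "C \<in> BA" and ab: "0 \<le> a" "a < b" "b \<le> 1" "{a<..<b} \<inter> S = {}" "(\<lambda>t. ?o (\<gamma> t)) ` {a..b} \<subseteq> fst C"
    then obtain c where c: "c \<in> A" "C = bc c" by (auto simp: bundle_atlas_def)
    have "\<gamma> ` {a..b} \<subseteq> fst c" using ab(5) by (auto simp: c fst_bc)
    then obtain D where D: "continuous_on {a..b} D"
        "\<And>t. t \<in> {a..b} \<Longrightarrow> ((snd c \<circ> \<gamma>) has_vector_derivative D t) (at t within {a..b})"
      using S(3) c(1) ab unfolding C1_off_def by meson
    have "continuous_on {a..b} (\<lambda>t. (D t, 0::'b))" by (intro continuous_intros D)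
    moreover have "((snd C \<circ> (\<lambda>t. ?o (\<gamma> t))) has_vector_derivative (D t, 0)) (at t within {a..b})"
      if "t \<in> {a..b}" for t
      using has_vector_derivative_Pair[OF D(2)[OF that] has_vector_derivative_const[of 0]]
      by (simp add: c snd_bc o_def)
    ultimately show "\<exists>D. continuous_on {a..b} D \<and> (\<forall>t\<in>{a..b}.
       ((snd C \<circ> (\<lambda>t. ?o (\<gamma> t))) has_vector_derivative D t) (at t within {a..b}))" by blast
  qed
  with path S(2) show ?thesis unfolding piecewise_C1_path_iff by blast
qed

text \<open>Each fibre is a disk and hence star-shaped about its centre.\<close>

lemma fibre_path:
  assumes e: "e \<in> W"
  shows "\<exists>\<gamma>. piecewise_C1_path BA \<gamma> \<and> \<gamma> 0 = e \<and> \<gamma> 1 = (fst e, \<lambda>_. 0)"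
proof -
  obtain c where c: "c \<in> A" "fst e \<in> fst c" using W_base[OF e] by (auto simp: manifold_points_def)
  let ?y = "snd c (fst e)" let ?x = "snd e c"
  have y: "?y \<in> snd c ` fst c" using c by blast
  have img: "(?y, ?x) \<in> chart_image c" using bc_in_image[OF c(1) e c(2)] by (simp add: snd_bc)
  have seg: "closed_segment (?y, ?x) (?y, 0) \<subseteq> chart_image c"
  proof
    fix z assume "z \<in> closed_segment (?y, ?x) (?y, 0)"
    then obtain u where u: "0 \<le> u" "u \<le> 1" "z = (1 - u) *\<^sub>R (?y, ?x) + u *\<^sub>R (?y, 0)"
      by (auto simp: closed_segment_def)
    then have z: "z = (?y, (1 - u) *\<^sub>R ?x)" by (simp add: algebra_simps)
    have "sq c z = (1 - u)\<^sup>2 * sq c (?y, ?x)" by (simp add: z sq_def metric_scale[OF c(1) y])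
    moreover have "c\<^sub>1 + K * sq c (?y, ?x) > 0" using img chart_image_iff[OF c(1)] by blast
    \<comment> \<open>The radicand along the segment is a convex combination, with weight
      \<open>(1 - u)\<^sup>2\<close>, of its values at the given vector and at the centre. Both are
      positive whatever the sign of \<open>K\<close>.\<close>
    then have "(1 - u)\<^sup>2 * (c\<^sub>1 + K * sq c (?y, ?x)) + (1 - (1 - u)\<^sup>2) * c\<^sub>1 > 0"
      using u c\<^sub>1 by (cases "u = 1") (auto intro!: add_pos_nonneg mult_pos_pos simp: power_le_one)
    ultimately have "c\<^sub>1 + K * sq c z > 0" by (simp add: algebra_simps)
    then show "z \<in> chart_image c" using y chart_image_iff[OF c(1)] by (simp add: z)
  qed
  have "chart_inv (bc c) (?y, ?x) = e"
    using chart_inv_bc[OF c(1) img] chart_point_bc[OF c(1) e c(2)] by (simp add: snd_bc)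
  moreover have "chart_inv (bc c) (?y, 0) = (fst e, \<lambda>_. 0)"
  proof -
    have "(?y, 0) \<in> chart_image c" using seg by auto
    then show ?thesis
      using chart_inv_bc[OF c(1)] chart_vec_of_tangent[OF c zero_tangent] by (simp add: chart_point_def chart_inv_chart[OF c])
  qed
  ultimately show ?thesis
    using BM.chart_segment_path[OF bc_in_atlas[OF c(1)], of "(?y, ?x)" "(?y, 0)"] seg
    by (metis bc_image[OF c(1)])
qed

text \<open>Two points are joined down one fibre, along the zero section, and up the other
  fibre.\<close>

sublocale BM: joined_metric BA GW
proof
  fix e e' assume "e \<in> manifold_points BA" "e' \<in> manifold_points BA"
  then have e: "e \<in> W" "e' \<in> W" by (simp_all add: bundle_points)
  obtain \<gamma>1 where 1: "piecewise_C1_path BA \<gamma>1" "\<gamma>1 0 = e" "\<gamma>1 1 = (fst e, \<lambda>_. 0)" using fibre_path[OF e(1)] by blast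
  obtain \<gamma>3 where 3: "piecewise_C1_path BA \<gamma>3" "\<gamma>3 0 = e'" "\<gamma>3 1 = (fst e', \<lambda>_. 0)" using fibre_path[OF e(2)] by blast
  obtain \<gamma> where \<gamma>: "piecewise_C1_path A \<gamma>" "\<gamma> 0 = fst e" "\<gamma> 1 = fst e'"
    using joined[OF W_base[OF e(1)] W_base[OF e(2)]] by blast
  let ?\<gamma>2 = "\<lambda>t. (\<gamma> t, \<lambda>_. 0) :: 'a \<times> ('a, 'b) tvec" and ?\<gamma>3 = "\<lambda>t. \<gamma>3 (1 - t)"
  have j: "piecewise_C1_path BA (path_join \<gamma>1 ?\<gamma>2)"
    by (rule BM.piecewise_C1_join(1)[OF 1(1) zero_section_path[OF \<gamma>(1)]]) (simp add: 1 \<gamma>)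
  have "piecewise_C1_path BA (path_join (path_join \<gamma>1 ?\<gamma>2) ?\<gamma>3)"
    by (rule BM.piecewise_C1_join(1)[OF j BM.piecewise_C1_reverse(1)[OF 3(1)]]) (simp add: path_join_def 3 \<gamma>)
  then show "\<exists>\<gamma>. piecewise_C1_path BA \<gamma> \<and> \<gamma> 0 = e \<and> \<gamma> 1 = e'"
    by (intro exI[of _ "path_join (path_join \<gamma>1 ?\<gamma>2) ?\<gamma>3"]) (simp add: path_join_def 1 3)
qed

text \<open>The squared norm is differentiable on the zero section, where the norm is not. The
  logarithm offsets the weakening of the fibre part of the metric at large norm when
  \<open>K\<close> is positive.\<close>

definition log_norm :: "'a \<times> ('a, 'b) tvec \<Rightarrow> real" where
  "log_norm e = ln (1 + (tnorm g (fst e) (snd e))\<^sup>2)"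

lemma has_derivative_sq:
  assumes c: "c \<in> A" and z: "z \<in> chart_image c"
  shows "(sq c has_derivative (\<lambda>h. 2 * G c (fst z) (vert c z h) (snd z))) (at z)"
proof -
  have y: "fst z \<in> snd c ` fst c" if "z \<in> chart_image c" for z using that by (simp add: chart_image_def)
  have fst: "(fst has_derivative fst) (at z)" and snd: "(snd has_derivative snd) (at z)"
    by (rule has_derivative_fst[OF has_derivative_ident] has_derivative_snd[OF has_derivative_ident])+
  have "((\<lambda>z. G c (fst z) (snd z) (snd z)) has_derivative
     (\<lambda>h. DG c (fst z) (fst h) (snd z) (snd z) + G c (fst z) (snd h) (snd z) + G c (fst z) (snd z) (snd h))) (at z)"
  proof (rule has_derivative_bilinear_family[where B = "\<lambda>z. G c (fst z)" and B' = "\<lambda>h. DG c (fst z) (fst h)", OF open_chart_image[OF c] z])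
    show "bilinear (G c (fst z))" if "z \<in> chart_image c" for z by (rule metric_bilinear[OF c y[OF that]])
    show "bilinear (DG c (fst z) (fst h))" for h by (rule DG_bilinear[OF c y[OF z]])
    show "((\<lambda>z. G c (fst z) v w) has_derivative (\<lambda>h. DG c (fst z) (fst h) v w)) (at z)" for v w
      using diff_chain_at[OF fst has_derivative_G[OF c y[OF z]]] by (simp add: o_def)
  qed (rule snd)+
  moreover have "DG c (fst z) (fst h) (snd z) (snd z) + G c (fst z) (snd h) (snd z) + G c (fst z) (snd z) (snd h) =
     2 * G c (fst z) (vert c z h) (snd z)" for h
    using christoffel_compat[OF c y[OF z], of "fst h" "snd z" "snd z"]
      metric_chart_sym[OF c y[OF z], of "snd z"]
    by (simp add: vert_def bilinear_ladd[OF metric_bilinear[OF c y[OF z]]])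
  ultimately show ?thesis by (simp add: sq_def[abs_def])
qed

text \<open>Combines \<open>\<bar>vert\<bar>\<^sup>2 \<le> s \<bar>h\<bar>\<^sup>2\<close> with \<open>s \<le> sqrt (c\<^sub>1 + \<bar>K\<bar>) (1 + r\<^sup>2)\<close>.\<close>

lemma log_norm_Lipschitz: "BM.Lipschitz_differential log_norm (2 * sqrt (sqrt (c\<^sub>1 + \<bar>K\<bar>)))"
  unfolding BM.Lipschitz_differential_def
proof
  fix e assume "e \<in> manifold_points BA"
  then have e: "e \<in> W" by (simp add: bundle_points)
  obtain c where c: "c \<in> A" "fst e \<in> fst c" using W_base[OF e] by (auto simp: manifold_points_def)
  let ?z = "snd (bc c) e" and ?C0 = "sqrt (c\<^sub>1 + \<bar>K\<bar>)"
  have z: "?z \<in> chart_image c" by (rule bc_in_image[OF c(1) e c(2)])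
  have y: "fst ?z \<in> snd c ` fst c" using z by (simp add: chart_image_def)
  let ?q = "sq c ?z"
  let ?F' = "\<lambda>h. 2 * G c (fst ?z) (vert c ?z h) (snd ?z) / (1 + ?q)"
  have q: "?q \<ge> 0" by (rule sq_nonneg[OF c(1) y])
  have "((\<lambda>z. ln (1 + sq c z)) has_derivative ?F') (at ?z)"
    using q by (auto intro!: derivative_eq_intros has_derivative_sq[OF c(1) z] simp: fun_eq_iff field_simps)
  then have der: "((log_norm \<circ> chart_inv (bc c)) has_derivative ?F') (at ?z)"
  proof (rule has_derivative_transform_within_open[OF _ open_chart_image[OF c(1)] z])
    fix x assume x: "x \<in> chart_image c"
    then have "fst x \<in> snd c ` fst c" by (simp add: chart_image_def)
    then show "ln (1 + sq c x) = (log_norm \<circ> chart_inv (bc c)) x"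
      by (simp add: log_norm_def chart_inv_bc[OF c(1) x] tnorm_chart_point[OF c(1)] sq_nonneg[OF c(1)])
  qed
  have le: "\<bar>?F' h\<bar> \<le> 2 * sqrt ?C0 * sqrt (GB (bc c) ?z h h)" for h
  proof -
    let ?m = "GB (bc c) ?z h h" and ?B = "G c (fst ?z)" and ?v = "vert c ?z h"
    have C0: "?C0 \<ge> 0" using c\<^sub>1 by simp
    have s: "scale c ?z \<ge> 0" using scale_pos[OF c(1) z] by simp
    have B: "?B ?v ?v \<le> scale c ?z * ?m" by (rule GW_bounds(2)[OF c(1) z])
    have Bnn: "?B ?v ?v \<ge> 0" by (rule metric_nonneg[OF c(1) y])
    have m: "?m \<ge> 0" using BM.metric_nonneg[OF bc_in_atlas[OF c(1)]] bc_image[OF c(1)] z by simp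
    \<comment> \<open>The absolute value makes the estimate independent of the sign of
      \<open>K\<close>. The factor \<open>1 + ?q\<close> is then squared so that it survives the
      square root.\<close>
    have "K * ?q \<le> \<bar>K\<bar> * ?q" using q by (intro mult_right_mono) auto
    then have "c\<^sub>1 + K * ?q \<le> (c\<^sub>1 + \<bar>K\<bar>) * (1 + ?q)" using q c\<^sub>1
      by (simp add: algebra_simps) (smt (verit) mult_nonneg_nonneg)
    also have "\<dots> \<le> (c\<^sub>1 + \<bar>K\<bar>) * (1 + ?q)\<^sup>2" using q c\<^sub>1 by (intro mult_left_mono) (auto simp: power2_eq_square)
    finally have "scale c ?z \<le> sqrt ((c\<^sub>1 + \<bar>K\<bar>) * (1 + ?q)\<^sup>2)" unfolding scale_def by simp
    then have sle: "scale c ?z \<le> ?C0 * (1 + ?q)" using q by (simp add: real_sqrt_mult)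
    \<comment> \<open>Of the two factors \<open>1 + ?q\<close> gained after Cauchy-Schwarz, one
      bounds \<open>scale\<close> and the other bounds \<open>?q\<close>; together they cancel the
      squared denominator of the logarithmic derivative.\<close>
    have "(?B ?v (snd ?z))\<^sup>2 \<le> ?B ?v ?v * ?q"
      unfolding sq_def
      by (rule bilinear_Cauchy_Schwarz[OF metric_bilinear[OF c(1) y] metric_chart_sym[OF c(1) y] metric_pos[OF c(1) y]])
    also have "\<dots> \<le> (scale c ?z * ?m) * ?q" using B q by (intro mult_right_mono) auto
    also have "\<dots> \<le> (?C0 * (1 + ?q) * ?m) * (1 + ?q)"
      using sle m q C0 s by (intro mult_mono) auto
    also have "\<dots> = (?C0 * ?m) * (1 + ?q)\<^sup>2" by (simp add: power2_eq_square algebra_simps)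
    finally have "(?B ?v (snd ?z) / (1 + ?q))\<^sup>2 \<le> ?C0 * ?m"
      using q by (simp add: power_divide pos_divide_le_eq)
    then have "sqrt ((?B ?v (snd ?z) / (1 + ?q))\<^sup>2) \<le> sqrt (?C0 * ?m)" by (rule real_sqrt_le_mono)
    then have "\<bar>?B ?v (snd ?z) / (1 + ?q)\<bar> \<le> sqrt ?C0 * sqrt ?m" by (simp add: real_sqrt_mult)
    moreover have "?F' h = 2 * (?B ?v (snd ?z) / (1 + ?q))" by simp
    ultimately show ?thesis by (simp add: abs_mult)
  qed
  show "\<exists>C\<in>BA. e \<in> fst C \<and> (\<exists>F'. ((log_norm \<circ> chart_inv C) has_derivative F') (at (snd C e)) \<and>
           (\<forall>v. \<bar>F' v\<bar> \<le> 2 * sqrt ?C0 * sqrt (GB C (snd C e) v v)))"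
    by (intro bexI[of _ "bc c"] conjI exI[of _ ?F'] allI der le bc_in_atlas c(1)) (use c(2) e in \<open>simp add: fst_bc\<close>)
qed

lemma log_norm_dist:
  "\<exists>C>0. \<forall>e\<in>W. \<forall>e'\<in>W. \<bar>log_norm e - log_norm e'\<bar> \<le> C * BM.d e e'"
  using BM.Lipschitz_dist[OF log_norm_Lipschitz] c\<^sub>1
  by (intro exI[of _ "2 * sqrt (sqrt (c\<^sub>1 + \<bar>K\<bar>))"]) (simp add: bundle_points add_pos_nonneg)

section \<open>The projection to the base\<close>

lemma projection_path:
  assumes \<gamma>: "piecewise_C1_path BA \<gamma>" and K: "K \<ge> 0"
  shows "piecewise_C1_path A (fst \<circ> \<gamma>)"
    and "riemannian_length A g (fst \<circ> \<gamma>) \<le> sqrt (1 / sqrt c\<^sub>1) * riemannian_length BA GW \<gamma>"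
proof -
  obtain S where S: "pathin (atlas_topology BA) \<gamma>" "finite S" "C1_off BA S \<gamma>"
    using \<gamma> by (auto simp: piecewise_C1_path_iff)
  have path: "pathin (atlas_topology A) (fst \<circ> \<gamma>)"
    by (rule pathin_compose[OF S(1) continuous_projection])
  have in_W: "\<gamma> t \<in> W" if "t \<in> {0..1}" for t using BA.path_in_manifold[OF S(1) that] by (simp add: bundle_points)
  have proj: "snd c \<circ> (fst \<circ> \<gamma>) = fst \<circ> (snd (bc c) \<circ> \<gamma>)" for c by (simp add: fun_eq_iff snd_bc)
  have proj': "((snd c \<circ> (fst \<circ> \<gamma>)) has_vector_derivative fst v) F"
    if "((snd (bc c) \<circ> \<gamma>) has_vector_derivative v) F" for c v F
    unfolding proj using has_derivative_fst[OF that[unfolded has_vector_derivative_def]]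
    by (simp add: has_vector_derivative_def o_def)
  have off: "C1_off A S (fst \<circ> \<gamma>)"
    unfolding C1_off_def
  proof (intro ballI allI impI, elim conjE)
    fix c and a b :: real
    assume c: "c \<in> A" and ab: "0 \<le> a" "a < b" "b \<le> 1" "{a<..<b} \<inter> S = {}" "(fst \<circ> \<gamma>) ` {a..b} \<subseteq> fst c"
    have "\<gamma> ` {a..b} \<subseteq> fst (bc c)" using ab in_W by (auto simp: fst_bc image_subset_iff)
    then obtain D where D: "continuous_on {a..b} D"
        "\<And>t. t \<in> {a..b} \<Longrightarrow> ((snd (bc c) \<circ> \<gamma>) has_vector_derivative D t) (at t within {a..b})"
      using S(3) bc_in_atlas[OF c] ab unfolding C1_off_def by meson
    have "continuous_on {a..b} (\<lambda>t. fst (D t))" by (intro continuous_intros D)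
    moreover have "((snd c \<circ> (fst \<circ> \<gamma>)) has_vector_derivative fst (D t)) (at t within {a..b})"
      if "t \<in> {a..b}" for t by (rule proj'[OF D(2)[OF that]])
    ultimately show "\<exists>D. continuous_on {a..b} D \<and> (\<forall>t\<in>{a..b}.
       ((snd c \<circ> (fst \<circ> \<gamma>)) has_vector_derivative D t) (at t within {a..b}))" by blast
  qed
  show *: "piecewise_C1_path A (fst \<circ> \<gamma>)"
    unfolding piecewise_C1_path_iff by (intro conjI exI[of _ S] path S(2) off)
  \<comment> \<open>The projection enlarges the squared speed by at most
    \<open>1 / sqrt c\<^sub>1\<close>, the reciprocal of the lower bound on \<open>scale\<close>;
    lengths take the square root of that factor.\<close>
  show "riemannian_length A g (fst \<circ> \<gamma>) \<le> sqrt (1 / sqrt c\<^sub>1) * riemannian_length BA GW \<gamma>"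
  proof (rule has_integral_le_off_finite[OF has_integral_speed[OF *] has_integral_mult_right[OF BM.has_integral_speed[OF \<gamma>]] S(2)])
    fix t assume t: "t \<in> {0<..<1} - S"
    then have t': "t \<in> {0<..<1}" "\<gamma> t \<in> W" using in_W[of t] by auto
    obtain c where c: "c \<in> A" "fst (\<gamma> t) \<in> fst c" using W_base[OF t'(2)] by (auto simp: manifold_points_def)
    have bcm: "bc c \<in> BA" "\<gamma> t \<in> fst (bc c)" using c t'(2) by (simp_all add: bc_in_atlas fst_bc)
    let ?v = "velocity BA \<gamma> t (bc c)" and ?z = "snd (bc c) (\<gamma> t)"
    have v: "((snd (bc c) \<circ> \<gamma>) has_vector_derivative ?v) (at t)"
      by (rule BA.velocity_component[OF S(1,3,2) t bcm])
    have z: "?z \<in> chart_image c" by (rule bc_in_image[OF c(1) t'(2) c(2)])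
    have y: "fst ?z \<in> snd c ` fst c" using z by (simp add: chart_image_def)
    have "speed A g (fst \<circ> \<gamma>) t = sqrt (G c (fst ?z) (fst ?v) (fst ?v))"
      using speed_chart[OF path t'(1) c(1) _ proj'[OF v]] c(2) by (simp add: snd_bc)
    also have "G c (fst ?z) (fst ?v) (fst ?v) \<le> 1 / sqrt c\<^sub>1 * GB (bc c) ?z ?v ?v"
    proof -
      have "sqrt c\<^sub>1 \<le> scale c ?z" unfolding scale_def using K sq_nonneg[OF c(1) y] by simp
      then have "sqrt c\<^sub>1 * G c (fst ?z) (fst ?v) (fst ?v) \<le> scale c ?z * G c (fst ?z) (fst ?v) (fst ?v)"
        by (rule mult_right_mono) (rule metric_nonneg[OF c(1) y])
      also note GW_bounds(1)[OF c(1) z, of ?v]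
      finally show ?thesis using c\<^sub>1 by (simp add: field_simps)
    qed
    then have "sqrt (G c (fst ?z) (fst ?v) (fst ?v)) \<le> sqrt (1 / sqrt c\<^sub>1 * GB (bc c) ?z ?v ?v)"
      by (rule real_sqrt_le_mono)
    also have "\<dots> = sqrt (1 / sqrt c\<^sub>1) * speed BA GW \<gamma> t"
      unfolding BM.speed_chart[OF S(1) t'(1) bcm v] by (rule real_sqrt_mult)
    finally show "speed A g (fst \<circ> \<gamma>) t \<le> sqrt (1 / sqrt c\<^sub>1) * speed BA GW \<gamma> t" .
  qed
qed

lemma projection_dist:
  assumes K: "K \<ge> 0" and e: "e \<in> W" "e' \<in> W"
  shows "d (fst e) (fst e') \<le> sqrt (1 / sqrt c\<^sub>1) * BM.d e e'"
proof -
  have pos: "sqrt (1 / sqrt c\<^sub>1) > 0" using c\<^sub>1 by simp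
  have "d (fst e) (fst e') / sqrt (1 / sqrt c\<^sub>1) \<le> BM.d e e'"
  proof (rule BM.dist_geI)
    fix \<gamma> assume \<gamma>: "piecewise_C1_path BA \<gamma>" "\<gamma> 0 = e" "\<gamma> 1 = e'"
    have "d (fst e) (fst e') \<le> riemannian_length A g (fst \<circ> \<gamma>)"
      by (rule dist_le_length[OF projection_path(1)[OF \<gamma>(1) K]]) (simp_all add: \<gamma>)
    also have "\<dots> \<le> sqrt (1 / sqrt c\<^sub>1) * riemannian_length BA GW \<gamma>" by (rule projection_path(2)[OF \<gamma>(1) K])
    finally show "d (fst e) (fst e') / sqrt (1 / sqrt c\<^sub>1) \<le> riemannian_length BA GW \<gamma>"
      using pos by (simp add: pos_divide_le_eq mult.commute del: real_sqrt_divide)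
  qed (simp_all add: bundle_points e)
  then show ?thesis using pos by (simp add: pos_divide_le_eq mult.commute del: real_sqrt_divide)
qed

section \<open>Nonnegative curvature: convergence of Cauchy sequences\<close>

lemma bundle_complete:
  assumes K: "K \<ge> 0" and complete: "mcomplete"
  shows "BM.mcomplete"
  unfolding BM.mcomplete_def
proof (intro allI impI)
  fix \<sigma> assume \<sigma>: "BM.MCauchy \<sigma>"
  have in_W: "\<sigma> n \<in> W" for n using \<sigma> unfolding BM.MCauchy_def unfolding bundle_points by blast
  have cau: "\<exists>N. \<forall>n n'. N \<le> n \<longrightarrow> N \<le> n' \<longrightarrow> BM.d (\<sigma> n) (\<sigma> n') < \<epsilon>" if "\<epsilon> > 0" for \<epsilon>
    using \<sigma> that unfolding BM.MCauchy_def by blast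
  let ?k = "sqrt (1 / sqrt c\<^sub>1)"
  have k: "?k > 0" using c\<^sub>1 by simp
  have "MCauchy (fst \<circ> \<sigma>)"
    unfolding MCauchy_def
  proof (intro conjI allI impI)
    show "range (fst \<circ> \<sigma>) \<subseteq> M" using W_base[OF in_W] by auto
    fix \<epsilon> :: real assume "\<epsilon> > 0"
    then obtain N where N: "\<And>n n'. N \<le> n \<Longrightarrow> N \<le> n' \<Longrightarrow> BM.d (\<sigma> n) (\<sigma> n') < \<epsilon> / ?k"
      using cau[of "\<epsilon> / ?k"] k by (metis divide_pos_pos)
    have "d ((fst \<circ> \<sigma>) n) ((fst \<circ> \<sigma>) n') < \<epsilon>" if "N \<le> n" "N \<le> n'" for n n'
    proof -
      have "d (fst (\<sigma> n)) (fst (\<sigma> n')) \<le> ?k * BM.d (\<sigma> n) (\<sigma> n')"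
        by (rule projection_dist[OF K in_W in_W])
      also have "\<dots> < ?k * (\<epsilon> / ?k)" by (rule mult_strict_left_mono[OF N[OF that] k])
      also have "\<dots> = \<epsilon>" using k by (metis less_numeral_extra(3) nonzero_mult_div_cancel_left times_divide_eq_right)
      finally show ?thesis by simp
    qed
    then show "\<exists>N. \<forall>n n'. N \<le> n \<longrightarrow> N \<le> n' \<longrightarrow> d ((fst \<circ> \<sigma>) n) ((fst \<circ> \<sigma>) n') < \<epsilon>" by blast
  qed
  then obtain p where "limitin mtopology (fst \<circ> \<sigma>) p sequentially" using complete unfolding mcomplete_def by blast
  then have p: "p \<in> M" and lim: "\<And>\<epsilon>. \<epsilon> > 0 \<Longrightarrow> \<forall>\<^sub>F n in sequentially. fst (\<sigma> n) \<in> M \<and> d (fst (\<sigma> n)) p < \<epsilon>"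
    by (auto simp: limitin_metric)
  obtain c where c: "c \<in> A" "p \<in> fst c" using p by (auto simp: manifold_points_def)
  obtain r where r: "r > 0" "cball (snd c p) r \<subseteq> snd c ` fst c"
    using chart_open[OF c(1)] c(2) by (meson imageI open_contains_cball)
  obtain \<delta> where \<delta>: "\<delta> > 0" "\<forall>q\<in>M. d p q < \<delta> \<longrightarrow> q \<in> fst c \<and> dist (snd c q) (snd c p) < r"
    using chart_near_of_dist[OF c r(1)] by blast
  obtain N1 where N1: "\<And>n. n \<ge> N1 \<Longrightarrow> fst (\<sigma> n) \<in> M \<and> d (fst (\<sigma> n)) p < \<delta>"
    using lim[OF \<delta>(1)] unfolding eventually_sequentially by blast
  have near: "fst (\<sigma> n) \<in> fst c" "dist (snd c (fst (\<sigma> n))) (snd c p) < r" if "n \<ge> N1" for n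
    using N1[OF that] \<delta>(2) commute[of p] by auto
  obtain N2 where N2: "\<And>n. n \<ge> N2 \<Longrightarrow> BM.d (\<sigma> n) (\<sigma> N2) < 1"
    using cau[of 1] by (metis order_refl zero_less_one)
  obtain C where C: "C > 0" "\<forall>e\<in>W. \<forall>e'\<in>W. \<bar>log_norm e - log_norm e'\<bar> \<le> C * BM.d e e'"
    using log_norm_dist by blast
  \<comment> \<open>Terms within distance 1 of the \<open>N2\<close>-th change
    \<open>log_norm\<close> by at most \<open>C\<close>; exponentiating turns this into a bound on
    the squared fibre norm.\<close>
  define B where "B = exp (log_norm (\<sigma> N2) + C)"
  have tnorm_le: "(tnorm g (fst (\<sigma> n)) (snd (\<sigma> n)))\<^sup>2 \<le> B" if "n \<ge> N2" for n
  proof -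
    have "log_norm (\<sigma> n) - log_norm (\<sigma> N2) \<le> C * BM.d (\<sigma> n) (\<sigma> N2)"
      using C(2) in_W by (meson abs_le_D1)
    also have "\<dots> \<le> C" using N2[OF that] C(1) by simp
    finally have "log_norm (\<sigma> n) \<le> log_norm (\<sigma> N2) + C" by simp
    then have "exp (log_norm (\<sigma> n)) \<le> B" unfolding B_def by simp
    moreover have "exp (log_norm (\<sigma> n)) = 1 + (tnorm g (fst (\<sigma> n)) (snd (\<sigma> n)))\<^sup>2"
      unfolding log_norm_def by (rule exp_ln) (simp add: add_pos_nonneg)
    ultimately show ?thesis by simp
  qed
  obtain m M' where m: "m > 0" "\<And>y v. y \<in> cball (snd c p) r \<Longrightarrow> m * (norm v)\<^sup>2 \<le> G c y v v"
    using metric_compact_bounds[OF c(1) compact_cball r(2)] by metis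
  define N where "N = max N1 N2"
  define z where "z n = snd (bc c) (\<sigma> (n + N))" for n
  have B: "B \<ge> 0" by (simp add: B_def)
  \<comment> \<open>A compact coordinate box: the base part comes from convergence in
    \<open>M\<close>, and the fibre radius from converting the bound \<open>B\<close> with the lower
    metric bound \<open>m\<close>.\<close>
  let ?T = "cball (snd c p) r \<times> cball (0::'b) (sqrt (B / m))"
  have zT: "z n \<in> ?T" for n
  proof -
    have n: "n + N \<ge> N1" "n + N \<ge> N2" by (auto simp: N_def)
    let ?e = "\<sigma> (n + N)"
    have y: "fst (z n) \<in> cball (snd c p) r" using near(2)[OF n(1)] by (simp add: z_def snd_bc dist_commute)
    have "chart_point c (z n) = ?e" unfolding z_def by (rule chart_point_bc[OF c(1) in_W near(1)[OF n(1)]])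
    then have "sqrt (sq c (z n)) = tnorm g (fst ?e) (snd ?e)"
      using tnorm_chart_point[OF c(1) subsetD[OF r(2) y]] by simp
    moreover have "sq c (z n) \<ge> 0" by (rule sq_nonneg[OF c(1) subsetD[OF r(2) y]])
    ultimately have "sq c (z n) \<le> B" using tnorm_le[OF n(2)] by (metis real_sqrt_pow2)
    with m(2)[OF y, of "snd (z n)"] have "m * (norm (snd (z n)))\<^sup>2 \<le> B" by (simp add: sq_def)
    then have "(norm (snd (z n)))\<^sup>2 \<le> B / m" using m(1) by (simp add: field_simps)
    then have "norm (snd (z n)) \<le> sqrt (B / m)" by (rule real_le_rsqrt)
    then show ?thesis using y by (simp add: mem_Times_iff)
  qed
  have "compact ?T" by (intro compact_Times compact_cball)
  then obtain l s where l: "l \<in> ?T" and s: "strict_mono (s :: nat \<Rightarrow> nat)" and zl: "(z \<circ> s) \<longlonglongrightarrow> l"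
    using zT unfolding compact_def by blast
  have "fst l \<in> cball (snd c p) r" using l by (simp add: mem_Times_iff)
  then have l_img: "fst l \<in> snd c ` fst c" using r(2) by blast
  \<comment> \<open>For nonnegative \<open>K\<close> the radicand is positive at every vector, so
    the coordinate limit cannot leave the bundle.\<close>
  have l': "l \<in> chart_image c"
    using chart_image_iff[OF c(1)] l_img K c\<^sub>1 sq_nonneg[OF c(1) l_img] by (simp add: add_pos_nonneg)
  let ?e = "chart_point c l"
  have e: "?e \<in> fst (bc c)" "snd (bc c) ?e = l" using bc_chart_point[OF c(1) l'] by auto
  \<comment> \<open>The shift by \<open>N\<close> skips the terms not yet known to lie in the
    chart.\<close>
  let ?s = "\<lambda>n. s n + N"
  have mono: "strict_mono ?s" using s by (simp add: strict_mono_def)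
  have "limitin BM.mtopology (\<sigma> \<circ> ?s) ?e sequentially"
    unfolding BM.limitin_metric
  proof (intro conjI allI impI)
    show "?e \<in> manifold_points BA" using e(1) by (simp add: bundle_points fst_bc)
    fix \<epsilon> :: real assume "\<epsilon> > 0"
    then obtain \<delta> where \<delta>: "\<delta> > 0" "\<forall>q\<in>fst (bc c). dist (snd (bc c) q) (snd (bc c) ?e) < \<delta> \<longrightarrow> BM.d q ?e < \<epsilon>"
      using BM.dist_small_of_chart[OF bc_in_atlas[OF c(1)] e(1)] by blast
    have "\<forall>\<^sub>F n in sequentially. dist ((z \<circ> s) n) l < \<delta>" using zl \<delta>(1) by (rule tendstoD)
    then show "\<forall>\<^sub>F n in sequentially. (\<sigma> \<circ> ?s) n \<in> manifold_points BA \<and> BM.d ((\<sigma> \<circ> ?s) n) ?e < \<epsilon>"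
    proof eventually_elim
      fix n assume n: "dist ((z \<circ> s) n) l < \<delta>"
      have "\<sigma> (?s n) \<in> fst (bc c)" using in_W near(1)[of "?s n"] by (simp add: fst_bc N_def)
      then show "(\<sigma> \<circ> ?s) n \<in> manifold_points BA \<and> BM.d ((\<sigma> \<circ> ?s) n) ?e < \<epsilon>"
        using \<delta>(2) n e(2) in_W by (simp add: z_def bundle_points)
    qed
  qed
  with BM.MCauchy_convergent_subsequence[OF \<sigma> mono]
  show "\<exists>x. limitin BM.mtopology \<sigma> x sequentially" by blast
qed

section \<open>Negative curvature: a Cauchy sequence running to the boundary\<close>

lemma bundle_incomplete:
  assumes K: "K < 0" and ne: "M \<noteq> {}"
  shows "\<not> BM.mcomplete"
proof
  assume complete: "BM.mcomplete"
  obtain p c where c: "c \<in> A" "p \<in> fst c" using ne by (auto simp: manifold_points_def)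
  let ?y = "snd c p"
  have y: "?y \<in> snd c ` fst c" using c by blast
  obtain b :: 'b where "b \<in> Basis" using nonempty_Basis by blast
  then have b: "G c ?y b b > 0" by (intro metric_pos[OF c(1) y]) auto
  define R where "R = - c\<^sub>1 / K"
  have R: "R > 0" "K * R = - c\<^sub>1" using K c\<^sub>1 by (auto simp: R_def field_simps)
  \<comment> \<open>The basis vector is rescaled to squared norm \<open>R\<close>, the square of
    \<open>r\<^sub>0\<close>, so the multiples \<open>t *\<^sub>R x\<close> reach the boundary
    exactly at \<open>t = 1\<close>.\<close>
  define x where "x = sqrt (R / G c ?y b b) *\<^sub>R b"
  have x: "G c ?y x x = R" unfolding x_def metric_scale[OF c(1) y] using R b by simp
  have sq: "sq c (?y, t *\<^sub>R x) = t\<^sup>2 * R" for t by (simp add: sq_def metric_scale[OF c(1) y] x)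
  have scale: "c\<^sub>1 + K * sq c (?y, t *\<^sub>R x) = c\<^sub>1 * (1 - t\<^sup>2)" for t
  proof -
    have "c\<^sub>1 + K * (t\<^sup>2 * R) = c\<^sub>1 + t\<^sup>2 * (K * R)" by simp
    then show ?thesis unfolding sq R(2) by (simp add: algebra_simps)
  qed
  have img: "(?y, t *\<^sub>R x) \<in> chart_image c" if "0 \<le> t" "t < 1" for t
  proof -
    have "t\<^sup>2 < 1" using that by (simp add: power_less_one_iff abs_square_less_1)
    then show ?thesis using chart_image_iff[OF c(1)] y scale c\<^sub>1 by simp
  qed
  \<comment> \<open>Each step divides the remaining gap by 4, which only halves the lower bound on
    \<open>scale\<close>. The squared step bound thus decays like
    \<open>16^(-n) * 2^n = 8^(-n)\<close>, faster than the \<open>4^(-n)\<close> that a geometric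
    bound with ratio 1/2 asks for.\<close>
  define t where "t n = 1 - (1/4::real) ^ n" for n
  have t: "0 \<le> t n" "t n < 1" for n by (auto simp: t_def power_le_one)
  define \<sigma> where "\<sigma> n = chart_inv (bc c) (?y, t n *\<^sub>R x)" for n
  have \<sigma>_pt: "\<sigma> n = chart_point c (?y, t n *\<^sub>R x)" for n
    unfolding \<sigma>_def by (rule chart_inv_bc[OF c(1) img[OF t]])
  have \<sigma>_W: "\<sigma> n \<in> W" for n using img[OF t, of n] by (simp add: \<sigma>_pt chart_image_def)
  \<comment> \<open>The factor 2 comes from the exponent \<open>Suc n\<close> in the lower bound on
    \<open>scale\<close>; the remaining numerical factor 9/16 is at most 1 and is dropped.\<close>
  define C where "C = sqrt (2 * R / sqrt c\<^sub>1)"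
  have "BM.d (\<sigma> n) (\<sigma> (Suc n)) \<le> C * (1/2) ^ n" for n
    unfolding \<sigma>_def
  proof (rule BM.dist_chart_segment[OF bc_in_atlas[OF c(1)]])
    let ?h = "(?y, t (Suc n) *\<^sub>R x) - (?y, t n *\<^sub>R x)"
    have pt: "\<exists>\<tau>. t n \<le> \<tau> \<and> \<tau> \<le> t (Suc n) \<and> z = (?y, \<tau> *\<^sub>R x)"
      if zz: "z \<in> closed_segment (?y, t n *\<^sub>R x) (?y, t (Suc n) *\<^sub>R x)" for z
    proof -
      have "\<exists>u. 0 \<le> u \<and> u \<le> 1 \<and> z = (1 - u) *\<^sub>R (?y, t n *\<^sub>R x) + u *\<^sub>R (?y, t (Suc n) *\<^sub>R x)"
        using zz by (simp only: closed_segment_def mem_Collect_eq conj_assoc) metis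
      then obtain u where u: "0 \<le> u" "u \<le> 1" "z = (1 - u) *\<^sub>R (?y, t n *\<^sub>R x) + u *\<^sub>R (?y, t (Suc n) *\<^sub>R x)"
        by (elim exE conjE)
      let ?\<tau> = "(1 - u) * t n + u * t (Suc n)"
      have le: "t n \<le> t (Suc n)" by (simp add: t_def)
      have "z = (?y, ?\<tau> *\<^sub>R x)" unfolding u(3) by (simp add: algebra_simps)
      moreover have "t n \<le> ?\<tau>" "?\<tau> \<le> t (Suc n)"
        using convex_bound_le[of "- t n" "- t n" "- t (Suc n)" "1 - u" u] convex_bound_le[of "t n" "t (Suc n)" "t (Suc n)" "1 - u" u] u(1,2) le
        by auto
      ultimately show ?thesis by blast
    qed
    have seg: "closed_segment (?y, t n *\<^sub>R x) (?y, t (Suc n) *\<^sub>R x) \<subseteq> chart_image c"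
    proof
      fix z assume "z \<in> closed_segment (?y, t n *\<^sub>R x) (?y, t (Suc n) *\<^sub>R x)"
      then obtain \<tau> where "t n \<le> \<tau>" "\<tau> \<le> t (Suc n)" "z = (?y, \<tau> *\<^sub>R x)" using pt by blast
      then show "z \<in> chart_image c" using img[of \<tau>] t(1)[of n] t(2)[of "Suc n"] by simp
    qed
    then show "closed_segment (?y, t n *\<^sub>R x) (?y, t (Suc n) *\<^sub>R x) \<subseteq> snd (bc c) ` fst (bc c)"
      unfolding bc_image[OF c(1)] .
    show "0 \<le> C * (1/2) ^ n" using R(1) c\<^sub>1 by (simp add: C_def)
    fix z assume z: "z \<in> closed_segment (?y, t n *\<^sub>R x) (?y, t (Suc n) *\<^sub>R x)"
    obtain \<tau> where \<tau>: "t n \<le> \<tau>" "\<tau> \<le> t (Suc n)" "z = (?y, \<tau> *\<^sub>R x)" using pt[OF z] by blast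
    have z': "z \<in> chart_image c" using seg z by blast
    let ?\<Delta> = "3 * (1/4) ^ Suc n"
    have h: "?h = (0, ?\<Delta> *\<^sub>R x)" by (simp add: t_def algebra_simps flip: scaleR_add_left)
    have \<tau>01: "0 \<le> \<tau>" "\<tau> \<le> 1" using \<tau> t(1)[of n] t(2)[of "Suc n"] by auto
    \<comment> \<open>On the whole step the gap to the boundary is at least its final value, which
      bounds the radicand and hence \<open>scale\<close> from below.\<close>
    have "(1/4) ^ Suc n \<le> 1 - \<tau>" using \<tau>(2) by (simp add: t_def)
    also have "1 - \<tau> \<le> 1 - \<tau>\<^sup>2" using \<tau>01 by (simp add: power2_eq_square mult_left_le)
    finally have "c\<^sub>1 * (1/4) ^ Suc n \<le> c\<^sub>1 + K * sq c z" unfolding \<tau>(3) scale using c\<^sub>1 by simp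
    then have "sqrt (c\<^sub>1 * (1/4) ^ Suc n) \<le> scale c z" unfolding scale_def by (rule real_sqrt_le_mono)
    then have s: "sqrt c\<^sub>1 * (1/2) ^ Suc n \<le> scale c z"
      by (simp add: real_sqrt_mult real_sqrt_power real_sqrt_divide)
    \<comment> \<open>The base point does not move, so the horizontal part and the Christoffel term
      both vanish.\<close>
    have "vert c z ?h = ?\<Delta> *\<^sub>R x"
      unfolding h vert_def by (simp add: \<tau>(3) bilinear_lzero[OF christoffel_bilinear[OF c(1) y]])
    then have "GB (bc c) z ?h ?h = 1 / scale c z * (?\<Delta>\<^sup>2 * R)"
      unfolding GW_chart[OF c(1) z'] using metric_scale[OF c(1) y, of ?\<Delta> x]
      by (simp add: \<tau>(3) x bilinear_lzero[OF metric_bilinear[OF c(1) y]])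
    also have "\<dots> \<le> 1 / (sqrt c\<^sub>1 * (1/2) ^ Suc n) * (?\<Delta>\<^sup>2 * R)"
      using s scale_pos[OF c(1) z'] c\<^sub>1 R(1) by (intro mult_right_mono divide_left_mono) auto
    also have "\<dots> \<le> (C * (1/2) ^ n)\<^sup>2"
    proof -
      have e4: "(1/4::real) ^ n = (1/2) ^ n * (1/2) ^ n" by (simp flip: power_mult_distrib)
      have "1 / (sqrt c\<^sub>1 * (1/2) ^ Suc n) * (?\<Delta>\<^sup>2 * R) = 2 * R / sqrt c\<^sub>1 * ((9/16) * ((1/2) ^ n) ^ 3)"
      proof -
        have "1 / (a * (b * (1/2))) * ((3 * (b * b * (1/4)))\<^sup>2 * R) = 2 * R / a * (9/16 * b ^ 3)"
          if "a > 0" "b > 0" for a b :: real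
          using that by (simp add: field_simps power2_eq_square power3_eq_cube)
        from this[of "sqrt c\<^sub>1" "(1/2) ^ n"] show ?thesis using c\<^sub>1 by (simp add: e4 mult_ac)
      qed
      also have "\<dots> \<le> 2 * R / sqrt c\<^sub>1 * ((1/2) ^ n)\<^sup>2"
      proof (rule mult_left_mono)
        have "((1/2::real) ^ n) ^ 3 \<le> ((1/2) ^ n)\<^sup>2" by (rule power_decreasing) (auto simp: power_le_one)
        moreover have "((1/2::real) ^ n) ^ 3 \<ge> 0" by simp
        ultimately show "9/16 * ((1/2::real) ^ n) ^ 3 \<le> ((1/2) ^ n)\<^sup>2" by linarith
      qed (use R(1) c\<^sub>1 in simp)
      also have "\<dots> = (C * (1/2) ^ n)\<^sup>2" using R(1) c\<^sub>1 by (simp add: C_def power_mult_distrib)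
      finally show ?thesis .
    qed
    finally show "GB (bc c) z ?h ?h \<le> (C * (1/2) ^ n)\<^sup>2" .
  qed
  then have "BM.MCauchy \<sigma>"
    using \<sigma>_W R(1) c\<^sub>1 by (intro BM.MCauchy_geometric[of _ C]) (auto simp: bundle_points C_def)
  then obtain e where "limitin BM.mtopology \<sigma> e sequentially" using complete unfolding BM.mcomplete_def by blast
  then have e: "e \<in> W" and lim: "\<And>\<epsilon>. \<epsilon> > 0 \<Longrightarrow> \<forall>\<^sub>F n in sequentially. BM.d (\<sigma> n) e < \<epsilon>"
    unfolding BM.limitin_metric unfolding bundle_points by (auto elim: eventually_mono)
  obtain L where L: "L > 0" "\<forall>e\<in>W. \<forall>e'\<in>W. \<bar>log_norm e - log_norm e'\<bar> \<le> L * BM.d e e'"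
    using log_norm_dist by blast
  have "(\<lambda>n. log_norm (\<sigma> n)) \<longlonglongrightarrow> log_norm e"
  proof (rule tendstoI)
    fix \<epsilon> :: real assume \<epsilon>: "\<epsilon> > 0"
    then have "\<epsilon> / L > 0" using L(1) by simp
    from lim[OF this] show "\<forall>\<^sub>F n in sequentially. dist (log_norm (\<sigma> n)) (log_norm e) < \<epsilon>"
    proof eventually_elim
      fix n assume "BM.d (\<sigma> n) e < \<epsilon> / L"
      then have "L * BM.d (\<sigma> n) e < \<epsilon>" using L(1) by (simp add: pos_less_divide_eq mult.commute)
      moreover have "\<bar>log_norm (\<sigma> n) - log_norm e\<bar> \<le> L * BM.d (\<sigma> n) e"
        using L(2) \<sigma>_W e by blast
      ultimately show "dist (log_norm (\<sigma> n)) (log_norm e) < \<epsilon>" by (simp add: dist_real_def)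
    qed
  qed
  moreover have "(\<lambda>n. log_norm (\<sigma> n)) \<longlonglongrightarrow> ln (1 + R)"
  proof -
    have "log_norm (\<sigma> n) = ln (1 + (t n)\<^sup>2 * R)" for n
      using tnorm_chart_point[OF c(1), of "(?y, t n *\<^sub>R x)"] y R(1) by (simp add: log_norm_def \<sigma>_pt sq)
    moreover have "t \<longlonglongrightarrow> 1 - 0" unfolding t_def by (intro tendsto_intros LIMSEQ_realpow_zero) auto
    then have "(\<lambda>n. ln (1 + (t n)\<^sup>2 * R)) \<longlonglongrightarrow> ln (1 + (1 - 0)\<^sup>2 * R)"
      using R(1) by (intro tendsto_intros) auto
    ultimately show ?thesis by simp
  qed
  ultimately have "log_norm e = ln (1 + R)" by (rule LIMSEQ_unique)
  moreover have "log_norm e < ln (1 + R)"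
  proof -
    \<comment> \<open>Membership in the disk is a strict inequality, whereas the limit value just
      found corresponds to norm exactly \<open>r\<^sub>0\<close>.\<close>
    have tn: "tnorm g (fst e) (snd e) < sqrt R" using e K by (auto simp: disk_bundle_def r\<^sub>0 R_def)
    obtain d where d: "d \<in> A" "fst e \<in> fst d" using W_base[OF e] by (auto simp: manifold_points_def)
    have "tnorm g (fst e) (snd e) \<ge> 0"
      using tnorm_chart_vec[OF d, of "snd e d"] chart_vec_of_tangent[OF d W_tangent[OF e]]
        metric_nonneg[OF d(1), of "snd d (fst e)"] d(2) by simp
    then have "(tnorm g (fst e) (snd e))\<^sup>2 < (sqrt R)\<^sup>2" using tn by (intro power_strict_mono) auto
    then show ?thesis unfolding log_norm_def using R(1) by (simp add: add_pos_nonneg)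
  qed
  ultimately show False by simp
qed

end

theorem theorem3p3:
  fixes A :: "('a, 'b::euclidean_space) chart set"
    and g :: "('a, 'b) metric_tensor"
    and K c\<^sub>1 :: real
    and r\<^sub>0 :: ereal
  assumes "smooth_manifold A"
    and "DIM('b) > 1"
    and "connected_space (atlas_topology A)"
    and "riemannian_metric A g"
    and "riemannian_complete A g"
    and "constant_sectional_curvature A g K"
    and "c\<^sub>1 > 0"
    and "r\<^sub>0 = (if K < 0 then ereal (sqrt (- c\<^sub>1 / K)) else \<infinity>)"
  shows "(K \<ge> 0 \<longrightarrow>
            riemannian_complete (bundle_atlas A (disk_bundle A g r\<^sub>0)) (disk_bundle_metric A g c\<^sub>1 K r\<^sub>0)) \<and>
         (K < 0 \<longrightarrow>
            \<not> riemannian_complete (bundle_atlas A (disk_bundle A g r\<^sub>0)) (disk_bundle_metric A g c\<^sub>1 K r\<^sub>0))"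
proof -
  interpret disk_bundle_setup A g K c\<^sub>1 r\<^sub>0 by unfold_locales (use assms in auto)
  have "manifold_points A \<noteq> {}" using assms(1) by (simp add: smooth_manifold_def)
  with bundle_complete bundle_incomplete assms(5) show ?thesis
    unfolding riemannian_complete_def by blast
qed

end
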